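(* Let $k\ge 2$ be an integer, $p>2$, and $U\in L^p_{sym}([0,1]^2)$. Let $X=(X_1,\dots,X_k)$ be a uniform random vector in $[0,1]^k$. For any $\phi\in\left(0,\frac12-\frac1p\right)$, with probability at least $1-e^{\frac{-k^2}{2\log_2 k}}-4k^{-\phi p}$, $$\delta_\square(\mathcal{U}_X,U)\le \frac{C}{(\ln k)^{\frac12-\frac1{2p}}},$$ where $C$ depends only on $p$, $\|U\|_1$, $\|U\|_p$ and $\phi$ (in particular, $C$ does not depend on $k$).
   Context: $L^p_{sym}([0,1]^2)$ is the set of symmetric real-valued measurable functions ("kernels") $U:[0,1]^2\to\mathbb{R}$ with $\|U\|_p=\left(\int_{[0,1]^2}|U|^p\right)^{1/p}<\infty$. Here $1\le p<\infty$. For $X=(X_1,\dots,X_k)$ with $X_1,\dots,X_k$ i.i.d. uniform on $[0,1]$, the sample $\mathcal{U}_X$ is the step function on $[0,1]^2$ with uniform steps of length $1/k$ in each variable, taking on $[(i-1)/k,i/k]\times[(j-1)/k,j/k]$ the value $U(X_i,X_j)$ if $i\ne j$ and $0$ if $i=j$. The cut norm of $W\in L^1([0,1]^2)$ is $\|W\|_\square=\sup_{S,T\subseteq[0,1]}\left|\int_{S\times T}W(x,y)\,dx\,dy\right|$ (supremum over measurable sets). The cut distance of $U_1,U_2\in L^1([0,1]^2)$ is $\delta_\square(U_1,U_2)=\inf_{\psi\in\Psi}\|U_1-U_2\circ\psi\|_\square$, where $\Psi$ is the set of measure preserving bijections $[0,1]\to[0,1]$ and $(U_2\circ\psi)(x,y)=U_2(\psi(x),\psi(y))$.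 *)

theory Defs
  imports "HOL-Probability.Probability"
begin

abbreviation unit_interval :: "real set"
  where "unit_interval \<equiv> {0..1}"

abbreviation unit_square :: "(real \<times> real) set"
  where "unit_square \<equiv> unit_interval \<times> unit_interval"

text \<open>
  Functions on the unit square are total functions of type \<^typ>\<open>real \<times> real \<Rightarrow> real\<close>
  whose values outside the square are irrelevant. Measurable means Lebesgue measurable throughout.
\<close>

definition Lp_norm :: "real \<Rightarrow> (real \<times> real \<Rightarrow> real) \<Rightarrow> real"
  where "Lp_norm p U = (LINT z:unit_square|lebesgue. \<bar>U z\<bar> powr p) powr (1 / p)"

definition Lp_sym :: "real \<Rightarrow> (real \<times> real \<Rightarrow> real) set"
  where "Lp_sym p = {U.
    set_borel_measurable lebesgue unit_square U \<and>
    (\<forall>x\<in>unit_interval. \<forall>y\<in>unit_interval. U (x, y) = U (y, x)) \<and>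
    set_integrable lebesgue unit_square (\<lambda>z. \<bar>U z\<bar> powr p)}"

text \<open>
  Steps and sample points are numbered from 0. The steps are half-open, except that the last one
  contains the point 1; this fixes the values on the common boundaries of the closed steps, a null set.
\<close>

definition step_index :: "nat \<Rightarrow> real \<Rightarrow> nat"
  where "step_index k x = min (k - 1) (nat \<lfloor>real k * x\<rfloor>)"

definition sample :: "nat \<Rightarrow> (real \<times> real \<Rightarrow> real) \<Rightarrow> (nat \<Rightarrow> real) \<Rightarrow> real \<times> real \<Rightarrow> real"
  where "sample k U X = (\<lambda>(x, y).
    let i = step_index k x; j = step_index k y in if i = j then 0 else U (X i, X j))"

text \<open>
  The supremum is taken in the reals, so it is meaningful for functions integrable on the unit
  square, for which the set of values is bounded. The same applies to the cut distance.
\<close>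

definition cut_norm :: "(real \<times> real \<Rightarrow> real) \<Rightarrow> real"
  where "cut_norm W =
    (SUP (S, T) \<in> sets (lebesgue_on unit_interval) \<times> sets (lebesgue_on unit_interval).
      \<bar>LINT z:S \<times> T|lebesgue. W z\<bar>)"

definition mp_bijections :: "(real \<Rightarrow> real) set"
  where "mp_bijections = {\<psi>.
    bij_betw \<psi> unit_interval unit_interval \<and>
    \<psi> \<in> lebesgue_on unit_interval \<rightarrow>\<^sub>M lebesgue_on unit_interval \<and>
    distr (lebesgue_on unit_interval) (lebesgue_on unit_interval) \<psi> = lebesgue_on unit_interval}"

definition cut_dist :: "(real \<times> real \<Rightarrow> real) \<Rightarrow> (real \<times> real \<Rightarrow> real) \<Rightarrow> real"
  where "cut_dist U\<^sub>1 U\<^sub>2 =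
    (INF \<psi>\<in>mp_bijections. cut_norm (\<lambda>(x, y). U\<^sub>1 (x, y) - U\<^sub>2 (\<psi> x, \<psi> y)))"

text \<open>
  The law of a uniform random vector in the \<open>k\<close>-dimensional unit cube. It is completed because
  \<open>U (X i, X j)\<close> is in general measurable in \<open>X\<close> only for the completed product measure when
  \<open>U\<close> is merely Lebesgue measurable.
\<close>

definition uniform_vector :: "nat \<Rightarrow> (nat \<Rightarrow> real) measure"
  where "uniform_vector k =
    completion (PiM {..<k} (\<lambda>_. uniform_measure lborel unit_interval))"

end

theory Submission imports Defs "HOL-Real_Asymp.Real_Asymp"
begin

text \<open>
  Only \<open>L\<^sup>2\<close> enters the approximation. Up to a small error in \<open>L\<^sup>1\<close>, estimated by Markov's inequality, \<open>U\<close>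
  is an \<open>n \<times> n\<close> step function \<open>A\<close> with \<open>\<bar>A\<bar> \<le> k powr (1/2 - d)\<close>, where \<open>n\<close> may be arbitrarily large. Subtracting greedily
  \<open>m \<approx> ln k / 8\<close> rectangles leaves a remainder \<open>R\<close> of cut norm \<open>\<parallel>U\<parallel>\<^sub>2 / sqrt m\<close> at most.
  The step structure has only \<open>4\<^sup>m\<close> types of points, so the sample of \<open>A - R\<close> matches a rearrangement of
  \<open>A - R\<close> up to a negative power of \<open>k\<close>. The expected cut norm of the sample of \<open>R\<close> is, after decoupling rows from
  columns, at most a constant times the cut norm of \<open>R\<close> plus \<open>O(1 / sqrt k)\<close>: symmetrization and the
  contraction principle, applied first to the columns and then to the rows, replace the suprema by norms of random
  sums. Bounded differences then give concentration. The failure probability \<open>k powr (- \<phi> p)\<close>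
  dominates everything for large \<open>k\<close>; small \<open>k\<close> are absorbed by the constant.
\<close>

section \<open>Averages over finite product sets\<close>

text \<open>Replacing \<open>U\<close> by a step function turns the sample points into uniform
  indices in \<open>{..<n}\<close>, so every expectation becomes a finite average \<open>avg\<close>
  and every supremum a \<open>Max\<close>; no estimate involves \<open>n\<close>. Two demands fix
  the truncation level \<open>M = k powr (1/2 - d)\<close>: bounded differences needs
  \<open>M\<^sup>2\<close> to be a power of \<open>k\<close> below \<open>k\<close>, while Markov's
  inequality loses \<open>M powr (1 - p)\<close>, up to a logarithm, and this must stay below
  \<open>k powr (- \<phi> p)\<close>. Since \<open>\<phi> p < p/2 - 1 < (p - 1)/2\<close>, a small
  \<open>d\<close> serves both. The number \<open>m\<close> of rectangles is held to a small
  multiple of \<open>ln k\<close> so that \<open>4 ^ m / sqrt k\<close>, the error in the type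
  frequencies, is still a negative power of \<open>k\<close>; the leading error is then of order
  \<open>1 / sqrt (ln k)\<close>. The rearrangement must be an honest measure preserving bijection:
  it permutes the \<open>k * n\<close> cells that refine both the \<open>k\<close> steps of the
  sample and the \<open>n\<close> steps of \<open>A\<close>. Finally, \<open>cut_dist\<close> is an
  infimum of suprema over uncountable families, so measurability of the event is a separate matter,
  settled by continuity in the entries of the sample.\<close>

definition avg :: "'a set \<Rightarrow> ('a \<Rightarrow> real) \<Rightarrow> real"
  where "avg A f = sum f A / real (card A)"

lemma avg_cong: "(\<And>a. a \<in> A \<Longrightarrow> f a = g a) \<Longrightarrow> avg A f = avg A g"
  by (simp add: avg_def)

lemma avg_mono: "(\<And>a. a \<in> A \<Longrightarrow> f a \<le> g a) \<Longrightarrow> avg A f \<le> avg A g"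
  by (simp add: avg_def divide_right_mono sum_mono)

lemma avg_nonneg: "(\<And>a. a \<in> A \<Longrightarrow> 0 \<le> f a) \<Longrightarrow> 0 \<le> avg A f"
  by (simp add: avg_def sum_nonneg)

lemma avg_add: "avg A (\<lambda>a. f a + g a) = avg A f + avg A g"
  by (simp add: avg_def sum.distrib add_divide_distrib)

lemma avg_diff: "avg A (\<lambda>a. f a - g a) = avg A f - avg A g"
  by (simp add: avg_def sum_subtractf diff_divide_distrib)

lemma avg_cmult: "avg A (\<lambda>a. c * f a) = c * avg A f"
  by (simp add: avg_def sum_distrib_left[symmetric])

lemma avg_mult_right: "avg A (\<lambda>a. f a * c) = avg A f * c"
  by (simp add: avg_def sum_distrib_right[symmetric])

lemma avg_const: "finite A \<Longrightarrow> A \<noteq> {} \<Longrightarrow> avg A (\<lambda>_. c) = c"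
  by (simp add: avg_def)

lemma avg_sum: "avg A (\<lambda>a. \<Sum>i\<in>I. f i a) = (\<Sum>i\<in>I. avg A (f i))"
  by (simp add: avg_def sum.swap[of _ A] sum_divide_distrib)

lemma avg_swap: "avg A (\<lambda>a. avg B (f a)) = avg B (\<lambda>b. avg A (\<lambda>a. f a b))"
  by (simp add: avg_def sum_divide_distrib[symmetric] sum.swap[of _ A] mult.commute)

lemma avg_abs_le: "\<bar>avg A f\<bar> \<le> avg A (\<lambda>a. \<bar>f a\<bar>)"
  by (simp add: avg_def divide_right_mono)

lemma avg_le_const: "finite A \<Longrightarrow> A \<noteq> {} \<Longrightarrow> (\<And>a. a \<in> A \<Longrightarrow> f a \<le> c) \<Longrightarrow> avg A f \<le> c"
  using avg_mono[of A f "\<lambda>_. c"] by (simp add: avg_const)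

text \<open>Conditioning on all coordinates but \<open>i\<close>, through the bijection that sends
  \<open>(a, x)\<close> to \<open>x(i := a)\<close>. The inductions over index sets below peel off
  one coordinate with it.\<close>

lemma avg_insert_PiE:
  assumes "i \<notin> I"
  shows "avg (PiE (insert i I) (\<lambda>_. Z)) f =
    avg (PiE I (\<lambda>_. Z)) (\<lambda>x. avg Z (\<lambda>a. f (x(i := a))))"
proof -
  let ?g = "\<lambda>(a, x). x(i := a)"
  have inj: "inj_on ?g (Z \<times> PiE I (\<lambda>_. Z))"
    using assms by (rule inj_combinator)
  have eq: "PiE (insert i I) (\<lambda>_. Z) = ?g ` (Z \<times> PiE I (\<lambda>_. Z))"
    by (simp add: PiE_insert_eq)
  have "sum f (PiE (insert i I) (\<lambda>_. Z)) = (\<Sum>(a,x)\<in>Z \<times> PiE I (\<lambda>_. Z). f (x(i := a)))"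
    unfolding eq using inj by (subst sum.reindex) (auto simp: case_prod_unfold)
  also have "\<dots> = (\<Sum>x\<in>PiE I (\<lambda>_. Z). \<Sum>a\<in>Z. f (x(i := a)))"
    by (subst sum.cartesian_product[symmetric], subst sum.swap) simp
  finally have s: "sum f (PiE (insert i I) (\<lambda>_. Z)) = \<dots>" .
  have c: "card (PiE (insert i I) (\<lambda>_. Z)) = card Z * card (PiE I (\<lambda>_. Z))"
    unfolding eq using inj by (subst card_image) (auto simp: card_cartesian_product)
  show ?thesis
    by (simp add: avg_def s c sum_divide_distrib[symmetric])
qed

lemma avg_PiE_coord:
  assumes "finite I" "i \<in> I" "finite Z" "Z \<noteq> {}"
  shows "avg (PiE I (\<lambda>_. Z)) (\<lambda>x. f (x i)) = avg Z f"
proof -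
  obtain J where J: "I = insert i J" "i \<notin> J" using assms(2) by (metis Set.set_insert)
  have "finite (PiE J (\<lambda>_. Z))" "PiE J (\<lambda>_. Z) \<noteq> {}"
    using assms J by (auto simp: PiE_eq_empty_iff intro: finite_PiE)
  then show ?thesis unfolding J(1)
    by (subst avg_insert_PiE[OF J(2)]) (simp add: avg_const)
qed

text \<open>Variance of independent centred terms: averaging over the new coordinate
  \<open>a\<close> first kills the cross term, because \<open>avg Z f = 0\<close>.\<close>

lemma avg_PiE_sum_squared:
  assumes "finite I" "finite Z" "Z \<noteq> {}" "avg Z f = 0"
  shows "avg (PiE I (\<lambda>_. Z)) (\<lambda>x. (\<Sum>i\<in>I. f (x i))\<^sup>2) = real (card I) * avg Z (\<lambda>a. (f a)\<^sup>2)"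
  using assms(1)
proof induction
  case empty
  then show ?case by (simp add: avg_def)
next
  case (insert i I)
  let ?P = "PiE I (\<lambda>_. Z)"
  have ne: "finite ?P" "?P \<noteq> {}"
    using assms insert by (auto simp: PiE_eq_empty_iff intro: finite_PiE)
  have "avg (PiE (insert i I) (\<lambda>_. Z)) (\<lambda>x. (\<Sum>i\<in>insert i I. f (x i))\<^sup>2)
    = avg ?P (\<lambda>x. avg Z (\<lambda>a. (f a)\<^sup>2 + 2 * (\<Sum>j\<in>I. f (x j)) * f a + (\<Sum>j\<in>I. f (x j))\<^sup>2))"
    unfolding avg_insert_PiE[OF insert(2)]
  proof (intro avg_cong)
    fix x a
    have "(\<Sum>j\<in>I. f ((x(i := a)) j)) = (\<Sum>j\<in>I. f (x j))"
      using insert(2) by (intro sum.cong) auto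
    then show "(\<Sum>j\<in>insert i I. f ((x(i := a)) j))\<^sup>2
        = (f a)\<^sup>2 + 2 * (\<Sum>j\<in>I. f (x j)) * f a + (\<Sum>j\<in>I. f (x j))\<^sup>2"
      using insert(1,2) by (simp add: power2_sum algebra_simps)
  qed
  also have "\<dots> = avg Z (\<lambda>a. (f a)\<^sup>2) + avg ?P (\<lambda>x. (\<Sum>j\<in>I. f (x j))\<^sup>2)"
    using assms ne by (simp add: avg_add avg_cmult avg_const)
  finally show ?case using insert by (simp add: algebra_simps)
qed

lemma avg_squared_le:
  assumes "finite A"
  shows "(avg A f)\<^sup>2 \<le> avg A (\<lambda>a. (f a)\<^sup>2)"
proof (cases "A = {}")
  case False
  have "0 \<le> avg A (\<lambda>a. (f a - avg A f)\<^sup>2)" by (rule avg_nonneg) simp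
  also have "\<dots> = avg A (\<lambda>a. (f a)\<^sup>2 - 2 * avg A f * f a + (avg A f)\<^sup>2)"
    by (simp add: power2_diff algebra_simps)
  also have "\<dots> = avg A (\<lambda>a. (f a)\<^sup>2) - (avg A f)\<^sup>2"
    using assms False by (simp add: avg_add avg_diff avg_cmult avg_const power2_eq_square)
  finally show ?thesis by simp
qed (simp add: avg_def)

lemma avg_sqrt_le:
  assumes "finite A" "\<And>a. a \<in> A \<Longrightarrow> 0 \<le> f a"
  shows "avg A (\<lambda>a. sqrt (f a)) \<le> sqrt (avg A f)"
proof -
  have "(avg A (\<lambda>a. sqrt (f a)))\<^sup>2 \<le> avg A f"
    using avg_squared_le[OF assms(1), of "\<lambda>a. sqrt (f a)"] assms(2)
    by (simp cong: avg_cong)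
  then show ?thesis by (simp add: real_le_rsqrt)
qed

lemma avg_PiE_abs_sum_le:
  assumes "finite I" "finite Z" "Z \<noteq> {}" "avg Z f = 0"
  shows "avg (PiE I (\<lambda>_. Z)) (\<lambda>x. \<bar>\<Sum>i\<in>I. f (x i)\<bar>) \<le> sqrt (real (card I) * avg Z (\<lambda>a. (f a)\<^sup>2))"
  using avg_sqrt_le[of "PiE I (\<lambda>_. Z)" "\<lambda>x. (\<Sum>i\<in>I. f (x i))\<^sup>2"] avg_PiE_sum_squared[OF assms] assms
  by (simp add: finite_PiE)

lemma avg_Times: "avg (A \<times> B) f = avg A (\<lambda>a. avg B (\<lambda>b. f (a, b)))"
  by (simp add: avg_def sum.cartesian_product card_cartesian_product sum_divide_distrib[symmetric]
      case_prod_unfold mult.commute)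

lemma avg_PiE_Un:
  assumes "finite I" "I \<inter> J = {}"
  shows "avg (PiE (I \<union> J) (\<lambda>_. Z)) f =
    avg (PiE I (\<lambda>_. Z)) (\<lambda>u. avg (PiE J (\<lambda>_. Z)) (\<lambda>v. f (\<lambda>i. if i \<in> I then u i else v i)))"
  using assms
proof (induction I arbitrary: f)
  case empty
  then show ?case by (simp add: avg_def)
next
  case (insert i I)
  have "avg (PiE (insert i I \<union> J) (\<lambda>_. Z)) f =
    avg (PiE (I \<union> J) (\<lambda>_. Z)) (\<lambda>x. avg Z (\<lambda>a. f (x(i := a))))"
    using insert by (simp add: avg_insert_PiE)
  also have "\<dots> = avg (PiE I (\<lambda>_. Z)) (\<lambda>u. avg (PiE J (\<lambda>_. Z))
      (\<lambda>v. avg Z (\<lambda>a. f ((\<lambda>i. if i \<in> I then u i else v i)(i := a)))))"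
    using insert by (subst insert.IH) auto
  also have "\<dots> = avg (PiE I (\<lambda>_. Z)) (\<lambda>u. avg Z (\<lambda>a. avg (PiE J (\<lambda>_. Z))
      (\<lambda>v. f ((\<lambda>i. if i \<in> I then u i else v i)(i := a)))))"
    by (subst (2) avg_swap) simp
  also have "\<dots> = avg (PiE (insert i I) (\<lambda>_. Z)) (\<lambda>u. avg (PiE J (\<lambda>_. Z))
      (\<lambda>v. f (\<lambda>j. if j \<in> insert i I then u j else v j)))"
    unfolding avg_insert_PiE[OF insert(2)] using insert
    by (intro avg_cong arg_cong[of _ _ f]) auto
  finally show ?case .
qed

section \<open>Exponential moments and bounded differences\<close>

lemma cosh_le_exp_half_square: "exp t + exp (- t) \<le> 2 * exp (t\<^sup>2 / 2)" for t :: real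
proof -
  have s: "(\<lambda>n. t ^ n /\<^sub>R fact n) sums exp t" "(\<lambda>n. (- t) ^ n /\<^sub>R fact n) sums exp (- t)"
    by (rule exp_converges)+
  from sums_add[OF this] have "(\<lambda>n. (t ^ n + (- t) ^ n) / fact n) sums (exp t + exp (- t))"
    by (simp add: field_simps)
  moreover have "(\<lambda>n. (t ^ n + (- t) ^ n) / fact n) = (\<lambda>n. if even n then 2 * t ^ n / fact n else 0)"
    by auto
  ultimately have "(\<lambda>n. if even n then 2 * t ^ n / fact n else 0) sums (exp t + exp (- t))" by simp
  \<comment> \<open>Grouping the series in pairs discards the vanishing odd terms, so that it can be
    compared with the series of \<open>exp (t\<^sup>2 / 2)\<close> term by term.\<close>
  from sums_group[OF this, of 2] have 1: "(\<lambda>n. 2 * t ^ (2 * n) / fact (2 * n)) sums (exp t + exp (- t))"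
    by (simp add: mult.commute)
  have 2: "(\<lambda>n. 2 * ((t\<^sup>2 / 2) ^ n /\<^sub>R fact n)) sums (2 * exp (t\<^sup>2 / 2))"
    by (intro sums_mult exp_converges)
  show ?thesis
  proof (rule sums_le[OF _ 1 2])
    fix n
    have "2 ^ n * fact n \<le> (fact (2 * n) :: real)"
    proof (induction n)
      case (Suc n)
      have "(2::real) ^ Suc n * fact (Suc n) = (2 * real n + 2) * (2 ^ n * fact n)"
        by (simp add: algebra_simps)
      also have "\<dots> \<le> (2 * real n + 2) * fact (2 * n)" using Suc by (intro mult_left_mono) auto
      also have "\<dots> \<le> (2 * real n + 2) * ((2 * real n + 1) * fact (2 * n))"
        by (intro mult_left_mono) (auto simp: mult_le_cancel_right1)
      also have "\<dots> = fact (2 * Suc n)" by (simp add: algebra_simps)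
      finally show ?case .
    qed simp
    then have "t ^ (2 * n) / fact (2 * n) \<le> t ^ (2 * n) / (2 ^ n * fact n)"
      by (intro divide_left_mono) auto
    also have "\<dots> = (t\<^sup>2 / 2) ^ n /\<^sub>R fact n"
      by (simp add: power_divide power_mult[symmetric] field_simps)
    finally show "2 * t ^ (2 * n) / fact (2 * n) \<le> 2 * ((t\<^sup>2 / 2) ^ n /\<^sub>R fact n)" by simp
  qed
qed

lemma exp_avg_le:
  assumes "finite A" "A \<noteq> {}"
  shows "exp (avg A f) \<le> avg A (\<lambda>a. exp (f a))"
proof -
  have "avg A f = (\<Sum>a\<in>A. (1 / real (card A)) *\<^sub>R f a)"
    by (simp add: avg_def sum_divide_distrib)
  also have "exp \<dots> \<le> (\<Sum>a\<in>A. (1 / real (card A)) * exp (f a))"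
    using assms by (intro convex_on_sum[OF _ _ exp_convex]) auto
  finally show ?thesis by (simp add: avg_def sum_divide_distrib)
qed

text \<open>Hoeffding's lemma by symmetrization: Jensen's inequality replaces the mean by an
  independent copy \<open>b\<close>; since \<open>a\<close> and \<open>b\<close> are exchangeable,
  the exponential may be replaced by a hyperbolic cosine. The constant 1/2 instead of the optimal
  1/8 is the price of this short route.\<close>

lemma avg_exp_deviation_le:
  assumes "finite Z" "Z \<noteq> {}" and c: "\<And>a b. a \<in> Z \<Longrightarrow> b \<in> Z \<Longrightarrow> \<bar>g a - g b\<bar> \<le> c"
  shows "avg Z (\<lambda>a. exp (l * (g a - avg Z g))) \<le> exp (l\<^sup>2 * c\<^sup>2 / 2)"
proof -
  have "avg Z (\<lambda>a. exp (l * (g a - avg Z g))) \<le> avg Z (\<lambda>a. avg Z (\<lambda>b. exp (l * (g a - g b))))"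
  proof (rule avg_mono)
    fix a
    have "l * (g a - avg Z g) = avg Z (\<lambda>b. l * (g a - g b))"
      using assms by (simp add: avg_cmult avg_diff avg_const)
    then show "exp (l * (g a - avg Z g)) \<le> avg Z (\<lambda>b. exp (l * (g a - g b)))"
      using exp_avg_le[OF assms(1,2)] by simp
  qed
  also have "\<dots> = avg Z (\<lambda>a. avg Z (\<lambda>b. 1 / 2 * (exp (l * (g a - g b)) + exp (- (l * (g a - g b))))))"
  proof -
    have "avg Z (\<lambda>a. avg Z (\<lambda>b. exp (l * (g a - g b)))) = avg Z (\<lambda>a. avg Z (\<lambda>b. exp (- (l * (g a - g b)))))"
      by (subst avg_swap) (simp add: algebra_simps)
    note sw = this
    have "avg Z (\<lambda>a. avg Z (\<lambda>b. 1 / 2 * (u a b + v a b)))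
        = 1 / 2 * (avg Z (\<lambda>a. avg Z (u a)) + avg Z (\<lambda>a. avg Z (v a)))" for u v :: "'a \<Rightarrow> 'a \<Rightarrow> real"
      by (simp only: avg_add avg_cmult)
    note ** = this[of "\<lambda>a b. exp (l * (g a - g b))" "\<lambda>a b. exp (- (l * (g a - g b)))"]
    have *: "a = 1 / 2 * (a + b)" if "a = b" for a b :: real using that by simp
    show ?thesis unfolding ** by (rule *) (rule sw)
  qed
  also have "\<dots> \<le> exp (l\<^sup>2 * c\<^sup>2 / 2)"
  proof (intro avg_le_const assms)
    fix a b assume ab: "a \<in> Z" "b \<in> Z"
    have "1 / 2 * (exp (l * (g a - g b)) + exp (- (l * (g a - g b)))) \<le> exp ((l * (g a - g b))\<^sup>2 / 2)"
      using cosh_le_exp_half_square[of "l * (g a - g b)"] by simp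
    also have "(g a - g b)\<^sup>2 \<le> c\<^sup>2" using c[OF ab] by (simp add: abs_le_square_iff[symmetric])
    then have "exp ((l * (g a - g b))\<^sup>2 / 2) \<le> exp (l\<^sup>2 * c\<^sup>2 / 2)"
      by (simp add: power_mult_distrib mult_left_mono)
    finally show "1 / 2 * (exp (l * (g a - g b)) + exp (- (l * (g a - g b)))) \<le> exp (l\<^sup>2 * c\<^sup>2 / 2)" .
  qed
  finally show ?thesis .
qed

text \<open>The induction plays the part of the martingale in McDiarmid's inequality:
  \<open>g\<close>, the conditional mean given the coordinates in \<open>I\<close>, inherits the
  increment bound \<open>c\<close>, and the deviation of \<open>f\<close> from \<open>g\<close>
  along the new coordinate falls under \<open>avg_exp_deviation_le\<close>.\<close>

lemma avg_exp_bounded_differences: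
  assumes "finite I" "finite Z" "Z \<noteq> {}"
    and "\<And>x i a. x \<in> PiE I (\<lambda>_. Z) \<Longrightarrow> i \<in> I \<Longrightarrow> a \<in> Z \<Longrightarrow> \<bar>f (x(i := a)) - f x\<bar> \<le> c"
  shows "avg (PiE I (\<lambda>_. Z)) (\<lambda>x. exp (l * (f x - avg (PiE I (\<lambda>_. Z)) f)))
    \<le> exp (real (card I) * (l\<^sup>2 * c\<^sup>2 / 2))"
  using assms(1,4)
proof (induction I arbitrary: f)
  case empty
  then show ?case by (simp add: avg_def)
next
  case (insert i I)
  let ?P = "PiE I (\<lambda>_. Z)"
  define g where "g x = avg Z (\<lambda>a. f (x(i := a)))" for x
  have upd: "x(i := a) \<in> PiE (insert i I) (\<lambda>_. Z)" if "x \<in> ?P" "a \<in> Z" for x a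
    using that by (rule PiE_fun_upd[rotated])
  have gl: "\<bar>g (x(j := b)) - g x\<bar> \<le> c" if x: "x \<in> ?P" "j \<in> I" "b \<in> Z" for x j b
  proof -
    have ij: "i \<noteq> j" using insert x by auto
    have "\<bar>g (x(j := b)) - g x\<bar> \<le> avg Z (\<lambda>a. \<bar>f ((x(i := a))(j := b)) - f (x(i := a))\<bar>)"
      unfolding g_def avg_diff[symmetric] using ij by (subst fun_upd_twist) (auto intro: avg_abs_le)
    also have "\<dots> \<le> c"
      using assms(2,3) x by (intro avg_le_const insert.prems upd) auto
    finally show ?thesis .
  qed
  have gc: "\<bar>f (x(i := a)) - f (x(i := b))\<bar> \<le> c" if "x \<in> ?P" "a \<in> Z" "b \<in> Z" for x a b
    using insert.prems[OF upd[of x b], of i a] that by (simp add: fun_upd_upd del: fun_upd_apply)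
  have "avg (PiE (insert i I) (\<lambda>_. Z)) (\<lambda>x. exp (l * (f x - avg (PiE (insert i I) (\<lambda>_. Z)) f)))
    = avg ?P (\<lambda>x. exp (l * (g x - avg ?P g)) * avg Z (\<lambda>a. exp (l * (f (x(i := a)) - g x))))"
    unfolding avg_insert_PiE[OF insert(2)] g_def[symmetric]
    by (intro avg_cong, unfold avg_cmult[symmetric] exp_add[symmetric])
       (simp add: ring_distribs)
  also have "\<dots> \<le> avg ?P (\<lambda>x. exp (l * (g x - avg ?P g)) * exp (l\<^sup>2 * c\<^sup>2 / 2))"
  proof (intro avg_mono mult_left_mono)
    fix x assume x: "x \<in> ?P"
    show "avg Z (\<lambda>a. exp (l * (f (x(i := a)) - g x))) \<le> exp (l\<^sup>2 * c\<^sup>2 / 2)"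
      unfolding g_def using assms gc[OF x] by (intro avg_exp_deviation_le) auto
  qed simp
  also have "\<dots> \<le> exp (real (card I) * (l\<^sup>2 * c\<^sup>2 / 2)) * exp (l\<^sup>2 * c\<^sup>2 / 2)"
    unfolding avg_mult_right by (intro mult_right_mono insert.IH gl) auto
  also have "\<dots> = exp (real (card (insert i I)) * (l\<^sup>2 * c\<^sup>2 / 2))"
    using insert by (simp add: exp_add[symmetric] algebra_simps)
  finally show ?case .
qed

lemma bounded_differences_tail:
  assumes "finite I" "I \<noteq> {}" "finite Z" "Z \<noteq> {}" "0 < c" "0 \<le> t"
    and "\<And>x i a. x \<in> PiE I (\<lambda>_. Z) \<Longrightarrow> i \<in> I \<Longrightarrow> a \<in> Z \<Longrightarrow> \<bar>f (x(i := a)) - f x\<bar> \<le> c"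
  shows "real (card {x \<in> PiE I (\<lambda>_. Z). f x \<ge> avg (PiE I (\<lambda>_. Z)) f + t}) / real (card Z ^ card I)
    \<le> exp (- (t\<^sup>2 / (2 * real (card I) * c\<^sup>2)))"
proof -
  let ?P = "PiE I (\<lambda>_. Z)"
  let ?B = "{x \<in> ?P. f x \<ge> avg ?P f + t}"
  \<comment> \<open>The minimiser of
    \<open>- l * t + card I * l\<^sup>2 * c\<^sup>2 / 2\<close>.\<close>
  define l where "l = t / (real (card I) * c\<^sup>2)"
  have l: "l \<ge> 0" using assms by (simp add: l_def)
  have cI: "real (card I) > 0" using assms by (simp add: card_gt_0_iff)
  have fin: "finite ?P" using assms by (simp add: finite_PiE)
  have "real (card ?B) = (\<Sum>x\<in>?B. 1)" by simp
  also have "\<dots> \<le> (\<Sum>x\<in>?B. exp (l * (f x - avg ?P f - t)))"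
    using l by (intro sum_mono) auto
  also have "\<dots> \<le> (\<Sum>x\<in>?P. exp (l * (f x - avg ?P f - t)))"
    using fin by (intro sum_mono2) auto
  finally have "real (card ?B) / real (card Z ^ card I) \<le> avg ?P (\<lambda>x. exp (l * (f x - avg ?P f - t)))"
    using assms by (simp add: avg_def card_PiE divide_right_mono)
  also have "\<dots> = exp (- (l * t)) * avg ?P (\<lambda>x. exp (l * (f x - avg ?P f)))"
    by (simp add: avg_cmult[symmetric] exp_add[symmetric] algebra_simps)
  also have "\<dots> \<le> exp (- (l * t)) * exp (real (card I) * (l\<^sup>2 * c\<^sup>2 / 2))"
    using assms by (intro mult_left_mono avg_exp_bounded_differences) auto
  also have "\<dots> = exp (- (t\<^sup>2 / (2 * real (card I) * c\<^sup>2)))"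
    using assms cI by (simp add: exp_add[symmetric] l_def field_simps power2_eq_square)
  finally show ?thesis .
qed

section \<open>Symmetrization and contraction\<close>

lemma Max_image_le_iff:
  fixes f :: "'a \<Rightarrow> real"
  shows "finite A \<Longrightarrow> A \<noteq> {} \<Longrightarrow> (MAX a\<in>A. f a) \<le> c \<longleftrightarrow> (\<forall>a\<in>A. f a \<le> c)"
  by simp

lemma Max_image_ge:
  fixes f :: "'a \<Rightarrow> real"
  shows "finite A \<Longrightarrow> a \<in> A \<Longrightarrow> f a \<le> (MAX a\<in>A. f a)"
  by (intro Max_ge) auto

lemma Max_image_obtain:
  fixes f :: "'a \<Rightarrow> real"
  assumes "finite A" "A \<noteq> {}"
  obtains a where "a \<in> A" "(MAX a\<in>A. f a) = f a"
proof -
  have "Max (f ` A) \<in> f ` A" using assms by (intro Max_in) auto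
  then show thesis using that by blast
qed

definition pos_part :: "real \<Rightarrow> real"
  where "pos_part t = max t 0"

lemma pos_part_nonneg [simp]: "0 \<le> pos_part t"
  and pos_part_ge [simp]: "t \<le> pos_part t"
  and pos_part_lipschitz: "\<bar>pos_part s - pos_part t\<bar> \<le> \<bar>s - t\<bar>"
  by (auto simp: pos_part_def)

text \<open>With maximisers \<open>s\<close> and \<open>t\<close> of the two terms on the left, the
  left side is at most \<open>c s + c t + 2 * |h s - h t|\<close>, as \<open>pos_part\<close> is
  1-Lipschitz. Depending on the sign of \<open>h s - h t\<close>, the right side reaches this at
  \<open>(s, t)\<close> or at \<open>(t, s)\<close>.\<close>

lemma contraction_pos_part:
  assumes "finite S" "S \<noteq> {}"
  shows "(MAX s\<in>S. c s + 2 * pos_part (h s)) + (MAX s\<in>S. c s - 2 * pos_part (h s))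
    \<le> (MAX s\<in>S. c s + 2 * h s) + (MAX s\<in>S. c s - 2 * h s)"
proof -
  obtain s where s: "s \<in> S" "(MAX s\<in>S. c s + 2 * pos_part (h s)) = c s + 2 * pos_part (h s)"
    using Max_image_obtain[OF assms] by blast
  obtain t where t: "t \<in> S" "(MAX s\<in>S. c s - 2 * pos_part (h s)) = c t - 2 * pos_part (h t)"
    using Max_image_obtain[OF assms] by blast
  have *: "c u + 2 * h u \<le> (MAX s\<in>S. c s + 2 * h s)" "c u - 2 * h u \<le> (MAX s\<in>S. c s - 2 * h s)"
    if "u \<in> S" for u
    using assms that Max_image_ge[of S u "\<lambda>s. c s + 2 * h s"] Max_image_ge[of S u "\<lambda>s. c s - 2 * h s"]
    by auto
  show ?thesis unfolding s t
    using *[OF s(1)] *[OF t(1)] pos_part_lipschitz[of "h s" "h t"] by argo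
qed

text \<open>An independent copy \<open>y'\<close> stands in for the mean. Writing \<open>P y\<close>
  for \<open>pos_part (h s y)\<close>, the term \<open>c s + (P y - P y')\<close> is the midpoint of
  \<open>c s + 2 * P y\<close> and \<open>c s - 2 * P y'\<close>, which is the origin of the factor
  2. Contraction then removes \<open>pos_part\<close>, and the two signs become the average over
  \<open>{1, -1}\<close>.\<close>

lemma symmetrization_one:
  assumes Z: "finite Z" "Z \<noteq> {}" and S: "finite S" "S \<noteq> {}"
  shows "avg Z (\<lambda>y. MAX s\<in>S. c s + (pos_part (h s y) - avg Z (\<lambda>y. pos_part (h s y))))
    \<le> avg (Z \<times> {1, -1}) (\<lambda>z. MAX s\<in>S. c s + 2 * (snd z * h s (fst z)))"
proof -
  define Ap Am Bp Bm where "Ap y = (MAX s\<in>S. c s + 2 * pos_part (h s y))"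
    and "Am y = (MAX s\<in>S. c s - 2 * pos_part (h s y))"
    and "Bp y = (MAX s\<in>S. c s + 2 * h s y)"
    and "Bm y = (MAX s\<in>S. c s - 2 * h s y)" for y
  have A: "c s + (pos_part (h s y) - pos_part (h s y')) \<le> 1 / 2 * (Ap y + Am y')" if "s \<in> S" for s y y'
    using Max_image_ge[OF S(1) that, of "\<lambda>s. c s + 2 * pos_part (h s y)"]
      Max_image_ge[OF S(1) that, of "\<lambda>s. c s - 2 * pos_part (h s y')"]
    unfolding Ap_def Am_def by argo
  have "avg Z (\<lambda>y. MAX s\<in>S. c s + (pos_part (h s y) - avg Z (\<lambda>y. pos_part (h s y))))
    \<le> avg Z (\<lambda>y. avg Z (\<lambda>y'. 1 / 2 * (Ap y + Am y')))"
  proof (rule avg_mono, subst Max_image_le_iff[OF S], intro ballI)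
    fix y s assume s: "s \<in> S"
    have "c s + (pos_part (h s y) - avg Z (\<lambda>y. pos_part (h s y)))
      = avg Z (\<lambda>y'. c s + (pos_part (h s y) - pos_part (h s y')))"
      using Z by (simp add: avg_add avg_diff avg_const)
    also have "\<dots> \<le> avg Z (\<lambda>y'. 1 / 2 * (Ap y + Am y'))"
      by (intro avg_mono A s)
    finally show "c s + (pos_part (h s y) - avg Z (\<lambda>y. pos_part (h s y))) \<le> \<dots>" .
  qed
  also have "\<dots> = 1 / 2 * avg Z (\<lambda>y. Ap y + Am y)"
    by (simp only: avg_cmult avg_add avg_const[OF Z])
  also have "\<dots> \<le> 1 / 2 * avg Z (\<lambda>y. Bp y + Bm y)"
    unfolding Ap_def Am_def Bp_def Bm_def
    by (intro mult_left_mono avg_mono contraction_pos_part S) auto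
  also have "\<dots> = avg (Z \<times> {1, -1}) (\<lambda>z. MAX s\<in>S. c s + 2 * (snd z * h s (fst z)))"
  proof -
    have "avg {1, -1} (\<lambda>e. MAX s\<in>S. c s + 2 * (e * h s y)) = 1 / 2 * (Bp y + Bm y)" for y
      by (simp add: avg_def Bp_def Bm_def)
    then show ?thesis by (simp only: avg_Times fst_conv snd_conv avg_cmult)
  qed
  finally show ?thesis .
qed

text \<open>The offset \<open>c\<close> is arbitrary so that it can absorb the other coordinates:
  the centred terms not yet treated in the one step, the signed term just produced in the
  induction.\<close>

lemma symmetrization:
  assumes J: "finite J" and Z: "finite Z" "Z \<noteq> {}" and S: "finite S" "S \<noteq> {}"
  shows "avg (PiE J (\<lambda>_. Z))
      (\<lambda>y. MAX s\<in>S. c s + (\<Sum>j\<in>J. pos_part (h s (y j)) - avg Z (\<lambda>y. pos_part (h s y))))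
    \<le> avg (PiE J (\<lambda>_. Z \<times> {1, -1})) (\<lambda>z. MAX s\<in>S. c s + 2 * (\<Sum>j\<in>J. snd (z j) * h s (fst (z j))))"
  using J
proof (induction arbitrary: c)
  case empty
  then show ?case by (simp add: avg_def)
next
  case (insert i I)
  let ?d = "\<lambda>s a. pos_part (h s a) - avg Z (\<lambda>y. pos_part (h s y))"
  let ?P = "PiE I (\<lambda>_. Z)" and ?Q = "PiE I (\<lambda>_. Z \<times> {1::real, -1})" and ?Z = "Z \<times> {1::real, -1}"
  have sum1: "(\<Sum>j\<in>insert i I. f ((x(i := a)) j)) = f a + (\<Sum>j\<in>I. f (x j))"
    for f :: "'x \<Rightarrow> real" and x a
  proof -
    have "(\<Sum>j\<in>I. f ((x(i := a)) j)) = (\<Sum>j\<in>I. f (x j))"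
      using insert(2) by (intro sum.cong) auto
    then show ?thesis using insert(1,2) by simp
  qed
  have "avg (PiE (insert i I) (\<lambda>_. Z)) (\<lambda>y. MAX s\<in>S. c s + (\<Sum>j\<in>insert i I. ?d s (y j)))
    = avg ?P (\<lambda>y. avg Z (\<lambda>a. MAX s\<in>S. (c s + (\<Sum>j\<in>I. ?d s (y j))) + ?d s a))"
    unfolding avg_insert_PiE[OF insert(2)] sum1[of "?d _"] by (simp only: add_ac)
  also have "\<dots> \<le> avg ?P (\<lambda>y. avg ?Z (\<lambda>z. MAX s\<in>S. (c s + (\<Sum>j\<in>I. ?d s (y j))) + 2 * (snd z * h s (fst z))))"
    by (intro avg_mono symmetrization_one Z S)
  also have "\<dots> = avg ?Z (\<lambda>z. avg ?P (\<lambda>y. MAX s\<in>S. (c s + 2 * (snd z * h s (fst z))) + (\<Sum>j\<in>I. ?d s (y j))))"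
    by (subst avg_swap) (simp only: add_ac)
  also have "\<dots> \<le> avg ?Z (\<lambda>z. avg ?Q (\<lambda>y. MAX s\<in>S. (c s + 2 * (snd z * h s (fst z)))
      + 2 * (\<Sum>j\<in>I. snd (y j) * h s (fst (y j)))))"
    by (intro avg_mono insert.IH)
  also have "\<dots> = avg (PiE (insert i I) (\<lambda>_. ?Z)) (\<lambda>z. MAX s\<in>S. c s + 2 * (\<Sum>j\<in>insert i I. snd (z j) * h s (fst (z j))))"
    unfolding avg_insert_PiE[OF insert(2)] sum1[of "\<lambda>z. snd z * h _ (fst z)"]
    by (subst avg_swap) (simp only: add_ac ring_distribs)
  finally show ?case .
qed

text \<open>A uniform law of large numbers for positive parts. What is gained is that the signed sum
  is linear in \<open>h s\<close>: when \<open>h s\<close> is a partial sum over a set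
  \<open>s\<close>, its maximum can be estimated row by row or column by column, without a union
  bound over \<open>S\<close>.\<close>

lemma avg_Max_pos_part_sum_le:
  assumes J: "finite J" and Z: "finite Z" "Z \<noteq> {}" and S: "finite S" "S \<noteq> {}"
    and B: "\<And>s. s \<in> S \<Longrightarrow> avg Z (\<lambda>y. pos_part (h s y)) \<le> B"
  shows "avg (PiE J (\<lambda>_. Z)) (\<lambda>y. MAX s\<in>S. \<Sum>j\<in>J. pos_part (h s (y j)))
    \<le> real (card J) * B
      + 2 * avg (PiE J (\<lambda>_. Z \<times> {1, -1})) (\<lambda>z. MAX s\<in>S. \<Sum>j\<in>J. snd (z j) * h s (fst (z j)))"
proof -
  let ?a = "\<lambda>s. avg Z (\<lambda>y. pos_part (h s y))"
  let ?Q = "PiE J (\<lambda>_. Z \<times> {1::real, -1})"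
  have "avg (PiE J (\<lambda>_. Z)) (\<lambda>y. MAX s\<in>S. \<Sum>j\<in>J. pos_part (h s (y j)))
    = avg (PiE J (\<lambda>_. Z)) (\<lambda>y. MAX s\<in>S. real (card J) * ?a s + (\<Sum>j\<in>J. pos_part (h s (y j)) - ?a s))"
    by (simp add: sum_subtractf)
  also have "\<dots> \<le> avg ?Q (\<lambda>z. MAX s\<in>S. real (card J) * ?a s + 2 * (\<Sum>j\<in>J. snd (z j) * h s (fst (z j))))"
    by (rule symmetrization[OF J Z S])
  also have "\<dots> \<le> avg ?Q (\<lambda>z. real (card J) * B + 2 * (MAX s\<in>S. \<Sum>j\<in>J. snd (z j) * h s (fst (z j))))"
  proof (rule avg_mono, subst Max_image_le_iff[OF S], intro ballI)
    fix z s assume "s \<in> S"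
    then show "real (card J) * ?a s + 2 * (\<Sum>j\<in>J. snd (z j) * h s (fst (z j)))
        \<le> real (card J) * B + 2 * (MAX s\<in>S. \<Sum>j\<in>J. snd (z j) * h s (fst (z j)))"
      using B S Max_image_ge[OF S(1), of s "\<lambda>s. \<Sum>j\<in>J. snd (z j) * h s (fst (z j))"]
      by (intro add_mono mult_left_mono) auto
  qed
  also have "\<dots> = real (card J) * B + 2 * avg ?Q (\<lambda>z. MAX s\<in>S. \<Sum>j\<in>J. snd (z j) * h s (fst (z j)))"
    using J Z by (simp add: avg_add avg_cmult avg_const finite_PiE PiE_eq_empty_iff)
  finally show ?thesis .
qed

text \<open>The independent signs centre the terms whatever \<open>g\<close> is, so the variance
  bound applies without subtracting a mean.\<close>

lemma avg_signed_sum_le: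
  assumes J: "finite J" and Z: "finite Z" "Z \<noteq> {}"
  shows "avg (PiE J (\<lambda>_. Z \<times> {1, -1})) (\<lambda>z. \<bar>\<Sum>j\<in>J. snd (z j) * g (fst (z j))\<bar>)
    \<le> sqrt (real (card J) * avg Z (\<lambda>a. (g a)\<^sup>2))"
proof -
  have "avg (Z \<times> {1, -1}) (\<lambda>z. snd z * g (fst z)) = 0"
    by (simp add: avg_Times) (simp add: avg_def)
  moreover have "avg (Z \<times> {1, -1}) (\<lambda>z. (snd z * g (fst z))\<^sup>2) = avg Z (\<lambda>a. (g a)\<^sup>2)"
    by (simp add: avg_Times power_mult_distrib) (simp add: avg_def)
  ultimately show ?thesis
    using avg_PiE_abs_sum_le[of J "Z \<times> {1, -1}" "\<lambda>z. snd z * g (fst z)"] J Z by simp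
qed

section \<open>Cut norm of a sample with separate rows and columns\<close>

lemma sum_le_sum_pos_part:
  assumes "finite I" "S \<subseteq> I" shows "(\<Sum>i\<in>S. f i) \<le> (\<Sum>i\<in>I. pos_part (f i))"
proof -
  have "(\<Sum>i\<in>S. f i) \<le> (\<Sum>i\<in>S. pos_part (f i))" by (intro sum_mono) simp
  also have "\<dots> \<le> (\<Sum>i\<in>I. pos_part (f i))" using assms by (intro sum_mono2) auto
  finally show ?thesis .
qed

lemma sum_pos_part_eq:
  assumes "finite A"
  shows "(\<Sum>a\<in>A. pos_part (f a)) = (\<Sum>a\<in>{a\<in>A. f a > 0}. f a)"
  using assms by (intro sum.mono_neutral_cong_right) (auto simp: pos_part_def)

text \<open>Only the rows are sampled; the columns still range over all of \<open>Z\<close>. The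
  roles of the two sets are exchanged: for a set \<open>T\<close> of columns the best set of rows is
  given by positive parts, whose mean is a rectangle sum and hence at most \<open>rho\<close>. The
  signed sums for the \<open>2 ^ card Z\<close> sets \<open>T\<close> are dominated column by column
  by absolute values, so neither this number nor \<open>card Z\<close> enters the bound.\<close>

lemma bipartite_cut_first:
  assumes I: "finite I" and Z: "finite Z" "Z \<noteq> {}"
    and rho: "\<And>S T. S \<subseteq> Z \<Longrightarrow> T \<subseteq> Z \<Longrightarrow> (\<Sum>a\<in>S. \<Sum>b\<in>T. R a b) \<le> rho * (real (card Z))\<^sup>2"
    and beta: "avg Z (\<lambda>a. avg Z (\<lambda>b. (R a b)\<^sup>2)) \<le> beta"
  shows "avg (PiE I (\<lambda>_. Z)) (\<lambda>u. MAX S\<in>Pow I. avg Z (\<lambda>b. pos_part (\<Sum>i\<in>S. R (u i) b)))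
    \<le> real (card I) * rho + 2 * sqrt (real (card I) * beta)"
proof -
  define r where "r T a = avg Z (\<lambda>b. if b \<in> T then R a b else 0)" for T a
  have cZ: "real (card Z) > 0" using Z by (simp add: card_gt_0_iff)
  have r_eq: "(\<Sum>a\<in>S. w a * r T (f a)) = avg Z (\<lambda>b. if b \<in> T then \<Sum>a\<in>S. w a * R (f a) b else 0)"
    for S :: "'c set" and T w f
    unfolding r_def avg_cmult[symmetric] avg_sum[symmetric] by (intro avg_cong) auto
  have "avg (PiE I (\<lambda>_. Z)) (\<lambda>u. MAX S\<in>Pow I. avg Z (\<lambda>b. pos_part (\<Sum>i\<in>S. R (u i) b)))
    \<le> avg (PiE I (\<lambda>_. Z)) (\<lambda>u. MAX T\<in>Pow Z. \<Sum>i\<in>I. pos_part (r T (u i)))"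
  proof (rule avg_mono)
    fix u
    have "avg Z (\<lambda>b. pos_part (\<Sum>i\<in>S. R (u i) b)) \<le> (MAX T\<in>Pow Z. \<Sum>i\<in>I. pos_part (r T (u i)))"
      if S: "S \<subseteq> I" for S
    proof -
      \<comment> \<open>The columns with positive sum: on them \<open>pos_part\<close> is the
        identity, elsewhere it contributes nothing.\<close>
      define T where "T = {b\<in>Z. (\<Sum>i\<in>S. R (u i) b) > 0}"
      have "avg Z (\<lambda>b. pos_part (\<Sum>i\<in>S. R (u i) b)) = (\<Sum>i\<in>S. 1 * r T (u i))"
        unfolding r_eq by (intro avg_cong) (auto simp: T_def pos_part_def)
      also have "\<dots> \<le> (\<Sum>i\<in>I. pos_part (r T (u i)))"
        using sum_le_sum_pos_part[OF I S] by simp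
      also have "\<dots> \<le> (MAX T\<in>Pow Z. \<Sum>i\<in>I. pos_part (r T (u i)))"
        using Z by (intro Max_image_ge) (auto simp: T_def)
      finally show ?thesis .
    qed
    then show "(MAX S\<in>Pow I. avg Z (\<lambda>b. pos_part (\<Sum>i\<in>S. R (u i) b)))
        \<le> (MAX T\<in>Pow Z. \<Sum>i\<in>I. pos_part (r T (u i)))"
      using I by (subst Max_image_le_iff) auto
  qed
  also have "\<dots> \<le> real (card I) * rho + 2 * avg (PiE I (\<lambda>_. Z \<times> {1, -1}))
      (\<lambda>z. MAX T\<in>Pow Z. \<Sum>i\<in>I. snd (z i) * r T (fst (z i)))"
  proof (rule avg_Max_pos_part_sum_le)
    fix T assume T: "T \<in> Pow Z"
    define S where "S = {a\<in>Z. r T a > 0}"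
    have "avg Z (\<lambda>a. pos_part (r T a)) = (\<Sum>a\<in>S. r T a) / real (card Z)"
      unfolding avg_def S_def using Z by (simp add: sum_pos_part_eq)
    also have "\<dots> = (\<Sum>a\<in>S. \<Sum>b\<in>T. R a b) / (real (card Z))\<^sup>2"
    proof -
      have "r T a = (\<Sum>b\<in>T. R a b) / real (card Z)" for a
      proof -
        have "(\<Sum>b\<in>Z. if b \<in> T then R a b else 0) = (\<Sum>b\<in>T. R a b)"
          using T Z by (subst sum.inter_restrict[symmetric]) (auto simp: Int_absorb1)
        then show ?thesis by (simp add: r_def avg_def)
      qed
      then show ?thesis by (simp add: sum_divide_distrib power2_eq_square)
    qed
    also have "\<dots> \<le> rho"
      using rho[of S T] T cZ by (auto simp: divide_le_eq S_def)
    finally show "avg Z (\<lambda>a. pos_part (r T a)) \<le> rho" .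
  qed (use I Z in auto)
  also have "avg (PiE I (\<lambda>_. Z \<times> {1, -1})) (\<lambda>z. MAX T\<in>Pow Z. \<Sum>i\<in>I. snd (z i) * r T (fst (z i)))
    \<le> avg (PiE I (\<lambda>_. Z \<times> {1, -1})) (\<lambda>z. avg Z (\<lambda>b. \<bar>\<Sum>i\<in>I. snd (z i) * R (fst (z i)) b\<bar>))"
  proof (rule avg_mono, subst Max_image_le_iff)
    fix z
    show "\<forall>T\<in>Pow Z. (\<Sum>i\<in>I. snd (z i) * r T (fst (z i)))
        \<le> avg Z (\<lambda>b. \<bar>\<Sum>i\<in>I. snd (z i) * R (fst (z i)) b\<bar>)"
      unfolding r_eq by (auto intro!: avg_mono)
  qed (use Z in auto)
  also have "\<dots> = avg Z (\<lambda>b. avg (PiE I (\<lambda>_. Z \<times> {1, -1})) (\<lambda>z. \<bar>\<Sum>i\<in>I. snd (z i) * R (fst (z i)) b\<bar>))"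
    by (rule avg_swap)
  also have "\<dots> \<le> avg Z (\<lambda>b. sqrt (real (card I) * avg Z (\<lambda>a. (R a b)\<^sup>2)))"
    by (intro avg_mono avg_signed_sum_le I Z)
  also have "\<dots> \<le> sqrt (avg Z (\<lambda>b. real (card I) * avg Z (\<lambda>a. (R a b)\<^sup>2)))"
    using Z by (intro avg_sqrt_le) (auto intro!: mult_nonneg_nonneg avg_nonneg)
  also have "\<dots> \<le> sqrt (real (card I) * beta)"
    unfolding avg_cmult using beta by (subst avg_swap) (simp add: mult_left_mono)
  finally show ?thesis by simp
qed

text \<open>The columns are sampled for fixed rows \<open>u\<close>. The mean of the positive parts
  is at most \<open>G u\<close>, which \<open>bipartite_cut_first\<close> controls on average over
  \<open>u\<close>; the signed part is dominated row by row by \<open>H u\<close>.\<close>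

lemma bipartite_cut:
  assumes I: "finite I" and J: "finite J" and Z: "finite Z" "Z \<noteq> {}"
    and rho: "\<And>S T. S \<subseteq> Z \<Longrightarrow> T \<subseteq> Z \<Longrightarrow> (\<Sum>a\<in>S. \<Sum>b\<in>T. R a b) \<le> rho * (real (card Z))\<^sup>2"
    and beta: "avg Z (\<lambda>a. avg Z (\<lambda>b. (R a b)\<^sup>2)) \<le> beta"
  shows "avg (PiE I (\<lambda>_. Z)) (\<lambda>u. avg (PiE J (\<lambda>_. Z))
      (\<lambda>v. MAX S\<in>Pow I. \<Sum>j\<in>J. pos_part (\<Sum>i\<in>S. R (u i) (v j))))
    \<le> real (card J) * (real (card I) * rho + 2 * sqrt (real (card I) * beta))
      + 2 * (real (card I) * sqrt (real (card J) * beta))"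
proof -
  define G where "G u = (MAX S\<in>Pow I. avg Z (\<lambda>b. pos_part (\<Sum>i\<in>S. R (u i) b)))" for u
  define H where "H u = (\<Sum>i\<in>I. sqrt (real (card J) * avg Z (\<lambda>b. (R (u i) b)\<^sup>2)))" for u
  have "avg (PiE J (\<lambda>_. Z)) (\<lambda>v. MAX S\<in>Pow I. \<Sum>j\<in>J. pos_part (\<Sum>i\<in>S. R (u i) (v j)))
      \<le> real (card J) * G u + 2 * H u" for u
  proof -
    have "avg (PiE J (\<lambda>_. Z)) (\<lambda>v. MAX S\<in>Pow I. \<Sum>j\<in>J. pos_part (\<Sum>i\<in>S. R (u i) (v j)))
      \<le> real (card J) * G u + 2 * avg (PiE J (\<lambda>_. Z \<times> {1, -1}))
        (\<lambda>z. MAX S\<in>Pow I. \<Sum>j\<in>J. snd (z j) * (\<Sum>i\<in>S. R (u i) (fst (z j))))"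
      using I J Z unfolding G_def
      by (intro avg_Max_pos_part_sum_le)
         (auto intro!: Max_image_ge[where f = "\<lambda>S. avg Z (\<lambda>b. pos_part (\<Sum>i\<in>S. R (u i) b))"])
    also have "avg (PiE J (\<lambda>_. Z \<times> {1, -1}))
        (\<lambda>z. MAX S\<in>Pow I. \<Sum>j\<in>J. snd (z j) * (\<Sum>i\<in>S. R (u i) (fst (z j))))
      \<le> avg (PiE J (\<lambda>_. Z \<times> {1, -1})) (\<lambda>z. \<Sum>i\<in>I. \<bar>\<Sum>j\<in>J. snd (z j) * R (u i) (fst (z j))\<bar>)"
    proof (rule avg_mono, subst Max_image_le_iff)
      fix z
      show "\<forall>S\<in>Pow I. (\<Sum>j\<in>J. snd (z j) * (\<Sum>i\<in>S. R (u i) (fst (z j))))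
        \<le> (\<Sum>i\<in>I. \<bar>\<Sum>j\<in>J. snd (z j) * R (u i) (fst (z j))\<bar>)"
      proof
        fix S assume S: "S \<in> Pow I"
        have "(\<Sum>j\<in>J. snd (z j) * (\<Sum>i\<in>S. R (u i) (fst (z j))))
          = (\<Sum>i\<in>S. \<Sum>j\<in>J. snd (z j) * R (u i) (fst (z j)))"
          unfolding sum_distrib_left by (rule sum.swap)
        also have "\<dots> \<le> (\<Sum>i\<in>S. \<bar>\<Sum>j\<in>J. snd (z j) * R (u i) (fst (z j))\<bar>)"
          by (intro sum_mono) simp
        also have "\<dots> \<le> (\<Sum>i\<in>I. \<bar>\<Sum>j\<in>J. snd (z j) * R (u i) (fst (z j))\<bar>)"
          using I S by (intro sum_mono2) auto
        finally show "(\<Sum>j\<in>J. snd (z j) * (\<Sum>i\<in>S. R (u i) (fst (z j)))) \<le> \<dots>" .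
      qed
    qed (use I in auto)
    also have "\<dots> \<le> H u"
      unfolding avg_sum H_def by (intro sum_mono avg_signed_sum_le J Z)
    finally show ?thesis by simp
  qed
  then have "avg (PiE I (\<lambda>_. Z)) (\<lambda>u. avg (PiE J (\<lambda>_. Z))
      (\<lambda>v. MAX S\<in>Pow I. \<Sum>j\<in>J. pos_part (\<Sum>i\<in>S. R (u i) (v j))))
    \<le> avg (PiE I (\<lambda>_. Z)) (\<lambda>u. real (card J) * G u + 2 * H u)"
    by (intro avg_mono)
  also have "\<dots> = real (card J) * avg (PiE I (\<lambda>_. Z)) G + 2 * avg (PiE I (\<lambda>_. Z)) H"
    by (simp only: avg_add avg_cmult)
  also have "avg (PiE I (\<lambda>_. Z)) G \<le> real (card I) * rho + 2 * sqrt (real (card I) * beta)"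
    unfolding G_def by (intro bipartite_cut_first I Z rho beta)
  also have "avg (PiE I (\<lambda>_. Z)) H \<le> (\<Sum>i\<in>I. sqrt (real (card J) * beta))"
    unfolding H_def avg_sum
  proof (rule sum_mono)
    fix i assume i: "i \<in> I"
    have "avg (PiE I (\<lambda>_. Z)) (\<lambda>u. sqrt (real (card J) * avg Z (\<lambda>b. (R (u i) b)\<^sup>2)))
      = avg Z (\<lambda>a. sqrt (real (card J) * avg Z (\<lambda>b. (R a b)\<^sup>2)))"
      using avg_PiE_coord[OF I i Z, of "\<lambda>a. sqrt (real (card J) * avg Z (\<lambda>b. (R a b)\<^sup>2))"] .
    also have "\<dots> \<le> sqrt (avg Z (\<lambda>a. real (card J) * avg Z (\<lambda>b. (R a b)\<^sup>2)))"
      using Z by (intro avg_sqrt_le) (auto intro!: mult_nonneg_nonneg avg_nonneg)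
    also have "\<dots> \<le> sqrt (real (card J) * beta)"
      unfolding avg_cmult using beta by (simp add: mult_left_mono)
    finally show "avg (PiE I (\<lambda>_. Z)) (\<lambda>u. sqrt (real (card J) * avg Z (\<lambda>b. (R (u i) b)\<^sup>2))) \<le> \<dots>" .
  qed
  finally show ?thesis by (simp add: mult_left_mono)
qed

section \<open>Cut norms of matrices\<close>

text \<open>The scaling by \<open>(real k)\<^sup>2\<close> makes this the cut norm of the step
  function with \<open>k\<close> equal steps and entries \<open>D\<close>; the direction in use is
  \<open>weighted_dcut_le\<close>.\<close>

definition dcut :: "nat \<Rightarrow> (nat \<Rightarrow> nat \<Rightarrow> real) \<Rightarrow> real"
  where "dcut k D =
    (MAX P\<in>Pow {..<k} \<times> Pow {..<k}. \<bar>\<Sum>i\<in>fst P. \<Sum>j\<in>snd P. D i j\<bar>) / (real k)\<^sup>2"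

lemma dcut_ge:
  assumes "S \<subseteq> {..<k}" "T \<subseteq> {..<k}"
  shows "\<bar>\<Sum>i\<in>S. \<Sum>j\<in>T. D i j\<bar> \<le> dcut k D * (real k)\<^sup>2"
proof (cases "k = 0")
  case False
  have "\<bar>\<Sum>i\<in>S. \<Sum>j\<in>T. D i j\<bar> \<le> (MAX P\<in>Pow {..<k} \<times> Pow {..<k}. \<bar>\<Sum>i\<in>fst P. \<Sum>j\<in>snd P. D i j\<bar>)"
    using assms Max_image_ge[of "Pow {..<k} \<times> Pow {..<k}" "(S, T)" "\<lambda>P. \<bar>\<Sum>i\<in>fst P. \<Sum>j\<in>snd P. D i j\<bar>"]
    by auto
  then show ?thesis using False by (simp add: dcut_def)
qed (use assms in auto)

lemma dcut_le:
  assumes "k \<ge> 1"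
    and "\<And>S T. S \<subseteq> {..<k} \<Longrightarrow> T \<subseteq> {..<k} \<Longrightarrow> \<bar>\<Sum>i\<in>S. \<Sum>j\<in>T. D i j\<bar> \<le> c * (real k)\<^sup>2"
  shows "dcut k D \<le> c"
proof -
  have "(MAX P\<in>Pow {..<k} \<times> Pow {..<k}. \<bar>\<Sum>i\<in>fst P. \<Sum>j\<in>snd P. D i j\<bar>) \<le> c * (real k)\<^sup>2"
    using assms by (subst Max_image_le_iff) auto
  then show ?thesis using assms by (simp add: dcut_def divide_le_eq)
qed

lemma dcut_diff_le:
  assumes "k \<ge> 1"
  shows "dcut k D \<le> dcut k D' + (\<Sum>i<k. \<Sum>j<k. \<bar>D i j - D' i j\<bar>) / (real k)\<^sup>2"
proof (rule dcut_le[OF assms])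
  fix S T assume ST: "S \<subseteq> {..<k}" "T \<subseteq> {..<k}"
  have "(\<Sum>i\<in>S. \<Sum>j\<in>T. D i j) = (\<Sum>i\<in>S. \<Sum>j\<in>T. D' i j) + (\<Sum>i\<in>S. \<Sum>j\<in>T. D i j - D' i j)"
    by (simp add: sum_subtractf)
  also have "\<bar>\<dots>\<bar> \<le> \<bar>\<Sum>i\<in>S. \<Sum>j\<in>T. D' i j\<bar> + \<bar>\<Sum>i\<in>S. \<Sum>j\<in>T. D i j - D' i j\<bar>" by simp
  also have "\<bar>\<Sum>i\<in>S. \<Sum>j\<in>T. D i j - D' i j\<bar> \<le> (\<Sum>i\<in>S. \<Sum>j\<in>T. \<bar>D i j - D' i j\<bar>)"
    by (rule order_trans[OF sum_abs]) (intro sum_mono sum_abs)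
  also have "\<dots> \<le> (\<Sum>i\<in>S. \<Sum>j<k. \<bar>D i j - D' i j\<bar>)"
    using ST by (intro sum_mono sum_mono2) auto
  also have "\<dots> \<le> (\<Sum>i<k. \<Sum>j<k. \<bar>D i j - D' i j\<bar>)"
    using ST by (intro sum_mono2) (auto intro: sum_nonneg)
  also have "\<bar>\<Sum>i\<in>S. \<Sum>j\<in>T. D' i j\<bar> \<le> dcut k D' * (real k)\<^sup>2" by (rule dcut_ge[OF ST])
  finally show "\<bar>\<Sum>i\<in>S. \<Sum>j\<in>T. D i j\<bar>
    \<le> (dcut k D' + (\<Sum>i<k. \<Sum>j<k. \<bar>D i j - D' i j\<bar>) / (real k)\<^sup>2) * (real k)\<^sup>2"
    using assms by (simp add: ring_distribs)
qed

section \<open>Decoupling rows from columns\<close>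

lemma card_subsets_separating:
  assumes "finite K" "i \<in> K" "j \<in> K" "i \<noteq> j"
  shows "4 * card {I \<in> Pow K. i \<in> I \<and> j \<notin> I} = 2 ^ card K"
proof -
  have "{I \<in> Pow K. i \<in> I \<and> j \<notin> I} = insert i ` Pow (K - {i, j})"
  proof
    show "{I \<in> Pow K. i \<in> I \<and> j \<notin> I} \<subseteq> insert i ` Pow (K - {i, j})"
    proof
      fix I assume I: "I \<in> {I \<in> Pow K. i \<in> I \<and> j \<notin> I}"
      then have "I = insert i (I - {i})" "I - {i} \<in> Pow (K - {i, j})" by auto
      then show "I \<in> insert i ` Pow (K - {i, j})" by blast
    qed
  qed (use assms in auto)
  moreover have "inj_on (insert i) (Pow (K - {i, j}))"
    by (auto simp: inj_on_def)
  ultimately have "card {I \<in> Pow K. i \<in> I \<and> j \<notin> I} = 2 ^ (card K - 2)"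
    using assms by (simp add: card_image card_Pow card_Diff_subset)
  moreover have "card K \<ge> 2"
    using assms card_mono[of K "{i, j}"] by simp
  then have "2 ^ card K = (4::nat) * 2 ^ (card K - 2)"
    by (metis le_add_diff_inverse power_add power2_eq_square mult_2_right numeral_Bit0 numeral_times_numeral)
  ultimately show ?thesis by simp
qed

text \<open>A random \<open>I\<close> contains \<open>i\<close> but not \<open>j\<close> with
  probability 1/4 if \<open>i \<noteq> j\<close>, whence the factor 4; the diagonal, which is never
  separated, carries zeros.\<close>

lemma sum_eq_avg_split:
  fixes D :: "'a \<Rightarrow> 'a \<Rightarrow> real"
  assumes K: "finite K" and ST: "S \<subseteq> K" "T \<subseteq> K" and D: "\<And>i. D i i = 0"
  shows "(\<Sum>i\<in>S. \<Sum>j\<in>T. D i j) = 4 * avg (Pow K) (\<lambda>I. \<Sum>i\<in>S \<inter> I. \<Sum>j\<in>T - I. D i j)"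
proof -
  have fin: "finite S" "finite T" using K ST by (auto intro: finite_subset)
  have "(\<Sum>i\<in>S \<inter> I. \<Sum>j\<in>T - I. D i j) = (\<Sum>i\<in>S. \<Sum>j\<in>T. D i j * of_bool (i \<in> I \<and> j \<notin> I))" for I
    using fin by (auto simp: sum.inter_restrict Diff_eq of_bool_def intro!: sum.cong)
  then have "avg (Pow K) (\<lambda>I. \<Sum>i\<in>S \<inter> I. \<Sum>j\<in>T - I. D i j)
    = (\<Sum>i\<in>S. \<Sum>j\<in>T. D i j * avg (Pow K) (\<lambda>I. of_bool (i \<in> I \<and> j \<notin> I)))"
    by (simp add: avg_sum avg_cmult)
  also have "\<dots> = (\<Sum>i\<in>S. \<Sum>j\<in>T. D i j / 4)"
  proof (intro sum.cong refl)
    fix i j assume ij: "i \<in> S" "j \<in> T"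
    show "D i j * avg (Pow K) (\<lambda>I. of_bool (i \<in> I \<and> j \<notin> I)) = D i j / 4"
    proof (cases "i = j")
      case False
      have "avg (Pow K) (\<lambda>I. of_bool (i \<in> I \<and> j \<notin> I)) = real (card {I \<in> Pow K. i \<in> I \<and> j \<notin> I}) / 2 ^ card K"
        using K by (simp add: avg_def sum_of_bool_eq card_Pow Int_def conj_commute)
      also have "real (4 * card {I \<in> Pow K. i \<in> I \<and> j \<notin> I}) = real (2 ^ card K)"
        using card_subsets_separating[OF K, of i j] ij ST False by (intro arg_cong[of _ _ real]) blast
      then have "real (card {I \<in> Pow K. i \<in> I \<and> j \<notin> I}) = 2 ^ card K / 4" by simp
      then have "real (card {I \<in> Pow K. i \<in> I \<and> j \<notin> I}) / 2 ^ card K = 1 / 4" by simp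
      finally show ?thesis by simp
    qed (simp add: D)
  qed
  also have "\<dots> = (\<Sum>i\<in>S. \<Sum>j\<in>T. D i j) / 4" by (simp add: sum_divide_distrib)
  finally show ?thesis by simp
qed

text \<open>One-sided: the other sign is covered by applying it to \<open>- D\<close>. The maximum
  over the set of columns has been carried out and is the sum of positive parts, the form that
  \<open>bipartite_cut\<close> bounds.\<close>

definition split_cut :: "'a set \<Rightarrow> 'a set \<Rightarrow> ('a \<Rightarrow> 'a \<Rightarrow> real) \<Rightarrow> real"
  where "split_cut I J D = (MAX S\<in>Pow I. \<Sum>j\<in>J. pos_part (\<Sum>i\<in>S. D i j))"

lemma split_cut_ge:
  assumes "finite I" "finite J" "S \<subseteq> I" "T \<subseteq> J"
  shows "(\<Sum>i\<in>S. \<Sum>j\<in>T. D i j) \<le> split_cut I J D"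
proof -
  have "(\<Sum>i\<in>S. \<Sum>j\<in>T. D i j) \<le> (\<Sum>j\<in>J. pos_part (\<Sum>i\<in>S. D i j))"
    using assms sum_le_sum_pos_part by (subst sum.swap) blast
  also have "\<dots> \<le> split_cut I J D"
    unfolding split_cut_def using assms by (intro Max_image_ge) auto
  finally show ?thesis .
qed

text \<open>The maximum over \<open>S\<close> and \<open>T\<close> ends up inside the average over
  \<open>I\<close>, so that the expectation over samples can later be taken for each fixed
  \<open>I\<close>.\<close>

lemma dcut_le_avg_split_cut:
  assumes "k \<ge> 1" and D: "\<And>i. D i i = 0"
  shows "dcut k D \<le> 4 * avg (Pow {..<k})
    (\<lambda>I. split_cut I ({..<k} - I) D + split_cut I ({..<k} - I) (\<lambda>i j. - D i j)) / (real k)\<^sup>2"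
proof (rule dcut_le[OF assms(1)])
  fix S T assume ST: "S \<subseteq> {..<k}" "T \<subseteq> {..<k}"
  have "\<bar>\<Sum>i\<in>S. \<Sum>j\<in>T. D i j\<bar> \<le> 4 * avg (Pow {..<k}) (\<lambda>I. \<bar>\<Sum>i\<in>S \<inter> I. \<Sum>j\<in>T - I. D i j\<bar>)"
    using sum_eq_avg_split[of "{..<k}" S T D] ST D by (simp add: abs_mult avg_abs_le)
  also have "\<dots> \<le> 4 * avg (Pow {..<k})
    (\<lambda>I. split_cut I ({..<k} - I) D + split_cut I ({..<k} - I) (\<lambda>i j. - D i j))"
  proof (intro mult_left_mono avg_mono)
    fix I assume I: "I \<in> Pow {..<k}"
    then have fin: "finite I" by (auto intro: finite_subset)
    have "0 \<le> split_cut I ({..<k} - I) D'" for D'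
      using split_cut_ge[OF fin, of "{..<k} - I" "{}" "{}" D'] by simp
    moreover have "(\<Sum>i\<in>S \<inter> I. \<Sum>j\<in>T - I. D' i j) \<le> split_cut I ({..<k} - I) D'" for D'
      using fin ST by (intro split_cut_ge) auto
    from this[of D] this[of "\<lambda>i j. - D i j"]
    have "(\<Sum>i\<in>S \<inter> I. \<Sum>j\<in>T - I. D i j) \<le> split_cut I ({..<k} - I) D"
      "- (\<Sum>i\<in>S \<inter> I. \<Sum>j\<in>T - I. D i j) \<le> split_cut I ({..<k} - I) (\<lambda>i j. - D i j)"
      by (simp_all add: sum_negf)
    ultimately show "\<bar>\<Sum>i\<in>S \<inter> I. \<Sum>j\<in>T - I. D i j\<bar>
      \<le> split_cut I ({..<k} - I) D + split_cut I ({..<k} - I) (\<lambda>i j. - D i j)"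
      by (smt (verit, ccfv_SIG))
  qed simp
  finally show "\<bar>\<Sum>i\<in>S. \<Sum>j\<in>T. D i j\<bar> \<le> 4 * avg (Pow {..<k})
    (\<lambda>I. split_cut I ({..<k} - I) D + split_cut I ({..<k} - I) (\<lambda>i j. - D i j)) / (real k)\<^sup>2 * (real k)\<^sup>2"
    using assms by simp
qed

abbreviation offdiag :: "('a \<Rightarrow> 'a \<Rightarrow> real) \<Rightarrow> ('i \<Rightarrow> 'a) \<Rightarrow> 'i \<Rightarrow> 'i \<Rightarrow> real"
  where "offdiag D x \<equiv> \<lambda>i j. if i = j then 0 else D (x i) (x j)"

text \<open>For fixed \<open>I\<close> the row variables and the column variables are disjoint
  blocks of coordinates, so \<open>bipartite_cut\<close> applies. The constants: 4 from decoupling,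
  2 for the two signs, and in \<open>c\<close> another 4 for two fluctuation terms with factor 2
  each.\<close>

lemma avg_dcut_sample_le:
  assumes k: "k \<ge> 1" and Z: "finite Z" "Z \<noteq> {}"
    and rho: "\<And>S T. S \<subseteq> Z \<Longrightarrow> T \<subseteq> Z \<Longrightarrow> \<bar>\<Sum>a\<in>S. \<Sum>b\<in>T. R a b\<bar> \<le> rho * (real (card Z))\<^sup>2"
    and beta: "avg Z (\<lambda>a. avg Z (\<lambda>b. (R a b)\<^sup>2)) \<le> beta"
  shows "avg (PiE {..<k} (\<lambda>_. Z)) (\<lambda>x. dcut k (offdiag R x))
    \<le> 8 * rho + 32 * sqrt (beta / real k)"
proof -
  let ?K = "{..<k}" and ?P = "PiE {..<k} (\<lambda>_. Z)"
  define c where "c = (real k)\<^sup>2 * rho + 4 * real k * sqrt (real k * beta)"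
  have rho0: "rho \<ge> 0" using rho[of "{}" "{}"] Z by (simp add: zero_le_mult_iff)
  have beta0: "beta \<ge> 0"
    using beta order_trans[OF avg_nonneg[of Z "\<lambda>a. avg Z (\<lambda>b. (R a b)\<^sup>2)"]] avg_nonneg
    by (metis (no_types, lifting) zero_le_power2)
  have split: "avg ?P (\<lambda>x. split_cut I (?K - I) (\<lambda>i j. Q (x i) (x j))) \<le> c"
    if I: "I \<subseteq> ?K"
      and Q: "\<And>S T. S \<subseteq> Z \<Longrightarrow> T \<subseteq> Z \<Longrightarrow> (\<Sum>a\<in>S. \<Sum>b\<in>T. Q a b) \<le> rho * (real (card Z))\<^sup>2"
        "avg Z (\<lambda>a. avg Z (\<lambda>b. (Q a b)\<^sup>2)) \<le> beta" for I Q
  proof -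
    have fin: "finite I" using I by (rule finite_subset) simp
    have K: "?K = I \<union> (?K - I)" using I by auto
    have cI: "real (card I) \<le> real k" "real (card (?K - I)) \<le> real k"
      using I card_mono[of ?K I] card_mono[of ?K "?K - I"] by auto
    have eq: "split_cut I (?K - I) (\<lambda>i j. Q (if i \<in> I then u i else v i) (if j \<in> I then u j else v j))
      = (MAX S\<in>Pow I. \<Sum>j\<in>?K - I. pos_part (\<Sum>i\<in>S. Q (u i) (v j)))" for u v
      unfolding split_cut_def
      by (intro arg_cong[of _ _ Max] image_cong refl sum.cong arg_cong[of _ _ pos_part]) auto
    have "avg ?P (\<lambda>x. split_cut I (?K - I) (\<lambda>i j. Q (x i) (x j)))
      = avg (PiE I (\<lambda>_. Z)) (\<lambda>u. avg (PiE (?K - I) (\<lambda>_. Z))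
          (\<lambda>v. MAX S\<in>Pow I. \<Sum>j\<in>?K - I. pos_part (\<Sum>i\<in>S. Q (u i) (v j))))"
      by (subst K, subst avg_PiE_Un[OF fin]) (auto simp: eq)
    also have "\<dots> \<le> real (card (?K - I)) * (real (card I) * rho + 2 * sqrt (real (card I) * beta))
      + 2 * (real (card I) * sqrt (real (card (?K - I)) * beta))"
      using fin Z Q by (intro bipartite_cut) auto
    also have "\<dots> \<le> real k * (real k * rho + 2 * sqrt (real k * beta)) + 2 * (real k * sqrt (real k * beta))"
      using cI rho0 beta0
      by (intro add_mono mult_mono real_sqrt_le_mono mult_left_mono mult_right_mono) auto
    also have "\<dots> = c" by (simp add: c_def power2_eq_square algebra_simps)
    finally show ?thesis .
  qed
  \<comment> \<open>Rows lie in \<open>I\<close> and columns outside, so the zeros on the diagonal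
    are never met.\<close>
  have off: "split_cut I (?K - I) (\<lambda>i j. s * (if i = j then 0 else R (x i) (x j)))
      = split_cut I (?K - I) (\<lambda>i j. s * R (x i) (x j))" if "I \<in> Pow ?K" for I x s
    unfolding split_cut_def
    by (intro arg_cong[of _ _ Max] image_cong refl sum.cong arg_cong[of _ _ pos_part]) auto
  have "avg ?P (\<lambda>x. dcut k (offdiag R x))
    \<le> avg ?P (\<lambda>x. 4 / (real k)\<^sup>2 * avg (Pow ?K)
      (\<lambda>I. split_cut I (?K - I) (\<lambda>i j. 1 * (if i = j then 0 else R (x i) (x j)))
         + split_cut I (?K - I) (\<lambda>i j. - 1 * (if i = j then 0 else R (x i) (x j)))))"
    by (intro avg_mono order_trans[OF dcut_le_avg_split_cut[OF k]]) auto
  also have "\<dots> = 4 / (real k)\<^sup>2 * avg (Pow ?K)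
    (\<lambda>I. avg ?P (\<lambda>x. split_cut I (?K - I) (\<lambda>i j. 1 * R (x i) (x j)))
       + avg ?P (\<lambda>x. split_cut I (?K - I) (\<lambda>i j. - 1 * R (x i) (x j))))"
    unfolding avg_cmult by (subst avg_swap) (simp only: avg_add[symmetric] off cong: avg_cong)
  also have "\<dots> \<le> 4 / (real k)\<^sup>2 * (c + c)"
  proof -
    have "(\<Sum>a\<in>S. \<Sum>b\<in>T. 1 * R a b) \<le> rho * (real (card Z))\<^sup>2"
      "(\<Sum>a\<in>S. \<Sum>b\<in>T. - 1 * R a b) \<le> rho * (real (card Z))\<^sup>2"
      if "S \<subseteq> Z" "T \<subseteq> Z" for S T
      using rho[OF that] by (simp_all add: sum_negf)
    then have "avg ?P (\<lambda>x. split_cut I (?K - I) (\<lambda>i j. 1 * R (x i) (x j))) \<le> c"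
      "avg ?P (\<lambda>x. split_cut I (?K - I) (\<lambda>i j. - 1 * R (x i) (x j))) \<le> c" if "I \<in> Pow ?K" for I
      using that beta split[of I "\<lambda>a b. 1 * R a b"] split[of I "\<lambda>a b. - 1 * R a b"]
      by simp_all
    then have "avg (Pow ?K)
      (\<lambda>I. avg ?P (\<lambda>x. split_cut I (?K - I) (\<lambda>i j. 1 * R (x i) (x j)))
         + avg ?P (\<lambda>x. split_cut I (?K - I) (\<lambda>i j. - 1 * R (x i) (x j)))) \<le> c + c"
      by (intro avg_le_const[of "Pow ?K"] add_mono[of _ c _ c]) auto
    then show ?thesis by (rule mult_left_mono) simp
  qed
  also have "\<dots> = 8 * rho + 32 * (sqrt (real k * beta) / real k)"
    using k by (simp add: c_def field_simps power2_eq_square)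
  also have "sqrt (real k * beta) / real k = sqrt (beta / real k)"
    using k by (simp add: real_sqrt_mult real_sqrt_divide real_div_sqrt field_simps)
  finally show ?thesis .
qed

text \<open>
  The greedy step subtracts the mean \<open>t\<close> over \<open>Z \<times> Z\<close>, not over the rectangle: the energy still drops by
  \<open>t\<^sup>2\<close>, and the coefficients become square summable.
\<close>

lemma cut_decomposition:
  assumes Z: "finite Z" "Z \<noteq> {}" and beta: "avg Z (\<lambda>a. avg Z (\<lambda>b. (A a b)\<^sup>2)) \<le> beta" and m: "m \<ge> 1"
  obtains c :: "nat \<Rightarrow> real" and S T :: "nat \<Rightarrow> 'a set" and R where
    "\<And>a b. R a b = A a b - (\<Sum>l<m. c l * of_bool (a \<in> S l \<and> b \<in> T l))"
    "\<And>S T. S \<subseteq> Z \<Longrightarrow> T \<subseteq> Z \<Longrightarrow> \<bar>\<Sum>a\<in>S. \<Sum>b\<in>T. R a b\<bar> \<le> sqrt (beta / real m) * (real (card Z))\<^sup>2"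
    "avg Z (\<lambda>a. avg Z (\<lambda>b. (R a b)\<^sup>2)) \<le> beta"
    "(\<Sum>l<m. (c l)\<^sup>2) \<le> beta"
proof -
  define e where "e = sqrt (beta / real m)"
  define q where "q R = avg Z (\<lambda>a. avg Z (\<lambda>b. (R a b)\<^sup>2))" for R
  define good where "good R \<longleftrightarrow>
    (\<forall>S T. S \<subseteq> Z \<longrightarrow> T \<subseteq> Z \<longrightarrow> \<bar>\<Sum>a\<in>S. \<Sum>b\<in>T. R a b\<bar> \<le> e * (real (card Z))\<^sup>2)" for R
  define rem where "rem n c S T a b = A a b - (\<Sum>l<n. c l * of_bool (a \<in> S l \<and> b \<in> T l))"
    for n and c :: "nat \<Rightarrow> real" and S T :: "nat \<Rightarrow> 'a set" and a b
  have cZ: "real (card Z) > 0" using Z by (simp add: card_gt_0_iff)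
  have q0: "q R \<ge> 0" for R by (auto simp: q_def intro!: avg_nonneg)
  have beta0: "beta \<ge> 0" using beta q0[of A] by (simp add: q_def)
  have e2: "e\<^sup>2 = beta / real m" using beta0 by (simp add: e_def)
  have e0: "e \<ge> 0" using beta0 by (simp add: e_def)
  have step: "q (\<lambda>a b. R a b - t * of_bool (a \<in> S \<and> b \<in> T)) \<le> q R - t\<^sup>2"
    if ST: "S \<subseteq> Z" "T \<subseteq> Z" and t: "t = (\<Sum>a\<in>S. \<Sum>b\<in>T. R a b) / (real (card Z))\<^sup>2" for R S T t
  proof -
    let ?o = "\<lambda>a b. of_bool (a \<in> S \<and> b \<in> T) :: real"
    have inner: "avg Z (\<lambda>a. avg Z (\<lambda>b. R a b * ?o a b)) = t"
    proof -
      have "(\<Sum>a\<in>Z. \<Sum>b\<in>Z. R a b * ?o a b) = (\<Sum>a\<in>Z. if a \<in> S then \<Sum>b\<in>Z. if b \<in> T then R a b else 0 else 0)"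
        by (intro sum.cong refl) (auto intro!: sum.cong)
      also have "\<dots> = (\<Sum>a\<in>S. \<Sum>b\<in>T. R a b)"
        using ST Z by (simp add: sum.inter_restrict[symmetric] Int_absorb1)
      finally show ?thesis unfolding t
        by (simp add: avg_def sum_divide_distrib[symmetric] power2_eq_square)
    qed
    have "q (\<lambda>a b. R a b - t * ?o a b)
      = avg Z (\<lambda>a. avg Z (\<lambda>b. (R a b)\<^sup>2 - 2 * t * (R a b * ?o a b) + t\<^sup>2 * ?o a b))"
      unfolding q_def by (intro avg_cong) (auto simp: power2_eq_square algebra_simps)
    also have "\<dots> = q R - 2 * t * t + t\<^sup>2 * avg Z (\<lambda>a. avg Z (\<lambda>b. ?o a b))"
      unfolding q_def avg_add avg_diff avg_cmult inner ..
    finally have eq: "q (\<lambda>a b. R a b - t * ?o a b) = \<dots>" .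
    have "avg Z (\<lambda>a. avg Z (\<lambda>b. ?o a b)) \<le> 1"
      using Z by (intro avg_le_const) auto
    then have "t\<^sup>2 * avg Z (\<lambda>a. avg Z (\<lambda>b. ?o a b)) \<le> t\<^sup>2 * 1"
      by (intro mult_left_mono) auto
    then show ?thesis unfolding eq by (simp only: power2_eq_square)
  qed
  \<comment> \<open>Invariant of the greedy procedure: as long as no good remainder has been found,
    every coefficient so far has square at least \<open>e\<^sup>2\<close>.\<close>
  have "\<exists>c S T. q (rem n c S T) + (\<Sum>l<n. (c l)\<^sup>2) \<le> beta
      \<and> (good (rem n c S T) \<or> real n * e\<^sup>2 \<le> (\<Sum>l<n. (c l)\<^sup>2))" for n
  proof (induction n)
    case 0
    then show ?case using beta by (auto simp: q_def rem_def)
  next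
    case (Suc n)
    then obtain c S T where IH: "q (rem n c S T) + (\<Sum>l<n. (c l)\<^sup>2) \<le> beta"
      "good (rem n c S T) \<or> real n * e\<^sup>2 \<le> (\<Sum>l<n. (c l)\<^sup>2)" by blast
    have ext: "rem (Suc n) (c(n := t)) (S(n := S')) (T(n := T')) =
        (\<lambda>a b. rem n c S T a b - t * of_bool (a \<in> S' \<and> b \<in> T'))"
      "(\<Sum>l<Suc n. ((c(n := t)) l)\<^sup>2) = (\<Sum>l<n. (c l)\<^sup>2) + t\<^sup>2" for t S' T'
      by (auto simp: rem_def fun_eq_iff intro!: sum.cong)
    show ?case
    proof (cases "good (rem n c S T)")
      case True
      \<comment> \<open>Once the remainder is good, empty rectangles with coefficient 0 pad the
        list, so that exactly \<open>m\<close> terms result.\<close>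
      then have "q (rem (Suc n) (c(n := 0)) (S(n := {})) (T(n := {}))) + (\<Sum>l<Suc n. ((c(n := 0)) l)\<^sup>2) \<le> beta
        \<and> good (rem (Suc n) (c(n := 0)) (S(n := {})) (T(n := {})))"
        unfolding ext using IH by simp
      then show ?thesis by blast
    next
      case False
      then obtain S' T' where S': "S' \<subseteq> Z" "T' \<subseteq> Z"
        "\<bar>\<Sum>a\<in>S'. \<Sum>b\<in>T'. rem n c S T a b\<bar> > e * (real (card Z))\<^sup>2"
        by (auto simp: good_def not_le)
      define t where "t = (\<Sum>a\<in>S'. \<Sum>b\<in>T'. rem n c S T a b) / (real (card Z))\<^sup>2"
      have "\<bar>t\<bar> > e" using S'(3) cZ by (simp add: t_def less_divide_eq)
      then have "t\<^sup>2 \<ge> e\<^sup>2" using e0 by (simp add: abs_le_square_iff[symmetric])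
      moreover have "real n * e\<^sup>2 \<le> (\<Sum>l<n. (c l)\<^sup>2)" using IH(2) False by simp
      ultimately have "real (Suc n) * e\<^sup>2 \<le> (\<Sum>l<n. (c l)\<^sup>2) + t\<^sup>2" by (simp add: algebra_simps)
      moreover have "q (\<lambda>a b. rem n c S T a b - t * of_bool (a \<in> S' \<and> b \<in> T')) \<le> q (rem n c S T) - t\<^sup>2"
        by (rule step[OF S'(1,2) t_def])
      ultimately have "q (rem (Suc n) (c(n := t)) (S(n := S')) (T(n := T'))) + (\<Sum>l<Suc n. ((c(n := t)) l)\<^sup>2) \<le> beta
        \<and> real (Suc n) * e\<^sup>2 \<le> (\<Sum>l<Suc n. ((c(n := t)) l)\<^sup>2)"
        unfolding ext using IH(1) by simp
      then show ?thesis by blast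
    qed
  qed
  from this[of m] obtain c S T where *: "q (rem m c S T) + (\<Sum>l<m. (c l)\<^sup>2) \<le> beta"
    "good (rem m c S T) \<or> real m * e\<^sup>2 \<le> (\<Sum>l<m. (c l)\<^sup>2)" by blast
  \<comment> \<open>If no remainder was good, the \<open>m\<close> coefficients use up all of
    \<open>beta\<close>, since \<open>real m * e\<^sup>2 = beta\<close>. The remainder then has
    energy 0, vanishes on \<open>Z \<times> Z\<close>, and is good after all.\<close>
  have "good (rem m c S T)"
  proof (rule ccontr)
    assume ng: "\<not> good (rem m c S T)"
    then have "beta \<le> (\<Sum>l<m. (c l)\<^sup>2)" using * m by (simp add: e2)
    then have "q (rem m c S T) = 0" using * q0[of "rem m c S T"] by simp
    then have "(\<Sum>a\<in>Z. \<Sum>b\<in>Z. (rem m c S T a b)\<^sup>2) = 0"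
      using cZ by (simp add: q_def avg_def sum_divide_distrib[symmetric])
    then have "rem m c S T a b = 0" if "a \<in> Z" "b \<in> Z" for a b
      using Z that by (simp add: sum_nonneg_eq_0_iff sum_nonneg)
    then have "(\<Sum>a\<in>S'. \<Sum>b\<in>T'. rem m c S T a b) = 0" if "S' \<subseteq> Z" "T' \<subseteq> Z" for S' T'
      using that by (intro sum.neutral ballI) auto
    then have "good (rem m c S T)" using e0 by (simp add: good_def)
    with ng show False by simp
  qed
  show ?thesis
  proof (rule that)
    show "rem m c S T a b = A a b - (\<Sum>l<m. c l * of_bool (a \<in> S l \<and> b \<in> T l))" for a b
      by (rule rem_def)
    show "avg Z (\<lambda>a. avg Z (\<lambda>b. (rem m c S T a b)\<^sup>2)) \<le> beta"
      using * sum_nonneg[of "{..<m}" "\<lambda>l. (c l)\<^sup>2"] by (simp add: q_def)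
    show "(\<Sum>l<m. (c l)\<^sup>2) \<le> beta" using * q0[of "rem m c S T"] by simp
  qed (use \<open>good (rem m c S T)\<close> in \<open>auto simp: good_def e_def\<close>)
qed

section \<open>Types of points and their matching\<close>

lemma avg_type_deviation_le:
  assumes k: "k \<ge> 1" and Z: "finite Z" "Z \<noteq> {}"
  shows "avg (PiE {..<k} (\<lambda>_. Z))
      (\<lambda>x. \<Sum>t\<in>Ty. \<bar>real (card {i. i < k \<and> \<tau> (x i) = t}) / real k - real (card {a\<in>Z. \<tau> a = t}) / real (card Z)\<bar>)
    \<le> real (card Ty) / sqrt (real k)"
proof -
  have "avg (PiE {..<k} (\<lambda>_. Z))
      (\<lambda>x. \<bar>real (card {i. i < k \<and> \<tau> (x i) = t}) / real k - real (card {a\<in>Z. \<tau> a = t}) / real (card Z)\<bar>)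
    \<le> 1 / sqrt (real k)" for t
  proof -
    define lam where "lam = real (card {a\<in>Z. \<tau> a = t}) / real (card Z)"
    \<comment> \<open>The centred indicator of type \<open>t\<close>: its sum over the sample has
      variance at most \<open>k\<close>, whence a deviation of \<open>1 / sqrt k\<close> for each
      type.\<close>
    define f where "f a = of_bool (\<tau> a = t) - lam" for a
    have lam: "avg Z (\<lambda>a. of_bool (\<tau> a = t)) = lam"
      using Z by (simp add: avg_def lam_def sum_of_bool_eq Int_def conj_commute)
    have cle: "card {a\<in>Z. \<tau> a = t} \<le> card Z" using Z by (intro card_mono) auto
    have lam01: "0 \<le> lam" "lam \<le> 1" unfolding lam_def using cle Z by (auto simp: divide_le_eq)
    have f0: "avg Z f = 0" unfolding f_def using lam Z by (simp add: avg_diff avg_const)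
    have f1: "avg Z (\<lambda>a. (f a)\<^sup>2) \<le> 1"
      using Z lam01 by (intro avg_le_const) (auto simp: f_def abs_square_le_1)
    have eq: "(\<Sum>i<k. f (x i)) = real (card {i. i < k \<and> \<tau> (x i) = t}) - real k * lam" for x
      by (simp add: f_def sum_subtractf sum_of_bool_eq Int_def conj_commute lessThan_def)
    have "avg (PiE {..<k} (\<lambda>_. Z)) (\<lambda>x. \<bar>real (card {i. i < k \<and> \<tau> (x i) = t}) / real k - lam\<bar>)
      = avg (PiE {..<k} (\<lambda>_. Z)) (\<lambda>x. 1 / real k * \<bar>\<Sum>i<k. f (x i)\<bar>)"
    proof (intro avg_cong)
      fix x :: "nat \<Rightarrow> 'a"
      have "real (card {i. i < k \<and> \<tau> (x i) = t}) / real k - lam = 1 / real k * (\<Sum>i<k. f (x i))"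
        unfolding eq using k by (simp add: field_simps)
      then show "\<bar>real (card {i. i < k \<and> \<tau> (x i) = t}) / real k - lam\<bar> = 1 / real k * \<bar>\<Sum>i<k. f (x i)\<bar>"
        by (simp add: abs_mult)
    qed
    also have "\<dots> \<le> 1 / real k * sqrt (real k * 1)"
      unfolding avg_cmult
      using avg_PiE_abs_sum_le[OF finite_lessThan Z f0, of k] f1 k
      by (intro mult_left_mono order_trans[OF avg_PiE_abs_sum_le[OF finite_lessThan Z f0]] real_sqrt_le_mono) auto
    also have "\<dots> = 1 / sqrt (real k)"
      using k by (simp add: real_sqrt_divide field_simps)
    finally show ?thesis unfolding lam_def .
  qed
  then have "avg (PiE {..<k} (\<lambda>_. Z))
      (\<lambda>x. \<Sum>t\<in>Ty. \<bar>real (card {i. i < k \<and> \<tau> (x i) = t}) / real k - real (card {a\<in>Z. \<tau> a = t}) / real (card Z)\<bar>)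
    \<le> (\<Sum>t\<in>Ty. 1 / sqrt (real k))"
    unfolding avg_sum by (intro sum_mono)
  then show ?thesis by simp
qed

text \<open>Within each colour as many elements as possible are paired, namely the smaller of the
  two counts; the leftovers are paired arbitrarily. Only leftovers can be mismatched, and each
  colour leaves over at most the difference of its counts.\<close>

lemma colour_matching:
  assumes E: "finite E" and Ty: "finite Ty" and c: "c1 ` E \<subseteq> Ty" "c2 ` E \<subseteq> Ty"
  obtains p where "bij_betw p E E"
    "real (card {e\<in>E. c1 e \<noteq> c2 (p e)})
      \<le> (\<Sum>t\<in>Ty. \<bar>real (card {e\<in>E. c1 e = t}) - real (card {e\<in>E. c2 e = t})\<bar>)"
proof -
  let ?n1 = "\<lambda>t. card {e\<in>E. c1 e = t}" and ?n2 = "\<lambda>t. card {e\<in>E. c2 e = t}"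
  have "\<forall>t. \<exists>A. A \<subseteq> {e\<in>E. c1 e = t} \<and> card A = min (?n1 t) (?n2 t)"
  proof
    fix t
    obtain X where "X \<subseteq> {e\<in>E. c1 e = t}" "card X = min (?n1 t) (?n2 t)"
      by (rule obtain_subset_with_card_n[OF min.cobounded1])
    then show "\<exists>X. X \<subseteq> {e\<in>E. c1 e = t} \<and> card X = min (?n1 t) (?n2 t)" by blast
  qed
  from choice[OF this] obtain A
    where A': "\<forall>t. A t \<subseteq> {e\<in>E. c1 e = t} \<and> card (A t) = min (?n1 t) (?n2 t)" ..
  have A: "A t \<subseteq> {e\<in>E. c1 e = t}" "card (A t) = min (?n1 t) (?n2 t)" for t
    using spec[OF A', of t] by blast+
  have "\<forall>t. \<exists>B. B \<subseteq> {e\<in>E. c2 e = t} \<and> card B = min (?n1 t) (?n2 t)"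
  proof
    fix t
    obtain X where "X \<subseteq> {e\<in>E. c2 e = t}" "card X = min (?n1 t) (?n2 t)"
      by (rule obtain_subset_with_card_n[OF min.cobounded2])
    then show "\<exists>X. X \<subseteq> {e\<in>E. c2 e = t} \<and> card X = min (?n1 t) (?n2 t)" by blast
  qed
  from choice[OF this] obtain B
    where B': "\<forall>t. B t \<subseteq> {e\<in>E. c2 e = t} \<and> card (B t) = min (?n1 t) (?n2 t)" ..
  have B: "B t \<subseteq> {e\<in>E. c2 e = t}" "card (B t) = min (?n1 t) (?n2 t)" for t
    using spec[OF B', of t] by blast+
  have finAB: "finite (A t)" "finite (B t)" for t
    using finite_subset[OF A(1)] finite_subset[OF B(1)] E by auto
  have "\<forall>t. \<exists>g. bij_betw g (A t) (B t)"
    using finAB A(2) B(2) by (simp add: finite_same_card_bij)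
  from choice[OF this] obtain g where "\<forall>t. bij_betw (g t) (A t) (B t)" ..
  then have g: "bij_betw (g t) (A t) (B t)" for t by simp
  have inA: "e \<in> E" "c1 e = t" if "e \<in> A t" for e t using subsetD[OF A(1) that] by simp_all
  have inB: "e \<in> E" "c2 e = t" if "e \<in> B t" for e t using subsetD[OF B(1) that] by simp_all
  define h where "h e = g (c1 e) e" for e
  let ?A = "\<Union>t\<in>Ty. A t" and ?B = "\<Union>t\<in>Ty. B t"
  have h: "bij_betw h ?A ?B"
  proof (rule bij_betw_UNION_disjoint)
    show "disjoint_family_on B Ty" unfolding disjoint_family_on_def using inB(2) by blast
    show "bij_betw h (A t) (B t)" for t
      by (rule iffD1[OF bij_betw_cong g[of t]]) (use inA in \<open>auto simp: h_def\<close>)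
  qed
  have sub: "?A \<subseteq> E" "?B \<subseteq> E" using inA(1) inB(1) by auto
  have fin: "finite ?A" "finite ?B" using sub E by (auto intro: finite_subset)
  have "card (E - ?A) = card (E - ?B)"
    using bij_betw_same_card[OF h] sub fin by (simp add: card_Diff_subset)
  then obtain h' where h': "bij_betw h' (E - ?A) (E - ?B)"
    using E finite_same_card_bij by (metis finite_Diff)
  define p where "p e = (if e \<in> ?A then h e else h' e)" for e
  have "bij_betw p (?A \<union> (E - ?A)) (?B \<union> (E - ?B))"
  proof (rule bij_betw_combine)
    show "bij_betw p ?A ?B" by (rule iffD1[OF bij_betw_cong h]) (auto simp: p_def)
    show "bij_betw p (E - ?A) (E - ?B)" by (rule iffD1[OF bij_betw_cong h']) (auto simp: p_def)
  qed auto
  then have bij: "bij_betw p E E" using sub by (simp add: Un_absorb1)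
  have match: "c2 (p e) = c1 e" if "e \<in> ?A" for e
  proof -
    from that obtain t where t: "t \<in> Ty" "e \<in> A t" by auto
    then have "p e = g t e" using that inA(2)[OF t(2)] by (simp add: p_def h_def)
    moreover have "c2 (g t e) = t" by (rule inB(2)[OF bij_betw_apply[OF g t(2)]])
    ultimately show ?thesis using inA(2)[OF t(2)] by simp
  qed
  have "card {e\<in>E. c1 e \<noteq> c2 (p e)} \<le> card (E - ?A)"
    using match[symmetric] E by (intro card_mono) (simp, blast)
  then have "real (card {e\<in>E. c1 e \<noteq> c2 (p e)}) \<le> real (card E) - real (card ?A)"
    using sub fin card_mono[OF E sub(1)] by (simp add: card_Diff_subset)
  also have "card ?A = (\<Sum>t\<in>Ty. card (A t))"
  proof (rule card_UN_disjoint)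
    show "\<forall>i\<in>Ty. finite (A i)" using finAB by blast
    show "\<forall>i\<in>Ty. \<forall>j\<in>Ty. i \<noteq> j \<longrightarrow> A i \<inter> A j = {}" using inA(2) by blast
  qed (use Ty in auto)
  also have "card E = (\<Sum>t\<in>Ty. ?n1 t)"
  proof -
    have "E = (\<Union>t\<in>Ty. {e\<in>E. c1 e = t})" using c by auto
    then have "card E = card (\<Union>t\<in>Ty. {e\<in>E. c1 e = t})" by simp
    also have "\<dots> = (\<Sum>t\<in>Ty. ?n1 t)"
      using E Ty by (intro card_UN_disjoint) auto
    finally show ?thesis .
  qed
  also have "real (\<Sum>t\<in>Ty. ?n1 t) - real (\<Sum>t\<in>Ty. card (A t))
      = (\<Sum>t\<in>Ty. real (?n1 t) - real (min (?n1 t) (?n2 t)))"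
    by (simp add: A(2) sum_subtractf)
  also have "\<dots> \<le> (\<Sum>t\<in>Ty. \<bar>real (?n1 t) - real (?n2 t)\<bar>)"
    by (intro sum_mono) auto
  finally show ?thesis using that bij by blast
qed

section \<open>Step functions and permutations of cells\<close>

text \<open>\<open>lebesgue\<close> on the plane is the completion of \<open>lborel\<close>, not the
  product of two completed measures. Each factor is a Borel set up to a null set, and the error of
  the product lies in the null cross
  \<open>N1' \<times> UNIV \<union> UNIV \<times> N2'\<close>.\<close>

lemma lebesgue_Times:
  fixes S T :: "real set"
  assumes "S \<in> sets lebesgue" "T \<in> sets lebesgue"
  shows "S \<times> T \<in> sets lebesgue"
    and "emeasure lebesgue (S \<times> T) = emeasure lebesgue S * emeasure lebesgue T"
proof -
  obtain S1 N1 N1' where S: "S = S1 \<union> N1" "N1 \<subseteq> N1'" "N1' \<in> null_sets lborel" "S1 \<in> sets lborel"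
    using assms(1) by (rule sets_completionE)
  obtain T1 N2 N2' where T: "T = T1 \<union> N2" "N2 \<subseteq> N2'" "N2' \<in> null_sets lborel" "T1 \<in> sets lborel"
    using assms(2) by (rule sets_completionE)
  define D where "D = N1 \<times> T \<union> S \<times> N2"
  have "N1' \<times> UNIV \<union> UNIV \<times> N2' \<in> null_sets (lborel \<Otimes>\<^sub>M lborel :: (real \<times> real) measure)"
    using S(3) T(3)
    by (intro null_sets.Un lborel.times_in_null_sets1 lborel.times_in_null_sets2) auto
  then have N: "N1' \<times> UNIV \<union> UNIV \<times> N2' \<in> null_sets (lborel :: (real \<times> real) measure)"
    by (simp add: lborel_prod)
  have D: "D \<in> null_sets lebesgue"
    using N S T by (intro null_sets_completion_subset[OF _ null_sets_completionI[OF N]]) (auto simp: D_def)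
  have eq: "S \<times> T = S1 \<times> T1 \<union> D" unfolding D_def S(1) T(1) by auto
  have ST1: "S1 \<times> T1 \<in> sets (lborel :: (real \<times> real) measure)"
    using S(4) T(4) by (subst lborel_prod[symmetric]) auto
  show "S \<times> T \<in> sets lebesgue" unfolding eq using ST1 D by auto
  have "emeasure lebesgue (S \<times> T) = emeasure lebesgue (S1 \<times> T1)"
    unfolding eq using ST1 D by (intro emeasure_Un_null_set) auto
  also have "\<dots> = emeasure (lborel \<Otimes>\<^sub>M lborel) (S1 \<times> T1)" using ST1 by (simp add: lborel_prod)
  also have "\<dots> = emeasure lborel S1 * emeasure lborel T1"
    using S(4) T(4) by (intro lborel.emeasure_pair_measure_Times)
  also have "\<dots> = emeasure lebesgue S1 * emeasure lebesgue T1" using S(4) T(4) by simp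
  also have "emeasure lebesgue S1 = emeasure lebesgue S"
    unfolding S(1) using S by (intro emeasure_Un_null_set[symmetric] null_sets_completion_subset[OF _ null_sets_completionI]) auto
  also have "emeasure lebesgue T1 = emeasure lebesgue T"
    unfolding T(1) using T by (intro emeasure_Un_null_set[symmetric] null_sets_completion_subset[OF _ null_sets_completionI]) auto
  finally show "emeasure lebesgue (S \<times> T) = emeasure lebesgue S * emeasure lebesgue T" .
qed

lemma measure_lebesgue_Times:
  fixes S T :: "real set"
  assumes "S \<in> sets lebesgue" "T \<in> sets lebesgue"
  shows "measure lebesgue (S \<times> T) = measure lebesgue S * measure lebesgue T"
  by (simp add: measure_def lebesgue_Times[OF assms] enn2real_mult)

lemma step_index_less: "k \<ge> 1 \<Longrightarrow> step_index k x < k"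
  by (auto simp: step_index_def)

lemma measurable_step_index [measurable]: "step_index k \<in> borel \<rightarrow>\<^sub>M count_space UNIV"
  unfolding step_index_def by measurable

lemma step_index_eq_iff:
  assumes "k \<ge> 1" "0 \<le> x" "x < 1"
  shows "step_index k x = i \<longleftrightarrow> real i / real k \<le> x \<and> x < (real i + 1) / real k"
proof -
  have "real k * x < real k" using assms by simp
  then have *: "nat \<lfloor>real k * x\<rfloor> \<le> k - 1" using assms by linarith
  have "nat \<lfloor>real k * x\<rfloor> = i \<longleftrightarrow> real i \<le> real k * x \<and> real k * x < real i + 1"
    using assms by (simp add: nat_eq_iff floor_eq_iff)
  then show ?thesis using * assms by (simp add: step_index_def field_simps min_absorb2)
qed

lemma step_interval_iff:
  assumes "i < k"
  shows "x \<in> {real i / real k..<(real i + 1) / real k} \<longleftrightarrow> 0 \<le> x \<and> x < 1 \<and> step_index k x = i"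
proof -
  have k: "k \<ge> 1" using assms by simp
  have "0 \<le> x \<and> x < 1" if x: "real i / real k \<le> x" "x < (real i + 1) / real k"
  proof
    show "0 \<le> x" by (rule order_trans[OF _ x(1)]) simp
    show "x < 1" by (rule less_le_trans[OF x(2)]) (use assms in \<open>simp add: divide_le_eq\<close>)
  qed
  then show ?thesis using step_index_eq_iff[OF k, of x i] by (auto simp del: divide_le_eq)
qed

text \<open>Passing to a refinement: cell \<open>i\<close> of \<open>k * n\<close> lies in step
  \<open>i div n\<close> of \<open>k\<close>. The floors nest, and the cap that puts the point 1
  into the last step is respected, since \<open>(k * n - 1) div n = k - 1\<close>.\<close>

lemma step_index_div:
  assumes "k \<ge> 1" "n \<ge> 1" "0 \<le> x"
  shows "step_index (k * n) x div n = step_index k x"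
proof -
  have "\<lfloor>real k * x\<rfloor> = \<lfloor>(real k * real n * x) / real_of_int (int n)\<rfloor>" using assms by simp
  also have "\<dots> = \<lfloor>real k * real n * x\<rfloor> div int n" by (rule floor_divide_real_eq_div) simp
  finally have 1: "nat \<lfloor>real k * x\<rfloor> = nat \<lfloor>real (k * n) * x\<rfloor> div n"
    using assms by (simp add: nat_div_distrib)
  have 2: "(k * n - 1) div n = k - 1"
  proof -
    obtain k' where "k = Suc k'" using assms by (cases k) auto
    then show ?thesis using assms by (intro div_nat_eqI) (auto simp: algebra_simps)
  qed
  have 3: "min a b div n = min (a div n) (b div n)" for a b :: nat
    by (simp add: min_def div_le_mono) (metis div_le_mono le_antisym nat_le_linear)
  show ?thesis unfolding step_index_def 1 3 2 ..
qed

definition grid :: "nat \<Rightarrow> (nat \<Rightarrow> nat \<Rightarrow> real) \<Rightarrow> real \<times> real \<Rightarrow> real"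
  where "grid k D = (\<lambda>(x, y). D (step_index k x) (step_index k y))"

definition cell :: "nat \<Rightarrow> nat \<Rightarrow> real set"
  where "cell k i = {x \<in> {0..1}. step_index k x = i}"

lemma cell_sets [measurable]: "cell k i \<in> sets borel"
  unfolding cell_def by measurable

lemma emeasure_cell:
  assumes "k \<ge> 1" "i < k"
  shows "emeasure lborel (cell k i) = ennreal (1 / real k)"
proof -
  let ?I = "{real i / real k..<(real i + 1) / real k}"
  \<comment> \<open>Only the last cell differs from its half-open interval, by the point 1.\<close>
  have "cell k i - {1} = ?I"
    unfolding set_eq_iff step_interval_iff[OF assms(2)] by (auto simp: cell_def)
  moreover have "emeasure lborel (cell k i - {1}) = emeasure lborel (cell k i)"
    by (intro emeasure_Diff_null_set) auto
  moreover have "(real i + 1) / real k - real i / real k = 1 / real k"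
    by (simp add: diff_divide_distrib[symmetric])
  moreover have "real i / real k \<le> (real i + 1) / real k" by (simp add: divide_right_mono)
  ultimately show ?thesis by simp
qed

lemma measure_Int_cell_le:
  assumes "k \<ge> 1" "i < k" "S \<in> sets lebesgue"
  shows "measure lebesgue (S \<inter> cell k i) \<le> 1 / real k"
proof -
  have "emeasure lebesgue (S \<inter> cell k i) \<le> emeasure lebesgue (cell k i)"
    using assms by (intro emeasure_mono) auto
  also have "\<dots> = ennreal (1 / real k)" using emeasure_cell[OF assms(1,2)] by simp
  finally show ?thesis by (simp add: measure_def enn2real_leI)
qed

text \<open>On \<open>S \<times> T\<close> a step function is a finite combination of indicators of
  rectangles. Integrals over arbitrary measurable \<open>S\<close> and \<open>T\<close> thus become
  matrix sums with weights between 0 and \<open>1 / k\<close>, to which the discrete cut norm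
  applies.\<close>

lemma grid_integral:
  assumes k: "k \<ge> 1" and S: "S \<in> sets lebesgue" "S \<subseteq> {0..1}" and T: "T \<in> sets lebesgue" "T \<subseteq> {0..1}"
  shows "set_integrable lebesgue (S \<times> T) (grid k D)"
    and "(LINT z:S \<times> T|lebesgue. grid k D z) =
      (\<Sum>i<k. \<Sum>j<k. D i j * measure lebesgue (S \<inter> cell k i) * measure lebesgue (T \<inter> cell k j))"
proof -
  have eq: "indicator (S \<times> T) z *\<^sub>R grid k D z =
    (\<Sum>i<k. \<Sum>j<k. D i j * indicator ((S \<inter> cell k i) \<times> (T \<inter> cell k j)) z)" for z
  proof (cases z)
    case (Pair x y)
    show ?thesis
    proof (cases "x \<in> S \<and> y \<in> T")
      case True
      then have xy: "x \<in> {0..1}" "y \<in> {0..1}" using S T by auto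
      have "(\<Sum>i<k. \<Sum>j<k. D i j * indicator ((S \<inter> cell k i) \<times> (T \<inter> cell k j)) z)
        = (\<Sum>i<k. \<Sum>j<k. if j = step_index k y then if i = step_index k x then D i j else 0 else 0)"
        using True xy Pair by (intro sum.cong refl) (auto simp: cell_def)
      also have "\<dots> = D (step_index k x) (step_index k y)"
        using k by (simp add: step_index_less)
      finally show ?thesis using True Pair by (simp add: grid_def)
    qed (auto simp: Pair)
  qed
  have sets: "S \<inter> cell k i \<in> sets lebesgue" "T \<inter> cell k i \<in> sets lebesgue" for i using S T by auto
  have prod: "(S \<inter> cell k i) \<times> (T \<inter> cell k j) \<in> sets lebesgue" for i j
    using sets by (intro lebesgue_Times(1))
  have fin: "emeasure lebesgue ((S \<inter> cell k i) \<times> (T \<inter> cell k j)) < \<infinity>" for i j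
  proof -
    have "emeasure lebesgue (S \<inter> cell k i) \<le> emeasure lebesgue {0..1::real}"
      "emeasure lebesgue (T \<inter> cell k j) \<le> emeasure lebesgue {0..1::real}"
      using S T by (intro emeasure_mono; auto)+
    then have "emeasure lebesgue (S \<inter> cell k i) * emeasure lebesgue (T \<inter> cell k j) \<le> 1 * 1"
      by (intro mult_mono) auto
    then show ?thesis using lebesgue_Times(2)[OF sets(1) sets(2), of i j]
      by (simp add: le_less_trans[OF _ ennreal_one_less_top])
  qed
  have int: "integrable lebesgue (\<lambda>z. D i j * indicator ((S \<inter> cell k i) \<times> (T \<inter> cell k j)) z :: real)" for i j
    using prod fin by (intro integrable_mult_right integrable_real_indicator) auto
  show "set_integrable lebesgue (S \<times> T) (grid k D)"
    unfolding set_integrable_def eq by (intro Bochner_Integration.integrable_sum int)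
  have "(LINT z:S \<times> T|lebesgue. grid k D z)
    = (\<Sum>i<k. \<Sum>j<k. D i j * measure lebesgue ((S \<inter> cell k i) \<times> (T \<inter> cell k j)))"
  proof -
    have "(LINT z|lebesgue. D i j * indicator ((S \<inter> cell k i) \<times> (T \<inter> cell k j)) z)
      = D i j * measure lebesgue ((S \<inter> cell k i) \<times> (T \<inter> cell k j))" for i j
      using prod by simp
    then show ?thesis unfolding set_lebesgue_integral_def eq
      by (simp only: Bochner_Integration.integral_sum Bochner_Integration.integrable_sum int)
  qed
  then show "(LINT z:S \<times> T|lebesgue. grid k D z) =
      (\<Sum>i<k. \<Sum>j<k. D i j * measure lebesgue (S \<inter> cell k i) * measure lebesgue (T \<inter> cell k j))"
    by (simp add: measure_lebesgue_Times[OF sets(1) sets(2)] mult.assoc)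
qed

text \<open>
  The last cell contains 1, so translating whole cells would not be injective at that point; it is kept fixed.
\<close>

definition cell_perm :: "nat \<Rightarrow> (nat \<Rightarrow> nat) \<Rightarrow> real \<Rightarrow> real"
  where "cell_perm N p x =
    (if 0 \<le> x \<and> x < 1 then x + (real (p (step_index N x)) - real (step_index N x)) / real N else x)"

abbreviation cell_perm2 :: "nat \<Rightarrow> (nat \<Rightarrow> nat) \<Rightarrow> real \<times> real \<Rightarrow> real \<times> real"
  where "cell_perm2 N p \<equiv> \<lambda>z. (cell_perm N p (fst z), cell_perm N p (snd z))"

lemma cell_perm_step:
  assumes N: "N \<ge> 1" and p: "p ` {..<N} \<subseteq> {..<N}" and x: "0 \<le> x" "x < 1"
  shows "0 \<le> cell_perm N p x" "cell_perm N p x < 1"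
    "step_index N (cell_perm N p x) = p (step_index N x)"
proof -
  let ?i = "step_index N x"
  have i: "?i < N" using N by (rule step_index_less)
  have pi: "p ?i < N" using p i by auto
  define a b d where "a = real ?i / real N" and "b = real (p ?i) / real N" and "d = 1 / real N"
  have s: "(real ?i + 1) / real N = a + d" "(real (p ?i) + 1) / real N = b + d"
    by (simp_all add: a_def b_def d_def add_divide_distrib)
  have 1: "a \<le> x" "x < a + d"
    using step_index_eq_iff[OF N x, of ?i] unfolding s a_def[symmetric] by blast+
  have "cell_perm N p x = x + b - a"
    using x by (simp add: cell_perm_def diff_divide_distrib a_def b_def)
  then have "cell_perm N p x \<in> {b..<b + d}" using 1 by simp
  then have "cell_perm N p x \<in> {real (p ?i) / real N..<(real (p ?i) + 1) / real N}"
    unfolding s b_def[symmetric] .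
  then show "0 \<le> cell_perm N p x" "cell_perm N p x < 1" "step_index N (cell_perm N p x) = p ?i"
    unfolding step_interval_iff[OF pi] by blast+
qed

lemma cell_perm_inverse:
  assumes N: "N \<ge> 1" and p: "p ` {..<N} \<subseteq> {..<N}" and q: "\<And>i. i < N \<Longrightarrow> q (p i) = i"
  shows "cell_perm N q (cell_perm N p x) = x"
proof (cases "0 \<le> x \<and> x < 1")
  case True
  let ?y = "cell_perm N p x"
  have q': "q (p (step_index N x)) = step_index N x" using q N by (simp add: step_index_less)
  note y = cell_perm_step[OF N p, of x]
  have "cell_perm N q ?y = ?y + (real (q (step_index N ?y)) - real (step_index N ?y)) / real N"
    using y True by (simp add: cell_perm_def[of N q ?y])
  also have "\<dots> = ?y + (real (step_index N x) - real (p (step_index N x))) / real N"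
    using y True q' by simp
  finally have 1: "cell_perm N q ?y = ?y + (real (step_index N x) - real (p (step_index N x))) / real N" .
  have 2: "?y = x + (real (p (step_index N x)) - real (step_index N x)) / real N"
    using True by (simp add: cell_perm_def)
  show ?thesis using 1 2 unfolding diff_divide_distrib by argo
next
  case False
  then have "cell_perm N r x = x" for r by (auto simp: cell_perm_def)
  then show ?thesis by simp
qed

lemma measurable_cell_perm [measurable]: "cell_perm N p \<in> borel_measurable borel"
proof -
  have "(\<lambda>x. real (p (step_index N x)) - real (step_index N x)) \<in> borel_measurable borel"
    by (intro measurable_compose[OF measurable_step_index]) simp
  then show ?thesis unfolding cell_perm_def by measurable
qed

text \<open>A Borel set is cut up by the half-open intervals \<open>J i\<close> and the complement
  of their union. The map is the identity on that complement and a translation from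
  \<open>J i\<close> onto \<open>J (p i)\<close>, and \<open>p\<close> only reorders the
  summands.\<close>

lemma distr_cell_perm:
  assumes N: "N \<ge> 1" and p: "bij_betw p {..<N} {..<N}"
  shows "distr lborel borel (cell_perm N p) = lborel"
proof (rule measure_eqI)
  show "sets (distr lborel borel (cell_perm N p)) = sets lborel" by simp
  fix B assume "B \<in> sets (distr lborel borel (cell_perm N p))"
  then have B [measurable]: "B \<in> sets borel" by simp
  define J where "J i = {real i / real N..<(real i + 1) / real N}" for i
  have pN: "p ` {..<N} \<subseteq> {..<N}" using p by (simp add: bij_betw_def)
  have J_iff: "x \<in> J i \<longleftrightarrow> 0 \<le> x \<and> x < 1 \<and> step_index N x = i" if "i < N" for x i
    unfolding J_def using that by (rule step_interval_iff)
  have decomp: "emeasure lborel C = emeasure lborel (C - {0..<1}) + (\<Sum>i<N. emeasure lborel (C \<inter> J i))"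
    if C [measurable]: "C \<in> sets borel" for C
  proof -
    have "C = (C - {0..<1}) \<union> (\<Union>i<N. C \<inter> J i)"
      using J_iff step_index_less[OF N] by auto
    then have "emeasure lborel C = emeasure lborel ((C - {0..<1}) \<union> (\<Union>i<N. C \<inter> J i))" by simp
    also have "\<dots> = emeasure lborel (C - {0..<1}) + emeasure lborel (\<Union>i<N. C \<inter> J i)"
      using J_iff by (intro plus_emeasure[symmetric]) (auto simp: J_def)
    also have "emeasure lborel (\<Union>i<N. C \<inter> J i) = (\<Sum>i<N. emeasure lborel (C \<inter> J i))"
      using J_iff by (intro sum_emeasure[symmetric]) (auto simp: J_def disjoint_family_on_def)
    finally show ?thesis .
  qed
  let ?V = "cell_perm N p -` B"
  have V: "?V \<in> sets borel" using measurable_sets[OF measurable_cell_perm B] by simp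
  have "emeasure (distr lborel borel (cell_perm N p)) B = emeasure lborel ?V"
    by (simp add: emeasure_distr)
  also have "\<dots> = emeasure lborel (?V - {0..<1}) + (\<Sum>i<N. emeasure lborel (?V \<inter> J i))"
    by (rule decomp[OF V])
  also have "?V - {0..<1} = B - {0..<1}" by (auto simp: cell_perm_def)
  also have "(\<Sum>i<N. emeasure lborel (?V \<inter> J i)) = (\<Sum>i<N. emeasure lborel (B \<inter> J (p i)))"
  proof (rule sum.cong[OF refl])
    fix i assume i: "i \<in> {..<N}"
    then have pi: "p i < N" using pN by auto
    define t where "t = (real (p i) - real i) / real N"
    have "?V \<inter> J i = (+) t -` (B \<inter> J (p i))"
    proof (intro set_eqI iffI)
      fix x assume x: "x \<in> ?V \<inter> J i"
      then have "cell_perm N p x = t + x" using i by (simp add: J_iff cell_perm_def t_def add.commute)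
      moreover have "t + x \<in> J (p i)"
        using x by (auto simp: J_def t_def add_divide_distrib diff_divide_distrib)
      ultimately show "x \<in> (+) t -` (B \<inter> J (p i))" using x by simp
    next
      fix x assume x: "x \<in> (+) t -` (B \<inter> J (p i))"
      then have "x \<in> J i" by (auto simp: J_def t_def add_divide_distrib diff_divide_distrib)
      then show "x \<in> ?V \<inter> J i" using x i
        by (auto simp: J_iff cell_perm_def t_def add.commute)
    qed
    then have "emeasure lborel (?V \<inter> J i) = emeasure (distr lborel borel ((+) t)) (B \<inter> J (p i))"
      by (subst emeasure_distr) (auto simp: J_def)
    then show "emeasure lborel (?V \<inter> J i) = emeasure lborel (B \<inter> J (p i))"
      by (simp add: lborel_distr_plus)
  qed
  also have "\<dots> = (\<Sum>i<N. emeasure lborel (B \<inter> J i))"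
    by (rule sum.reindex_bij_betw[OF p])
  also have "emeasure lborel (B - {0..<1}) + \<dots> = emeasure lborel B" by (rule decomp[OF B, symmetric])
  finally show "emeasure (distr lborel borel (cell_perm N p)) B = emeasure lborel B" .
qed

lemma cell_perm_mem_iff:
  assumes N: "N \<ge> 1" and p: "p ` {..<N} \<subseteq> {..<N}"
  shows "cell_perm N p x \<in> {0..1} \<longleftrightarrow> x \<in> {0..1}"
proof (cases "0 \<le> x \<and> x < 1")
  case True
  then show ?thesis using cell_perm_step[OF assms, of x] by simp
qed (auto simp: cell_perm_def)

lemma cell_perm_mp_bijection:
  assumes N: "N \<ge> 1" and p: "bij_betw p {..<N} {..<N}"
  shows "cell_perm N p \<in> mp_bijections"
proof -
  let ?psi = "cell_perm N p" and ?q = "inv_into {..<N} p"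
  have pN: "p ` {..<N} \<subseteq> {..<N}" using p by (simp add: bij_betw_def)
  have q: "bij_betw ?q {..<N} {..<N}" using p by (rule bij_betw_inv_into)
  have qN: "?q ` {..<N} \<subseteq> {..<N}" using q by (simp add: bij_betw_def)
  have inv1: "cell_perm N ?q (?psi x) = x" for x
    using p by (intro cell_perm_inverse N pN) (auto simp: bij_betw_inv_into_left)
  have inv2: "?psi (cell_perm N ?q x) = x" for x
    using p by (intro cell_perm_inverse N qN) (auto simp: bij_betw_inv_into_right)
  have bij: "bij_betw ?psi unit_interval unit_interval"
    by (rule bij_betw_byWitness[where f' = "cell_perm N ?q"])
       (use inv1 inv2 cell_perm_mem_iff[OF N pN] cell_perm_mem_iff[OF N qN] in auto)
  have d0: "distr lebesgue lborel ?psi = lborel"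
    using distr_cell_perm[OF assms] by (subst distr_completion) (auto cong: distr_cong)
  have m0: "?psi \<in> lebesgue \<rightarrow>\<^sub>M lborel" by (intro measurable_completion) simp
  \<comment> \<open>Between completed measures, measurability also requires that preimages of null
    sets be null, which \<open>d0\<close> ensures.\<close>
  have m: "?psi \<in> lebesgue \<rightarrow>\<^sub>M lebesgue"
    by (rule completion.measurable_completion2[OF m0]) (simp add: d0)
  have d: "distr lebesgue lebesgue ?psi = lebesgue"
    using completion.completion_distr_eq[OF m0] by (simp add: d0)
  have m': "?psi \<in> lebesgue_on unit_interval \<rightarrow>\<^sub>M lebesgue_on unit_interval"
    using cell_perm_mem_iff[OF N pN] m
    by (intro measurable_restrict_space2 measurable_restrict_space1) (auto simp: space_restrict_space)
  have "distr (lebesgue_on unit_interval) (lebesgue_on unit_interval) ?psi = lebesgue_on unit_interval"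
  proof (rule measure_eqI)
    fix A assume "A \<in> sets (distr (lebesgue_on unit_interval) (lebesgue_on unit_interval) ?psi)"
    then have A: "A \<in> sets (lebesgue_on unit_interval)" by simp
    then have A': "A \<in> sets lebesgue" "A \<subseteq> unit_interval" by (auto simp: sets_restrict_space_iff)
    have "emeasure (distr (lebesgue_on unit_interval) (lebesgue_on unit_interval) ?psi) A
      = emeasure (lebesgue_on unit_interval) (?psi -` A \<inter> unit_interval)"
      using m' A by (simp add: emeasure_distr space_restrict_space)
    also have "?psi -` A \<inter> unit_interval = ?psi -` A" using A'(2) cell_perm_mem_iff[OF N pN] by auto
    also have "emeasure (lebesgue_on unit_interval) (?psi -` A) = emeasure lebesgue (?psi -` A)"
      using A'(2) cell_perm_mem_iff[OF N pN] by (intro emeasure_restrict_space) auto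
    also have "\<dots> = emeasure (distr lebesgue lebesgue ?psi) A"
      using m A' by (simp add: emeasure_distr)
    also have "\<dots> = emeasure (lebesgue_on unit_interval) A"
      unfolding d using A' by (simp add: emeasure_restrict_space)
    finally show "emeasure (distr (lebesgue_on unit_interval) (lebesgue_on unit_interval) ?psi) A
      = emeasure (lebesgue_on unit_interval) A" .
  qed simp
  then show ?thesis using bij m' by (simp add: mp_bijections_def)
qed

text \<open>\<open>lborel\<close> on the plane is a product measure, so invariance passes from the
  factors to the map acting on both coordinates. It is applied to a Borel majorant of the
  approximation error.\<close>

lemma nn_integral_cell_perm:
  fixes f :: "real \<times> real \<Rightarrow> ennreal"
  assumes N: "N \<ge> 1" and p: "bij_betw p {..<N} {..<N}" and f [measurable]: "f \<in> borel_measurable borel"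
  shows "(\<integral>\<^sup>+z. f (cell_perm2 N p z) \<partial>lborel) = (\<integral>\<^sup>+z. f z \<partial>lborel)"
proof -
  let ?psi = "cell_perm N p"
  have m: "?psi \<in> lborel \<rightarrow>\<^sub>M lborel" by simp
  have d: "distr lborel lborel ?psi = lborel"
    using distr_cell_perm[OF assms(1,2)] by (auto cong: distr_cong)
  have "(lborel :: (real \<times> real) measure) = distr lborel lborel ?psi \<Otimes>\<^sub>M distr lborel lborel ?psi"
    by (simp add: d lborel_prod)
  also have "\<dots> = distr (lborel \<Otimes>\<^sub>M lborel) (lborel \<Otimes>\<^sub>M lborel) (\<lambda>(x, y). (?psi x, ?psi y))"
    using m by (intro pair_measure_distr) (simp_all add: d lborel.sigma_finite_measure_axioms)
  finally have eq: "(lborel :: (real \<times> real) measure) = distr lborel lborel (\<lambda>(x, y). (?psi x, ?psi y))"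
    by (simp add: lborel_prod)
  have "(\<lambda>(x, y). (?psi x, ?psi y)) \<in> (lborel \<Otimes>\<^sub>M lborel) \<rightarrow>\<^sub>M (lborel \<Otimes>\<^sub>M lborel)"
    by measurable
  then have "(\<lambda>(x, y). (?psi x, ?psi y)) \<in> (lborel :: (real \<times> real) measure) \<rightarrow>\<^sub>M lborel"
    by (simp add: lborel_prod)
  then show ?thesis
    by (subst (2) eq, subst nn_integral_distr) (auto simp: case_prod_unfold)
qed

section \<open>Comparing a sample with a rearranged step function\<close>

text \<open>A linear function on the cube of weights is largest at a vertex: weight 1 where the
  coefficient is positive, 0 elsewhere.\<close>

lemma weighted_sum_abs_le:
  fixes c s :: "'a \<Rightarrow> real"
  assumes "finite K" and B: "\<And>S. S \<subseteq> K \<Longrightarrow> \<bar>\<Sum>i\<in>S. c i\<bar> \<le> B"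
    and s: "\<And>i. i \<in> K \<Longrightarrow> 0 \<le> s i \<and> s i \<le> 1"
  shows "\<bar>\<Sum>i\<in>K. c i * s i\<bar> \<le> B"
proof -
  have *: "(\<Sum>i\<in>K. d i * s i) \<le> B" if d: "\<And>S. S \<subseteq> K \<Longrightarrow> \<bar>\<Sum>i\<in>S. d i\<bar> \<le> B" for d
  proof -
    have "(\<Sum>i\<in>K. d i * s i) \<le> (\<Sum>i\<in>K. pos_part (d i))"
    proof (rule sum_mono)
      fix i assume "i \<in> K"
      then have "d i * s i \<le> pos_part (d i) * s i" "pos_part (d i) * s i \<le> pos_part (d i)"
        using s by (auto intro!: mult_right_mono mult_left_le)
      then show "d i * s i \<le> pos_part (d i)" by linarith
    qed
    also have "\<dots> = (\<Sum>i\<in>{i\<in>K. d i > 0}. d i)" by (rule sum_pos_part_eq[OF assms(1)])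
    also have "\<dots> \<le> B" using d[of "{i\<in>K. d i > 0}"] by auto
    finally show ?thesis .
  qed
  have "(\<Sum>i\<in>K. c i * s i) \<le> B" "(\<Sum>i\<in>K. - c i * s i) \<le> B"
    using B by (intro *; simp add: sum_negf)+
  then show ?thesis by (simp add: sum_negf)
qed

lemma weighted_cut_le:
  fixes D :: "'a \<Rightarrow> 'b \<Rightarrow> real"
  assumes fin: "finite K" "finite L"
    and B: "\<And>S T. S \<subseteq> K \<Longrightarrow> T \<subseteq> L \<Longrightarrow> \<bar>\<Sum>i\<in>S. \<Sum>j\<in>T. D i j\<bar> \<le> B"
    and s: "\<And>i. i \<in> K \<Longrightarrow> 0 \<le> s i \<and> s i \<le> 1" and t: "\<And>j. j \<in> L \<Longrightarrow> 0 \<le> t j \<and> t j \<le> 1"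
  shows "\<bar>\<Sum>i\<in>K. \<Sum>j\<in>L. D i j * s i * t j\<bar> \<le> B"
proof -
  have "\<bar>\<Sum>j\<in>L. (\<Sum>i\<in>K. D i j * s i) * t j\<bar> \<le> B"
  proof (rule weighted_sum_abs_le[OF fin(2) _ t])
    fix T assume "T \<subseteq> L"
    then have "\<bar>\<Sum>i\<in>K. (\<Sum>j\<in>T. D i j) * s i\<bar> \<le> B"
      by (intro weighted_sum_abs_le[OF fin(1) _ s] B)
    then show "\<bar>\<Sum>j\<in>T. \<Sum>i\<in>K. D i j * s i\<bar> \<le> B"
      by (subst sum.swap) (simp add: sum_distrib_right)
  qed
  then show ?thesis by (subst sum.swap) (simp add: sum_distrib_right)
qed

text \<open>A measurable set meets each step in some part of it. The measures of these parts act as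
  weights, and a bilinear sum is extremal at the weights 0 and \<open>1 / k\<close>, that is, at
  unions of whole steps.\<close>

lemma weighted_dcut_le:
  assumes k: "k \<ge> 1" and s: "\<And>i. i < k \<Longrightarrow> 0 \<le> s i \<and> s i \<le> 1 / real k"
    and t: "\<And>j. j < k \<Longrightarrow> 0 \<le> t j \<and> t j \<le> 1 / real k"
  shows "\<bar>\<Sum>i<k. \<Sum>j<k. D i j * s i * t j\<bar> \<le> dcut k D"
proof -
  have "\<bar>\<Sum>i<k. \<Sum>j<k. D i j * (real k * s i) * (real k * t j)\<bar> \<le> dcut k D * (real k)\<^sup>2"
    using k s t by (intro weighted_cut_le dcut_ge) (auto simp: field_simps)
  also have "(\<Sum>i<k. \<Sum>j<k. D i j * (real k * s i) * (real k * t j))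
      = (real k)\<^sup>2 * (\<Sum>i<k. \<Sum>j<k. D i j * s i * t j)"
    by (simp add: sum_distrib_left power2_eq_square mult_ac)
  finally show ?thesis using k by (simp add: abs_mult mult.commute)
qed

text \<open>Splitting the steps of a matrix into finer cells does not raise its cut norm: the
  weights of the cells over the same \<open>a\<close> add up, and the fibre condition keeps their
  total at most \<open>1 / k\<close>.\<close>

lemma blowup_dcut_le:
  assumes k: "k \<ge> 1" and f: "f ` {..<N} \<subseteq> {..<k}"
    and fib: "\<And>a. a < k \<Longrightarrow> real (card {i\<in>{..<N}. f i = a}) * (1 / real N) \<le> 1 / real k"
    and s: "\<And>i. i < N \<Longrightarrow> 0 \<le> s i \<and> s i \<le> 1 / real N"
    and t: "\<And>j. j < N \<Longrightarrow> 0 \<le> t j \<and> t j \<le> 1 / real N"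
  shows "\<bar>\<Sum>i<N. \<Sum>j<N. D (f i) (f j) * s i * t j\<bar> \<le> dcut k D"
proof -
  define F where "F a = {i\<in>{..<N}. f i = a}" for a
  define w where "w u a = (\<Sum>i\<in>F a. u i)" for u :: "nat \<Rightarrow> real" and a
  have group: "(\<Sum>i<N. g (f i) * u i) = (\<Sum>a<k. g a * w u a)" for g u :: "nat \<Rightarrow> real"
  proof -
    have "(\<Sum>i<N. g (f i) * u i) = (\<Sum>a<k. \<Sum>i\<in>F a. g (f i) * u i)"
      unfolding F_def using f by (intro sum.group[symmetric]) auto
    also have "\<dots> = (\<Sum>a<k. g a * w u a)"
      by (simp add: w_def sum_distrib_left) (auto simp: F_def intro!: sum.cong)
    finally show ?thesis .
  qed
  have w: "0 \<le> w u a \<and> w u a \<le> 1 / real k"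
    if a: "a < k" and u: "\<And>i. i < N \<Longrightarrow> 0 \<le> u i \<and> u i \<le> 1 / real N" for u a
  proof
    show "0 \<le> w u a" unfolding w_def using u by (intro sum_nonneg) (auto simp: F_def)
    have "w u a \<le> (\<Sum>i\<in>F a. 1 / real N)" unfolding w_def using u by (intro sum_mono) (auto simp: F_def)
    also have "\<dots> \<le> 1 / real k" using fib[OF a] by (simp add: F_def)
    finally show "w u a \<le> 1 / real k" .
  qed
  have "(\<Sum>i<N. \<Sum>j<N. D (f i) (f j) * s i * t j) = (\<Sum>i<N. (\<Sum>j<N. D (f i) (f j) * t j) * s i)"
    by (simp add: sum_distrib_left sum_distrib_right mult_ac)
  also have "\<dots> = (\<Sum>i<N. (\<Sum>b<k. D (f i) b * w t b) * s i)"
    by (simp only: group[of "D (f _)"])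
  also have "\<dots> = (\<Sum>a<k. (\<Sum>b<k. D a b * w t b) * w s a)"
    by (rule group[of "\<lambda>a. \<Sum>b<k. D a b * w t b"])
  also have "\<dots> = (\<Sum>a<k. \<Sum>b<k. D a b * w s a * w t b)"
    by (simp add: sum_distrib_left sum_distrib_right mult_ac)
  also have "\<bar>\<dots>\<bar> \<le> dcut k D"
    using w s t by (intro weighted_dcut_le k) blast+
  finally show ?thesis .
qed

lemma card_div_fibres:
  assumes "n \<ge> 1"
  shows "card {i. i < k * n \<and> P (i div n)} = n * card {a. a < k \<and> P a}"
proof -
  let ?A = "{a. a < k \<and> P a}" and ?h = "\<lambda>(a, r). a * n + r"
  have "{i. i < k * n \<and> P (i div n)} = ?h ` (?A \<times> {..<n})"
  proof (intro set_eqI iffI)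
    fix i assume i: "i \<in> {i. i < k * n \<and> P (i div n)}"
    then have "i = ?h (i div n, i mod n)" "(i div n, i mod n) \<in> ?A \<times> {..<n}"
      using assms by (auto simp: less_mult_imp_div_less)
    then show "i \<in> ?h ` (?A \<times> {..<n})" by blast
  next
    fix i assume "i \<in> ?h ` (?A \<times> {..<n})"
    then obtain a r where ar: "a < k" "P a" "r < n" "i = a * n + r" by auto
    have "a * n + r < (a + 1) * n" using ar by simp
    also have "\<dots> \<le> k * n" using ar by (intro mult_le_mono1) simp
    finally show "i \<in> {i. i < k * n \<and> P (i div n)}" using ar by simp
  qed
  moreover have "inj_on ?h (?A \<times> {..<n})"
  proof (rule inj_onI)
    fix u v assume uv: "u \<in> ?A \<times> {..<n}" "v \<in> ?A \<times> {..<n}" and eq: "?h u = ?h v"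
    obtain a r b s where ar: "u = (a, r)" "v = (b, s)" by (cases u, cases v)
    have rs: "r < n" "s < n" using uv ar by auto
    have "(a * n + r) div n = a" "(b * n + s) div n = b" using rs by simp_all
    then show "u = v" using eq by (auto simp: ar)
  qed
  ultimately show ?thesis by (simp add: card_image card_cartesian_product mult.commute)
qed

lemma measurable_grid [measurable]: "grid k D \<in> borel_measurable borel"
proof -
  have "(\<lambda>z. (step_index k (fst z), step_index k (snd z)))
      \<in> borel \<Otimes>\<^sub>M borel \<rightarrow>\<^sub>M count_space UNIV \<Otimes>\<^sub>M count_space UNIV"
    by measurable
  then have "(\<lambda>z. (step_index k (fst z), step_index k (snd z))) \<in> borel \<Otimes>\<^sub>M borel \<rightarrow>\<^sub>M count_space UNIV"
    by (simp add: pair_measure_countable)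
  from measurable_compose[OF this, of "\<lambda>(i, j). D i j" borel]
  have "(\<lambda>z. D (step_index k (fst z)) (step_index k (snd z))) \<in> borel_measurable (borel \<Otimes>\<^sub>M borel)"
    by simp
  then show ?thesis by (simp add: grid_def case_prod_unfold borel_prod)
qed

lemma null_boundary:
  "{1} \<times> UNIV \<union> UNIV \<times> {1} \<in> null_sets (lborel :: (real \<times> real) measure)"
proof -
  have "{1} \<times> UNIV \<union> UNIV \<times> {1} \<in> null_sets (lborel \<Otimes>\<^sub>M lborel :: (real \<times> real) measure)"
    by (intro null_sets.Un lborel.times_in_null_sets1 lborel.times_in_null_sets2) auto
  then show ?thesis by (simp add: lborel_prod)
qed

text \<open>The \<open>k * n\<close> cells refine both partitions: cell \<open>i\<close> lies in
  step \<open>i div n\<close> of the \<open>k\<close> steps and in step \<open>i div k\<close> of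
  the \<open>n\<close> steps. The integrands can differ only where a coordinate equals 1, a point
  that \<open>cell_perm\<close> does not move with its cell; \<open>null_boundary\<close> disposes
  of it.\<close>

lemma sample_perm_integral:
  fixes A D :: "nat \<Rightarrow> nat \<Rightarrow> real"
  assumes k: "k \<ge> 1" and n: "n \<ge> 1" and p: "p ` {..<k * n} \<subseteq> {..<k * n}"
    and S: "S \<in> sets lebesgue" "S \<subseteq> {0..1}" and T: "T \<in> sets lebesgue" "T \<subseteq> {0..1}"
  defines "W \<equiv> \<lambda>z. grid k D z - grid n A (cell_perm2 (k * n) p z)"
  shows "set_integrable lebesgue (S \<times> T) W"
    and "(LINT z:S \<times> T|lebesgue. W z) =
      (\<Sum>i<k * n. \<Sum>j<k * n. (D (i div n) (j div n) - A (p i div k) (p j div k))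
        * measure lebesgue (S \<inter> cell (k * n) i) * measure lebesgue (T \<inter> cell (k * n) j))"
proof -
  let ?N = "k * n"
  define G where "G i j = D (i div n) (j div n) - A (p i div k) (p j div k)" for i j
  have N: "?N \<ge> 1" using k n by simp
  have WG: "W (x, y) = grid ?N G (x, y)" if xy: "0 \<le> x" "x < 1" "0 \<le> y" "y < 1" for x y
  proof -
    have "step_index k x = step_index ?N x div n" "step_index k y = step_index ?N y div n"
      using xy k n by (simp_all add: step_index_div)
    moreover have "step_index n (cell_perm ?N p x) = p (step_index ?N x) div k"
      using cell_perm_step[OF N p, of x] step_index_div[OF n k, of "cell_perm ?N p x"] xy
      by (simp add: mult.commute)
    moreover have "step_index n (cell_perm ?N p y) = p (step_index ?N y) div k"
      using cell_perm_step[OF N p, of y] step_index_div[OF n k, of "cell_perm ?N p y"] xy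
      by (simp add: mult.commute)
    ultimately show ?thesis by (simp add: W_def grid_def G_def)
  qed
  have ae: "AE z in lebesgue. indicator (S \<times> T) z *\<^sub>R W z = indicator (S \<times> T) z *\<^sub>R grid ?N G z"
  proof (rule AE_I'[OF null_sets_completionI[OF null_boundary]], rule subsetI)
    fix z assume z: "z \<in> {z \<in> space lebesgue. indicator (S \<times> T) z *\<^sub>R W z \<noteq> indicator (S \<times> T) z *\<^sub>R grid ?N G z}"
    obtain x y where xy: "z = (x, y)" by (cases z)
    have "x \<in> {0..1}" "y \<in> {0..1}" using z S T by (auto simp: xy indicator_def split: if_splits)
    moreover have "\<not> (0 \<le> x \<and> x < 1 \<and> 0 \<le> y \<and> y < 1)" using z WG by (auto simp: xy)
    ultimately show "z \<in> {1} \<times> UNIV \<union> UNIV \<times> {1}" by (auto simp: xy)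
  qed
  have mp: "cell_perm2 ?N p \<in> borel \<rightarrow>\<^sub>M (borel :: (real \<times> real) measure)"
    unfolding borel_prod[symmetric] by measurable
  have Wm: "W \<in> borel_measurable borel"
    unfolding W_def by (intro borel_measurable_diff measurable_grid measurable_compose[OF mp])
  have ST: "S \<times> T \<in> sets lebesgue" using S T by (intro lebesgue_Times)
  have m1: "(\<lambda>z. indicator (S \<times> T) z *\<^sub>R W z) \<in> borel_measurable lebesgue"
    using ST Wm by (intro borel_measurable_scaleR borel_measurable_indicator measurable_completion) simp_all
  have m2: "(\<lambda>z. indicator (S \<times> T) z *\<^sub>R grid ?N G z) \<in> borel_measurable lebesgue"
    using ST by (intro borel_measurable_scaleR borel_measurable_indicator measurable_completion) simp_all
  show "set_integrable lebesgue (S \<times> T) W"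
    using grid_integral(1)[OF N S T, of G] unfolding set_integrable_def integrable_cong_AE[OF m1 m2 ae] .
  show "(LINT z:S \<times> T|lebesgue. W z) =
      (\<Sum>i<?N. \<Sum>j<?N. (D (i div n) (j div n) - A (p i div k) (p j div k))
        * measure lebesgue (S \<inter> cell ?N i) * measure lebesgue (T \<inter> cell ?N j))"
    using grid_integral(2)[OF N S T, of G]
    unfolding set_lebesgue_integral_def integral_cong_AE[OF m1 m2 ae] by (simp add: G_def)
qed

text \<open>A cut distance bound witnessed by a cell permutation, one \<open>p\<close> serving all
  \<open>S\<close> and \<open>T\<close>. Stated for the single integrals, it involves only step
  functions and no supremum in the reals, and it depends on the sample through the indices
  \<open>x\<close> alone.\<close>

definition cut_close :: "nat \<Rightarrow> nat \<Rightarrow> (nat \<Rightarrow> nat \<Rightarrow> real) \<Rightarrow> (nat \<Rightarrow> nat) \<Rightarrow> real \<Rightarrow> bool"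
  where "cut_close k n A x c \<longleftrightarrow> (\<exists>p. bij_betw p {..<k * n} {..<k * n} \<and>
    (\<forall>S T. S \<in> sets lebesgue \<longrightarrow> S \<subseteq> {0..1} \<longrightarrow> T \<in> sets lebesgue \<longrightarrow> T \<subseteq> {0..1} \<longrightarrow>
      \<bar>LINT z:S \<times> T|lebesgue. grid k (offdiag A x) z
        - grid n A (cell_perm2 (k * n) p z)\<bar> \<le> c))"

lemma cut_close_mono: "cut_close k n A x c \<Longrightarrow> c \<le> c' \<Longrightarrow> cut_close k n A x c'"
  unfolding cut_close_def by (elim ex_forward conj_forward all_forward imp_forward) auto

lemma sample_cut_close:
  fixes A R :: "nat \<Rightarrow> nat \<Rightarrow> real" and Q :: "'t \<Rightarrow> 't \<Rightarrow> real"
  assumes k: "k \<ge> 1" and n: "n \<ge> 1" and x: "\<And>i. i < k \<Longrightarrow> x i < n"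
    and A: "\<And>a b. A a b = R a b + Q (\<tau> a) (\<tau> b)"
    and Q: "\<And>t u. \<bar>Q t u\<bar> \<le> q"
    and Ty: "finite Ty" "\<tau> ` {..<n} \<subseteq> Ty"
  shows "cut_close k n A x (dcut k (offdiag R x) + dcut n R
    + 2 * q * (2 * (\<Sum>t\<in>Ty. \<bar>real (card {i. i < k \<and> \<tau> (x i) = t}) / real k
        - real (card {a\<in>{..<n}. \<tau> a = t}) / real n\<bar>) + 1 / real k))"
proof -
  define N where "N = k * n"
  have N: "N \<ge> 1" using k n by (simp add: N_def)
  have div1: "i div n < k" if "i < N" for i
    using that by (simp add: N_def less_mult_imp_div_less)
  have div2: "i div k < n" if "i < N" for i
    using that by (simp add: N_def less_mult_imp_div_less mult.commute)
  \<comment> \<open>Two colourings of the \<open>k * n\<close> cells: by the type of the sample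
    point of the step that contains the cell, and by the type of the index of \<open>A\<close>
    there.\<close>
  define c1 c2 where "c1 i = \<tau> (x (i div n))" and "c2 i = \<tau> (i div k)" for i
  define mis where "mis = (\<Sum>t\<in>Ty. \<bar>real (card {i. i < k \<and> \<tau> (x i) = t}) / real k
      - real (card {a\<in>{..<n}. \<tau> a = t}) / real n\<bar>)"
  have cc: "c1 ` {..<N} \<subseteq> Ty" "c2 ` {..<N} \<subseteq> Ty"
    using Ty(2) div1 div2 x by (auto simp: c1_def c2_def)
  obtain p where p: "bij_betw p {..<N} {..<N}"
    "real (card {e\<in>{..<N}. c1 e \<noteq> c2 (p e)})
      \<le> (\<Sum>t\<in>Ty. \<bar>real (card {e\<in>{..<N}. c1 e = t}) - real (card {e\<in>{..<N}. c2 e = t})\<bar>)"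
    using colour_matching[OF finite_lessThan Ty(1) cc] by blast
  define M where "M = {e\<in>{..<N}. c1 e \<noteq> c2 (p e)}"
  have pN: "p ` {..<N} \<subseteq> {..<N}" and p_less: "\<And>i. i < N \<Longrightarrow> p i < N"
    using p(1) by (auto simp: bij_betw_def)
  have "real (card M) \<le> real N * mis"
  proof -
    have "card {e\<in>{..<N}. c1 e = t} = n * card {i. i < k \<and> \<tau> (x i) = t}" for t
      using card_div_fibres[OF n, of k "\<lambda>i. \<tau> (x i) = t"] by (simp add: c1_def N_def)
    moreover have "card {e\<in>{..<N}. c2 e = t} = k * card {a\<in>{..<n}. \<tau> a = t}" for t
      using card_div_fibres[OF k, of n "\<lambda>i. \<tau> i = t"] by (simp add: c2_def N_def mult.commute)
    moreover have "\<bar>real (n * a) - real (k * b)\<bar> = real N * \<bar>real a / real k - real b / real n\<bar>" for a b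
    proof -
      have "real (n * a) - real (k * b) = real N * (real a / real k - real b / real n)"
        using k n by (simp add: N_def field_simps)
      then show ?thesis by (simp add: abs_mult)
    qed
    ultimately have "\<bar>real (card {e\<in>{..<N}. c1 e = t}) - real (card {e\<in>{..<N}. c2 e = t})\<bar>
      = real N * \<bar>real (card {i. i < k \<and> \<tau> (x i) = t}) / real k
        - real (card {a\<in>{..<n}. \<tau> a = t}) / real n\<bar>" for t
      by simp
    then show ?thesis using p(2) by (simp add: M_def mis_def sum_distrib_left)
  qed
  have q0: "q \<ge> 0" using Q[of undefined undefined] by linarith
  define Rx where "Rx i j = (if i = j then 0 else R (x i) (x j))" for i j
  define F where "F i j = (if i div n = j div n then 0 else Q (c1 i) (c1 j)) - Q (c2 (p i)) (c2 (p j))" for i j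
  define ob where "ob b = (of_bool b :: real)" for b
  have F: "\<bar>F i j\<bar> \<le> 2 * q * (ob (i \<in> M) + ob (j \<in> M) + ob (i div n = j div n))" if "i < N" "j < N" for i j
  proof (cases "i \<in> M \<or> j \<in> M \<or> i div n = j div n")
    case True
    have "\<bar>F i j\<bar> \<le> 2 * q * 1"
      using Q[of "c1 i" "c1 j"] Q[of "c2 (p i)" "c2 (p j)"] q0 unfolding F_def by (auto split: if_splits)
    also have "\<dots> \<le> 2 * q * (ob (i \<in> M) + ob (j \<in> M) + ob (i div n = j div n))"
      using True q0 by (intro mult_left_mono) (auto simp: ob_def of_bool_def)
    finally show ?thesis .
  next
    case False
    then show ?thesis using that q0 by (simp add: F_def M_def ob_def)
  qed
  have cM: "(\<Sum>i<N. ob (i \<in> M)) = real (card M)"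
    by (auto simp: ob_def M_def sum_of_bool_eq intro!: arg_cong[of _ _ card])
  \<comment> \<open>The diagonal blocks of the sample are \<open>k\<close> squares of side
    \<open>n\<close>, a share \<open>1 / k\<close> of all pairs of cells.\<close>
  have blk: "(\<Sum>i<N. \<Sum>j<N. ob (i div n = j div n)) = real N * real n"
  proof -
    have "(\<Sum>j<N. ob (i div n = j div n)) = real n" if "i < N" for i
    proof -
      have "{..<N} \<inter> {j. i div n = j div n} = {j. j < k * n \<and> j div n = i div n}" by (auto simp: N_def)
      then have "card ({..<N} \<inter> {j. i div n = j div n}) = n * card {a. a < k \<and> a = i div n}"
        using card_div_fibres[OF n, of k "\<lambda>a. a = i div n"] by simp
      moreover have "{a. a < k \<and> a = i div n} = {i div n}" using div1[OF that] by auto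
      ultimately show ?thesis by (simp add: ob_def sum_of_bool_eq)
    qed
    then show ?thesis by simp
  qed
  have sumF: "(\<Sum>i<N. \<Sum>j<N. \<bar>F i j\<bar>) \<le> 2 * q * (2 * mis + 1 / real k) * (real N)\<^sup>2"
  proof -
    have "(\<Sum>i<N. \<Sum>j<N. \<bar>F i j\<bar>) \<le> (\<Sum>i<N. \<Sum>j<N. 2 * q * (ob (i \<in> M) + ob (j \<in> M) + ob (i div n = j div n)))"
      using F by (intro sum_mono) auto
    also have "\<dots> = 2 * q * (real N * real (card M) + real N * real (card M) + real N * real n)"
      by (simp only: sum_distrib_left[symmetric] sum.distrib cM blk)
         (simp add: sum_distrib_left[symmetric] cM)
    also have "\<dots> \<le> 2 * q * (real N * (real N * mis) + real N * (real N * mis) + real N * real n)"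
      using \<open>real (card M) \<le> real N * mis\<close> q0 by (intro mult_left_mono add_mono) auto
    also have "\<dots> = 2 * q * (2 * mis + 1 / real k) * (real N)\<^sup>2"
      using k by (simp add: N_def field_simps power2_eq_square)
    finally show ?thesis .
  qed
  show ?thesis
    unfolding cut_close_def mis_def[symmetric]
  proof (intro exI[of _ p] conjI allI impI)
    show "bij_betw p {..<k * n} {..<k * n}" using p(1) by (simp add: N_def)
    fix S T :: "real set"
    assume S: "S \<in> sets lebesgue" "S \<subseteq> {0..1}" and T: "T \<in> sets lebesgue" "T \<subseteq> {0..1}"
    define s t where "s i = measure lebesgue (S \<inter> cell N i)" and "t j = measure lebesgue (T \<inter> cell N j)" for i j
    have s: "0 \<le> s i \<and> s i \<le> 1 / real N" if "i < N" for i
      using measure_Int_cell_le[OF N that S(1)] by (simp add: s_def)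
    have t: "0 \<le> t i \<and> t i \<le> 1 / real N" if "i < N" for i
      using measure_Int_cell_le[OF N that T(1)] by (simp add: t_def)
    have "(LINT z:S \<times> T|lebesgue. grid k (offdiag A x) z
          - grid n A (cell_perm2 (k * n) p z))
      = (\<Sum>i<N. \<Sum>j<N. ((if i div n = j div n then 0 else A (x (i div n)) (x (j div n)))
          - A (p i div k) (p j div k)) * s i * t j)"
      using sample_perm_integral(2)[OF k n pN[unfolded N_def] S T]
      unfolding s_def t_def N_def .
    also have "\<dots> = (\<Sum>i<N. \<Sum>j<N. Rx (i div n) (j div n) * s i * t j)
        - (\<Sum>i<N. \<Sum>j<N. R (p i div k) (p j div k) * s i * t j) + (\<Sum>i<N. \<Sum>j<N. F i j * s i * t j)"
      unfolding sum_subtractf[symmetric] sum.distrib[symmetric]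
      by (intro sum.cong refl) (simp add: Rx_def F_def A c1_def c2_def algebra_simps)
    finally have eq: "(LINT z:S \<times> T|lebesgue. grid k (offdiag A x) z
          - grid n A (cell_perm2 (k * n) p z)) = \<dots>" .
    have 1: "\<bar>\<Sum>i<N. \<Sum>j<N. Rx (i div n) (j div n) * s i * t j\<bar> \<le> dcut k Rx"
    proof (rule blowup_dcut_le[where f = "\<lambda>i. i div n" and D = Rx, OF k _ _ s t])
      show "(\<lambda>i. i div n) ` {..<N} \<subseteq> {..<k}" using div1 by auto
      fix a assume a: "a < k"
      have "{i\<in>{..<N}. i div n = a} = {i. i < k * n \<and> i div n = a}" by (auto simp: N_def)
      moreover have "{b. b < k \<and> b = a} = {a}" using a by auto
      ultimately have "card {i\<in>{..<N}. i div n = a} = n"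
        using card_div_fibres[OF n, of k "\<lambda>b. b = a"] by simp
      then show "real (card {i\<in>{..<N}. i div n = a}) * (1 / real N) \<le> 1 / real k"
        using n by (simp add: N_def)
    qed
    have 2: "\<bar>\<Sum>i<N. \<Sum>j<N. R (p i div k) (p j div k) * s i * t j\<bar> \<le> dcut n R"
    proof (rule blowup_dcut_le[where f = "\<lambda>i. p i div k" and D = R, OF n _ _ s t])
      show "(\<lambda>i. p i div k) ` {..<N} \<subseteq> {..<n}" using div2 p_less by auto
      fix a assume a: "a < n"
      have "p ` {i\<in>{..<N}. p i div k = a} = {j\<in>p ` {..<N}. j div k = a}" by auto
      also have "p ` {..<N} = {..<N}" using p(1) by (simp add: bij_betw_def)
      finally have "card {j\<in>{..<N}. j div k = a} = card (p ` {i\<in>{..<N}. p i div k = a})" by simp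
      also have "\<dots> = card {i\<in>{..<N}. p i div k = a}"
        by (intro card_image inj_on_subset[OF bij_betw_imp_inj_on[OF p(1)]]) blast
      finally have "card {i\<in>{..<N}. p i div k = a} = card {j\<in>{..<N}. j div k = a}" by simp
      moreover have "{i\<in>{..<N}. i div k = a} = {i. i < n * k \<and> i div k = a}" by (auto simp: N_def mult.commute)
      moreover have "{b. b < n \<and> b = a} = {a}" using a by auto
      ultimately have "card {i\<in>{..<N}. p i div k = a} = k"
        using card_div_fibres[OF k, of n "\<lambda>b. b = a"] by simp
      then show "real (card {i\<in>{..<N}. p i div k = a}) * (1 / real N) \<le> 1 / real n"
        using k by (simp add: N_def)
    qed
    have "\<bar>\<Sum>i<N. \<Sum>j<N. F i j * s i * t j\<bar> \<le> (\<Sum>i<N. \<Sum>j<N. \<bar>F i j\<bar> * (1 / real N) * (1 / real N))"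
    proof (intro order_trans[OF sum_abs] sum_mono)
      fix i j assume ij: "i \<in> {..<N}" "j \<in> {..<N}"
      show "\<bar>F i j * s i * t j\<bar> \<le> \<bar>F i j\<bar> * (1 / real N) * (1 / real N)"
        unfolding abs_mult using s[of i] t[of j] ij by (intro mult_mono) auto
    qed
    also have "\<dots> = (\<Sum>i<N. \<Sum>j<N. \<bar>F i j\<bar>) / (real N)\<^sup>2"
      by (simp add: sum_divide_distrib power2_eq_square)
    also have "\<dots> \<le> 2 * q * (2 * mis + 1 / real k)"
      using sumF N by (simp add: divide_le_eq)
    finally have 3: "\<bar>\<Sum>i<N. \<Sum>j<N. F i j * s i * t j\<bar> \<le> 2 * q * (2 * mis + 1 / real k)" .
    have "\<bar>u - v + w\<bar> \<le> a + b + c" if "\<bar>u\<bar> \<le> a" "\<bar>v\<bar> \<le> b" "\<bar>w\<bar> \<le> c" for u v w a b c :: real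
      using that by linarith
    from this[OF 1 2 3, folded eq]
    show "\<bar>LINT z:S \<times> T|lebesgue. grid k (offdiag A x) z - grid n A (cell_perm2 (k * n) p z)\<bar>
      \<le> dcut k (offdiag R x) + dcut n R + 2 * q * (2 * mis + 1 / real k)"
      by (simp add: Rx_def[abs_def])
  qed
qed

section \<open>Approximation by step functions\<close>

lemma step_index_close:
  assumes n: "n \<ge> 1" and x: "x \<in> {0..1}"
  shows "\<bar>x - real (step_index n x) / real n\<bar> \<le> 1 / real n"
    and "real (step_index n x) / real n \<in> {0..1}"
proof -
  show "real (step_index n x) / real n \<in> {0..1}"
    using step_index_less[OF n, of x] n by simp
  show "\<bar>x - real (step_index n x) / real n\<bar> \<le> 1 / real n"
  proof (cases "x = 1")
    case True
    have "step_index n x = n - 1" unfolding True using n by (simp add: step_index_def)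
    then show ?thesis using True n by (simp add: of_nat_diff field_simps)
  next
    case False
    then have "real (step_index n x) / real n \<le> x \<and> x < (real (step_index n x) + 1) / real n"
      using step_index_eq_iff[OF n, of x "step_index n x"] x by simp
    then show ?thesis by (simp add: add_divide_distrib abs_le_iff)
  qed
qed

lemma emeasure_unit_square: "emeasure lebesgue unit_square = 1"
  using lebesgue_Times(2)[of "{0..1}" "{0..1}"] by simp

lemma unit_square_sets [simp]: "unit_square \<in> sets lebesgue"
  by (intro lebesgue_Times) auto

abbreviation L1_dist :: "(real \<times> real \<Rightarrow> real) \<Rightarrow> (real \<times> real \<Rightarrow> real) \<Rightarrow> ennreal"
  where "L1_dist f g \<equiv> \<integral>\<^sup>+z\<in>unit_square. ennreal \<bar>f z - g z\<bar> \<partial>lebesgue"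

text \<open>Lebesgue measurable functions are limits almost everywhere of continuous ones; clipped
  at \<open>M\<close>, these converge in the mean by dominated convergence. A continuous function on
  the compact square is uniformly close to a step function.\<close>

lemma grid_approximation:
  fixes f :: "real \<times> real \<Rightarrow> real"
  assumes f: "f \<in> borel_measurable lebesgue" and M: "\<And>z. \<bar>f z\<bar> \<le> M" and e: "e > 0"
  obtains n A where "n \<ge> 1" "\<And>a b. \<bar>A a b\<bar> \<le> M"
    "L1_dist f (grid n A) \<le> ennreal e"
proof -
  have M0: "M \<ge> 0" using M[of undefined] by linarith
  have "f measurable_on UNIV" using f by (intro lebesgue_measurable_imp_measurable_on) auto
  then obtain N g where N: "negligible N" and g: "\<And>m. continuous_on UNIV (g m)"
    and lim: "\<And>z. z \<notin> N \<Longrightarrow> (\<lambda>m. g m z) \<longlonglongrightarrow> f z"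
    unfolding measurable_on_def by auto
  define h where "h m z = max (- M) (min M (g m z))" for m :: nat and z
  have hc: "continuous_on UNIV (h m)" for m unfolding h_def by (intro continuous_intros g)
  have hM: "\<bar>h m z\<bar> \<le> M" for m z using M0 by (auto simp: h_def)
  have hlim: "(\<lambda>m. h m z) \<longlonglongrightarrow> f z" if "z \<notin> N" for z
  proof -
    have "(\<lambda>m. h m z) \<longlonglongrightarrow> max (- M) (min M (f z))"
      unfolding h_def by (intro tendsto_intros lim that)
    also have "max (- M) (min M (f z)) = f z" using M[of z] by auto
    finally show ?thesis .
  qed
  have hm: "h m \<in> borel_measurable lebesgue" for m
    using borel_measurable_continuous_onI[OF hc] by (intro measurable_completion) simp
  have conv: "(\<lambda>m. L1_dist f (h m))
      \<longlonglongrightarrow> (\<integral>\<^sup>+z. 0 \<partial>(lebesgue :: (real \<times> real) measure))"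
  proof (rule nn_integral_dominated_convergence[where w = "\<lambda>z. ennreal (2 * M) * indicator unit_square z"])
    show "(\<lambda>z. ennreal \<bar>f z - h m z\<bar> * indicator unit_square z) \<in> borel_measurable lebesgue" for m
      using f hm by (intro borel_measurable_times_ennreal borel_measurable_indicator measurable_compose[OF _ measurable_ennreal]) auto
    show "AE z in lebesgue. ennreal \<bar>f z - h m z\<bar> * indicator unit_square z \<le> ennreal (2 * M) * indicator unit_square z" for m
    proof (intro AE_I2 mult_right_mono ennreal_leI)
      fix z show "\<bar>f z - h m z\<bar> \<le> 2 * M" using M[of z] hM[of m z] by linarith
    qed simp
    show "(\<integral>\<^sup>+z. ennreal (2 * M) * indicator unit_square z \<partial>lebesgue) < \<infinity>"
      by (simp add: nn_integral_cmult_indicator emeasure_unit_square)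
    show "AE z in lebesgue. (\<lambda>m. ennreal \<bar>f z - h m z\<bar> * indicator unit_square z) \<longlonglongrightarrow> 0"
    proof (rule AE_I'[of N])
      show "N \<in> null_sets lebesgue" using N by (simp add: negligible_iff_null_sets)
      show "{z \<in> space lebesgue. \<not> (\<lambda>m. ennreal \<bar>f z - h m z\<bar> * indicator unit_square z) \<longlonglongrightarrow> 0} \<subseteq> N"
      proof (rule subsetI, rule ccontr)
        fix z assume z: "z \<in> {z \<in> space lebesgue. \<not> (\<lambda>m. ennreal \<bar>f z - h m z\<bar> * indicator unit_square z) \<longlonglongrightarrow> 0}"
          and "z \<notin> N"
        have "(\<lambda>m. \<bar>f z - h m z\<bar>) \<longlonglongrightarrow> \<bar>f z - f z\<bar>"
          by (intro tendsto_intros hlim \<open>z \<notin> N\<close>)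
        then have "(\<lambda>m. ennreal (\<bar>f z - h m z\<bar> * indicator unit_square z)) \<longlonglongrightarrow> ennreal (\<bar>f z - f z\<bar> * indicator unit_square z)"
          by (intro tendsto_ennrealI tendsto_mult) auto
        then show False using z by (simp add: ennreal_mult' ennreal_indicator)
      qed
    qed
    show "(\<lambda>z. ennreal (2 * M) * indicator unit_square z) \<in> borel_measurable lebesgue"
      by (intro borel_measurable_times_ennreal borel_measurable_indicator) auto
  qed auto
  then have "(\<lambda>m. L1_dist f (h m)) \<longlonglongrightarrow> 0" by simp
  moreover have "ennreal (e / 2) > 0" using e by simp
  ultimately have "eventually (\<lambda>m. L1_dist f (h m) < ennreal (e / 2)) sequentially"
    by (intro order_tendstoD(2)) auto
  then obtain m where m: "L1_dist f (h m) < ennreal (e / 2)"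
    by (auto simp: eventually_sequentially)
  have "uniformly_continuous_on unit_square (h m)"
    by (intro compact_uniformly_continuous compact_Times continuous_on_subset[OF hc]) auto
  then obtain d where d: "d > 0" "\<And>z w. z \<in> unit_square \<Longrightarrow> w \<in> unit_square \<Longrightarrow> dist w z < d \<Longrightarrow> dist (h m w) (h m z) < e / 2"
    unfolding uniformly_continuous_on_def using e by (metis half_gt_zero)
  obtain n0 where n0: "real n0 > 2 / d" using reals_Archimedean2 by blast
  define n where "n = Suc n0"
  have n: "n \<ge> 1" "2 / real n < d"
  proof -
    have "2 / d < real n" using n0 by (simp add: n_def)
    then show "2 / real n < d" using d(1) by (simp add: n_def field_simps)
  qed (simp add: n_def)
  define A where "A a b = h m (real a / real n, real b / real n)" for a b
  have close: "\<bar>h m z - grid n A z\<bar> \<le> e / 2" if z: "z \<in> unit_square" for z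
  proof -
    obtain x y where xy: "z = (x, y)" "x \<in> {0..1}" "y \<in> {0..1}" using z by auto
    define x' y' where "x' = real (step_index n x) / real n" and "y' = real (step_index n y) / real n"
    have "dist z (x', y') \<le> \<bar>x - x'\<bar> + \<bar>y - y'\<bar>"
      unfolding xy dist_Pair_Pair dist_real_def by (rule order_trans[OF sqrt_sum_squares_le_sum_abs]) simp
    also have "\<dots> \<le> 1 / real n + 1 / real n"
      unfolding x'_def y'_def using n(1) xy by (intro add_mono step_index_close(1))
    also have "\<dots> < d" using n(2) by simp
    finally have "dist (h m z) (h m (x', y')) < e / 2"
      using xy n(1) step_index_close(2)[OF n(1)] by (intro d(2) z) (simp_all add: x'_def y'_def del: divide_le_eq_1)
    then show ?thesis by (simp add: xy grid_def A_def x'_def y'_def dist_real_def)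
  qed
  have "L1_dist f (grid n A)
    \<le> (\<integral>\<^sup>+z. ennreal \<bar>f z - h m z\<bar> * indicator unit_square z + ennreal (e / 2) * indicator unit_square z \<partial>lebesgue)"
  proof (rule nn_integral_mono)
    fix z :: "real \<times> real"
    have "ennreal \<bar>f z - grid n A z\<bar> \<le> ennreal \<bar>f z - h m z\<bar> + ennreal (e / 2)" if "z \<in> unit_square"
    proof -
      have "\<bar>f z - grid n A z\<bar> \<le> \<bar>f z - h m z\<bar> + e / 2" using close[OF that] by linarith
      then show ?thesis using e by (simp add: ennreal_plus[symmetric] ennreal_leI del: ennreal_plus)
    qed
    then show "ennreal \<bar>f z - grid n A z\<bar> * indicator unit_square z
      \<le> ennreal \<bar>f z - h m z\<bar> * indicator unit_square z + ennreal (e / 2) * indicator unit_square z"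
      by (simp add: indicator_def)
  qed
  also have "\<dots> = L1_dist f (h m) + ennreal (e / 2)"
  proof (subst nn_integral_add)
    show "(\<lambda>z. ennreal \<bar>f z - h m z\<bar> * indicator unit_square z) \<in> borel_measurable lebesgue"
      using f hm by (intro borel_measurable_times_ennreal borel_measurable_indicator measurable_compose[OF _ measurable_ennreal]) auto
    show "(\<lambda>z. ennreal (e / 2) * indicator unit_square z) \<in> borel_measurable lebesgue"
      by (intro borel_measurable_times_ennreal borel_measurable_indicator) auto
  qed (simp add: nn_integral_cmult_indicator emeasure_unit_square)
  also have "\<dots> \<le> ennreal (e / 2) + ennreal (e / 2)" using m by (intro add_right_mono) simp
  also have "\<dots> = ennreal e" using e by (subst ennreal_plus[symmetric]) auto
  finally have le: "L1_dist f (grid n A) \<le> ennreal e" .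
  have "\<bar>A a b\<bar> \<le> M" for a b by (simp add: A_def hM)
  from that[OF n(1) this le] show ?thesis .
qed

lemma nn_integral_grid:
  assumes n: "n \<ge> 1" and D: "\<And>i j. D i j \<ge> 0"
  shows "(\<integral>\<^sup>+z\<in>unit_square. ennreal (grid n D z) \<partial>lebesgue) =
    ennreal (avg {..<n} (\<lambda>a. avg {..<n} (D a)))"
proof -
  have "(\<integral>\<^sup>+z\<in>unit_square. ennreal (grid n D z) \<partial>lebesgue)
    = (\<integral>\<^sup>+z. ennreal (indicator unit_square z *\<^sub>R grid n D z) \<partial>lebesgue)"
    by (intro nn_integral_cong) (auto simp: indicator_def)
  also have "\<dots> = ennreal (LINT z:unit_square|lebesgue. grid n D z)"
    unfolding set_lebesgue_integral_def
    using grid_integral(1)[OF n, of unit_interval unit_interval D] D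
    by (intro nn_integral_eq_integral) (auto simp: set_integrable_def grid_def indicator_def)
  also have "(LINT z:unit_square|lebesgue. grid n D z) = (\<Sum>i<n. \<Sum>j<n. D i j * (1 / real n) * (1 / real n))"
  proof -
    have "measure lebesgue (unit_interval \<inter> cell n i) = 1 / real n" if "i < n" for i
    proof -
      have "unit_interval \<inter> cell n i = cell n i" by (auto simp: cell_def)
      then show ?thesis using emeasure_cell[OF n that] by (simp add: measure_def)
    qed
    then show ?thesis by (subst grid_integral(2)[OF n]) auto
  qed
  also have "\<dots> = avg {..<n} (\<lambda>a. avg {..<n} (D a))"
    by (simp add: avg_def sum_divide_distrib)
  finally show ?thesis .
qed

section \<open>Truncation of kernels in L^p\<close>

lemma Lp_sym_measurable:
  assumes "U \<in> Lp_sym p"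
  shows "(\<lambda>z. indicator unit_square z * U z) \<in> borel_measurable lebesgue"
  using assms by (simp add: Lp_sym_def set_borel_measurable_def)

lemma Lp_sym_powr_measurable:
  assumes "U \<in> Lp_sym p"
  shows "(\<lambda>z. ennreal (\<bar>U z\<bar> powr p) * indicator unit_square z) \<in> borel_measurable lebesgue"
proof -
  have "(\<lambda>z. ennreal (indicator unit_square z *\<^sub>R \<bar>U z\<bar> powr p)) \<in> borel_measurable lebesgue"
    using assms by (intro measurable_compose[OF _ measurable_ennreal] borel_measurable_integrable)
      (simp add: Lp_sym_def set_integrable_def)
  also have "(\<lambda>z. ennreal (indicator unit_square z *\<^sub>R \<bar>U z\<bar> powr p))
      = (\<lambda>z. ennreal (\<bar>U z\<bar> powr p) * indicator unit_square z)"
    by (auto simp: indicator_def)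
  finally show ?thesis .
qed

lemma Lp_norm_powr:
  assumes U: "U \<in> Lp_sym p" and p: "p > 0"
  shows "(\<integral>\<^sup>+z\<in>unit_square. ennreal (\<bar>U z\<bar> powr p) \<partial>lebesgue) = ennreal (Lp_norm p U powr p)"
proof -
  let ?J = "LINT z:unit_square|lebesgue. \<bar>U z\<bar> powr p"
  have int: "integrable lebesgue (\<lambda>z. indicator unit_square z *\<^sub>R \<bar>U z\<bar> powr p)"
    using U by (simp add: Lp_sym_def set_integrable_def)
  have J: "?J \<ge> 0" unfolding set_lebesgue_integral_def by (intro integral_nonneg_AE) auto
  have "(\<integral>\<^sup>+z\<in>unit_square. ennreal (\<bar>U z\<bar> powr p) \<partial>lebesgue)
    = (\<integral>\<^sup>+z. ennreal (indicator unit_square z *\<^sub>R \<bar>U z\<bar> powr p) \<partial>lebesgue)"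
    by (intro nn_integral_cong) (auto simp: indicator_def)
  also have "\<dots> = ennreal ?J" unfolding set_lebesgue_integral_def
    by (intro nn_integral_eq_integral int) auto
  also have "?J = Lp_norm p U powr p" using J p by (simp add: Lp_norm_def powr_powr)
  finally show ?thesis .
qed

lemma powr_tail_bound:
  fixes u M p :: real
  assumes "M > 0" "p \<ge> 1" "\<bar>u\<bar> > M"
  shows "\<bar>u\<bar> \<le> M powr (1 - p) * \<bar>u\<bar> powr p"
proof -
  have "\<bar>u\<bar> powr (1 - p) \<le> M powr (1 - p)" using assms by (intro powr_mono2') auto
  then have "\<bar>u\<bar> powr (1 - p) * \<bar>u\<bar> powr p \<le> M powr (1 - p) * \<bar>u\<bar> powr p"
    by (intro mult_right_mono) auto
  moreover have "\<bar>u\<bar> powr (1 - p) * \<bar>u\<bar> powr p = \<bar>u\<bar>"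
    using assms by (simp add: powr_add[symmetric])
  ultimately show ?thesis by simp
qed

text \<open>The truncation error sits where \<open>|U|\<close> exceeds \<open>M\<close>, and there
  \<open>|U|\<close> is at most \<open>M powr (1 - p) * |U| powr p\<close>. The mean square of
  \<open>A\<close> is compared with that of the truncation of \<open>U\<close>, hence with the mean
  of \<open>1 + |U| powr p\<close>, so its bound is free of \<open>M\<close>.\<close>

lemma Lp_grid_approximation:
  assumes U: "U \<in> Lp_sym p" and p: "p > 2" and M: "M > 0"
  defines "J \<equiv> Lp_norm p U powr p"
  obtains n A where "n \<ge> 1" "\<And>a b. \<bar>A a b\<bar> \<le> M"
    "L1_dist U (grid n A) \<le> ennreal ((J + 1) * M powr (1 - p))"
    "avg {..<n} (\<lambda>a. avg {..<n} (\<lambda>b. (A a b)\<^sup>2)) \<le> J + 2"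
proof -
  let ?L = "lebesgue :: (real \<times> real) measure"
  let ?q = "indicator unit_square :: real \<times> real \<Rightarrow> ennreal"
  define f where "f z = max (- M) (min M (indicator unit_square z * U z))" for z
  have fm: "f \<in> borel_measurable ?L"
    unfolding f_def using Lp_sym_measurable[OF U] by (intro borel_measurable_max borel_measurable_min) auto
  have fM: "\<bar>f z\<bar> \<le> M" for z using M by (auto simp: f_def)
  \<comment> \<open>The first entry adds at most \<open>M powr (1 - p)\<close> to the L1 error,
    turning \<open>J\<close> into \<open>J + 1\<close>. The second compensates the factor
    \<open>2 * M\<close> in the comparison of squares, so that the mean square grows by at most
    1.\<close>
  define e where "e = min (M powr (1 - p)) (1 / (2 * M))"
  have e: "e > 0" "e \<le> M powr (1 - p)" "2 * M * e \<le> 1"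
    using M by (auto simp: e_def min_def field_simps)
  obtain n A where nA: "n \<ge> 1" "\<And>a b. \<bar>A a b\<bar> \<le> M"
    "L1_dist f (grid n A) \<le> ennreal e"
    using grid_approximation[OF fm fM e(1)] by blast
  have J0: "J \<ge> 0" by (simp add: J_def)
  have gm: "grid n A \<in> borel_measurable ?L" by (intro measurable_completion) simp
  have dm: "(\<lambda>z. ennreal \<bar>f z - grid n A z\<bar> * ?q z) \<in> borel_measurable ?L"
    using fm gm by (intro borel_measurable_times_ennreal borel_measurable_indicator measurable_compose[OF _ measurable_ennreal]) auto
  note pm = Lp_sym_powr_measurable[OF U]
  have 1: "L1_dist U (grid n A) \<le> ennreal ((J + 1) * M powr (1 - p))"
  proof -
    have "L1_dist U (grid n A)
      \<le> (\<integral>\<^sup>+z. ennreal (M powr (1 - p)) * (ennreal (\<bar>U z\<bar> powr p) * ?q z) + ennreal \<bar>f z - grid n A z\<bar> * ?q z \<partial>?L)"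
    proof (rule nn_integral_mono)
      fix z :: "real \<times> real"
      have "\<bar>U z - f z\<bar> \<le> M powr (1 - p) * \<bar>U z\<bar> powr p" if z: "z \<in> unit_square"
      proof (cases "\<bar>U z\<bar> \<le> M")
        case False
        then have "\<bar>U z - f z\<bar> \<le> \<bar>U z\<bar>" using z M by (auto simp: f_def)
        also have "\<dots> \<le> M powr (1 - p) * \<bar>U z\<bar> powr p" using False M p by (intro powr_tail_bound) auto
        finally show ?thesis .
      qed (use z in \<open>auto simp: f_def\<close>)
      then have "\<bar>U z - grid n A z\<bar> \<le> M powr (1 - p) * \<bar>U z\<bar> powr p + \<bar>f z - grid n A z\<bar>"
        if z: "z \<in> unit_square" using z by fastforce
      then have "ennreal \<bar>U z - grid n A z\<bar> \<le> ennreal (M powr (1 - p) * \<bar>U z\<bar> powr p + \<bar>f z - grid n A z\<bar>)"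
        if z: "z \<in> unit_square" using z by (intro ennreal_leI)
      then show "ennreal \<bar>U z - grid n A z\<bar> * ?q z
        \<le> ennreal (M powr (1 - p)) * (ennreal (\<bar>U z\<bar> powr p) * ?q z) + ennreal \<bar>f z - grid n A z\<bar> * ?q z"
        by (auto simp: indicator_def ennreal_plus ennreal_mult)
    qed
    also have "\<dots> = ennreal (M powr (1 - p)) * ennreal J + L1_dist f (grid n A)"
      using dm pm Lp_norm_powr[OF U] p by (simp add: nn_integral_add nn_integral_cmult J_def)
    also have "\<dots> \<le> ennreal (M powr (1 - p)) * ennreal J + ennreal (M powr (1 - p))"
      using nA(3) e(2) by (intro add_left_mono) (meson ennreal_leI order_trans)
    also have "\<dots> = ennreal ((J + 1) * M powr (1 - p))"
      using J0 by (simp add: ennreal_mult[symmetric] ennreal_plus[symmetric] algebra_simps del: ennreal_plus)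
    finally show ?thesis .
  qed
  have "(\<integral>\<^sup>+z\<in>unit_square. ennreal (grid n (\<lambda>a b. (A a b)\<^sup>2) z) \<partial>?L)
    \<le> (\<integral>\<^sup>+z. ?q z + ennreal (\<bar>U z\<bar> powr p) * ?q z + ennreal (2 * M) * (ennreal \<bar>f z - grid n A z\<bar> * ?q z) \<partial>?L)"
  proof (rule nn_integral_mono)
    fix z :: "real \<times> real"
    have "grid n (\<lambda>a b. (A a b)\<^sup>2) z \<le> 1 + \<bar>U z\<bar> powr p + 2 * M * \<bar>f z - grid n A z\<bar>" if z: "z \<in> unit_square"
    proof -
      let ?g = "grid n A z"
      have gM: "\<bar>?g\<bar> \<le> M" using nA(2) by (simp add: grid_def case_prod_unfold)
      have "grid n (\<lambda>a b. (A a b)\<^sup>2) z = ?g\<^sup>2" by (simp add: grid_def case_prod_unfold)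
      also have "\<dots> = (f z)\<^sup>2 + (?g + f z) * (?g - f z)" by (simp add: power2_eq_square algebra_simps)
      also have "(?g + f z) * (?g - f z) \<le> \<bar>?g + f z\<bar> * \<bar>?g - f z\<bar>"
        by (metis abs_ge_self abs_mult)
      also have "\<dots> \<le> 2 * M * \<bar>f z - ?g\<bar>"
        using gM fM[of z] by (subst abs_minus_commute) (intro mult_right_mono; linarith)
      also have "(f z)\<^sup>2 \<le> \<bar>U z\<bar>\<^sup>2"
      proof -
        have "\<bar>f z\<bar> \<le> \<bar>U z\<bar>" using z M by (auto simp: f_def)
        then show ?thesis by (simp add: abs_le_square_iff)
      qed
      also have "\<bar>U z\<bar>\<^sup>2 \<le> 1 + \<bar>U z\<bar> powr p"
      proof (cases "\<bar>U z\<bar> \<le> 1")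
        case True
        then have "\<bar>U z\<bar>\<^sup>2 \<le> 1" by (simp add: abs_square_le_1)
        then show ?thesis using powr_ge_zero[of "\<bar>U z\<bar>" p] by linarith
      next
        case False
        then have "\<bar>U z\<bar>\<^sup>2 = \<bar>U z\<bar> powr 2" by simp
        also have "\<dots> \<le> \<bar>U z\<bar> powr p" using False p by (intro powr_mono) auto
        finally show ?thesis by simp
      qed
      finally show ?thesis by simp
    qed
    then have "ennreal (grid n (\<lambda>a b. (A a b)\<^sup>2) z) \<le> ennreal (1 + \<bar>U z\<bar> powr p + 2 * M * \<bar>f z - grid n A z\<bar>)"
      if "z \<in> unit_square" using that by (intro ennreal_leI)
    then show "ennreal (grid n (\<lambda>a b. (A a b)\<^sup>2) z) * ?q z
      \<le> ?q z + ennreal (\<bar>U z\<bar> powr p) * ?q z + ennreal (2 * M) * (ennreal \<bar>f z - grid n A z\<bar> * ?q z)"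
      using M by (auto simp: indicator_def ennreal_plus ennreal_mult)
  qed
  also have "\<dots> = 1 + ennreal J + ennreal (2 * M) * L1_dist f (grid n A)"
  proof -
    have qm: "?q \<in> borel_measurable ?L" by (rule borel_measurable_indicator[OF unit_square_sets])
    have "(\<lambda>z. ?q z + ennreal (\<bar>U z\<bar> powr p) * ?q z) \<in> borel_measurable ?L"
      by (intro borel_measurable_add qm pm)
    then show ?thesis using dm pm qm Lp_norm_powr[OF U] p
      by (simp add: nn_integral_add nn_integral_cmult J_def emeasure_unit_square)
  qed
  also have "\<dots> \<le> 1 + ennreal J + ennreal (2 * M) * ennreal e"
    by (intro add_left_mono mult_left_mono nA(3)) simp
  also have "\<dots> \<le> 1 + ennreal J + ennreal 1"
    using e M by (intro add_left_mono) (simp add: ennreal_mult[symmetric] del: ennreal_1)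
  also have "\<dots> = ennreal (J + 2)"
    using J0 by (simp add: ennreal_plus[symmetric] ennreal_1[symmetric] del: ennreal_plus ennreal_1)
  finally have "ennreal (avg {..<n} (\<lambda>a. avg {..<n} (\<lambda>b. (A a b)\<^sup>2))) \<le> ennreal (J + 2)"
    by (simp add: nn_integral_grid[OF nA(1)])
  then have "avg {..<n} (\<lambda>a. avg {..<n} (\<lambda>b. (A a b)\<^sup>2)) \<le> J + 2"
    using J0 by (subst (asm) ennreal_le_iff) auto
  from that[OF nA(1,2) 1 this] show ?thesis .
qed

section \<open>Measurability and the law of the sample\<close>

text \<open>\<open>Sup\<close> on the reals is defined from the upper bounds alone, and an unbounded
  set has none.\<close>

lemma Sup_unbounded_eq:
  fixes X Y :: "real set"
  assumes "\<not> bdd_above X" "\<not> bdd_above Y"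
  shows "Sup X = Sup Y"
proof -
  have "(\<lambda>z. \<forall>x\<in>X. x \<le> z) = (\<lambda>z. \<forall>x\<in>Y. x \<le> z)"
    using assms by (auto simp: bdd_above_def fun_eq_iff)
  then show ?thesis by (simp add: Sup_real_def)
qed

lemma grid_integral_abs_le:
  assumes k: "k \<ge> 1" and S: "S \<in> sets lebesgue" "S \<subseteq> {0..1}" and T: "T \<in> sets lebesgue" "T \<subseteq> {0..1}"
  shows "\<bar>LINT z:S \<times> T|lebesgue. grid k D z\<bar> \<le> (\<Sum>i<k. \<Sum>j<k. \<bar>D i j\<bar>) / (real k)\<^sup>2"
proof -
  have "\<bar>LINT z:S \<times> T|lebesgue. grid k D z\<bar> \<le> (\<Sum>i<k. \<Sum>j<k. \<bar>D i j\<bar> * (1 / real k) * (1 / real k))"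
    unfolding grid_integral(2)[OF k S T]
  proof (intro order_trans[OF sum_abs] sum_mono)
    fix i j assume "i \<in> {..<k}" "j \<in> {..<k}"
    then show "\<bar>D i j * measure lebesgue (S \<inter> cell k i) * measure lebesgue (T \<inter> cell k j)\<bar>
        \<le> \<bar>D i j\<bar> * (1 / real k) * (1 / real k)"
      unfolding abs_mult using measure_Int_cell_le[OF k _ S(1)] measure_Int_cell_le[OF k _ T(1)]
      by (intro mult_mono) auto
  qed
  then show ?thesis by (simp add: sum_divide_distrib power2_eq_square)
qed

lemma sets_lebesgue_on_unit:
  "S \<in> sets (lebesgue_on unit_interval) \<longleftrightarrow> S \<in> sets lebesgue \<and> S \<subseteq> unit_interval"
  by (subst sets_restrict_space_iff) auto

text \<open>
  No integrability is assumed of \<open>B\<close>: where \<open>grid k D - B\<close> is not integrable the Bochner integral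
  is 0 whatever \<open>D\<close> is, and a supremum over an unbounded set does not depend on that set.
\<close>

lemma abs_integral_grid_diff_le:
  assumes k: "k \<ge> 1" and S: "S \<in> sets lebesgue" "S \<subseteq> {0..1}" and T: "T \<in> sets lebesgue" "T \<subseteq> {0..1}"
  shows "\<bar>LINT z:S \<times> T|lebesgue. grid k D z - B z\<bar>
    \<le> \<bar>LINT z:S \<times> T|lebesgue. grid k D' z - B z\<bar> + (\<Sum>i<k. \<Sum>j<k. \<bar>D i j - D' i j\<bar>) / (real k)\<^sup>2"
proof -
  have *: "grid k D z - B z = (grid k D' z - B z) + grid k (\<lambda>i j. D i j - D' i j) z" for z
    by (simp add: grid_def case_prod_unfold)
  note int = grid_integral(1)[OF k S T, of "\<lambda>i j. D i j - D' i j"]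
  show ?thesis
  proof (cases "set_integrable lebesgue (S \<times> T) (\<lambda>z. grid k D' z - B z)")
    case True
    have "(LINT z:S \<times> T|lebesgue. grid k D z - B z)
      = (LINT z:S \<times> T|lebesgue. grid k D' z - B z) + (LINT z:S \<times> T|lebesgue. grid k (\<lambda>i j. D i j - D' i j) z)"
      unfolding * using True int by (rule set_integral_add(2))
    then show ?thesis
      using grid_integral_abs_le[OF k S T, of "\<lambda>i j. D i j - D' i j"] by linarith
  next
    case False
    have "\<not> set_integrable lebesgue (S \<times> T) (\<lambda>z. grid k D z - B z)"
    proof
      assume "set_integrable lebesgue (S \<times> T) (\<lambda>z. grid k D z - B z)"
      then have "set_integrable lebesgue (S \<times> T) (\<lambda>z. (grid k D z - B z) - grid k (\<lambda>i j. D i j - D' i j) z)"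
        using int by (rule set_integral_diff(1))
      then show False using False unfolding * by simp
    qed
    then have "(LINT z:S \<times> T|lebesgue. grid k D z - B z) = 0"
      by (simp add: set_lebesgue_integral_def set_integrable_def not_integrable_integral_eq)
    then show ?thesis by (simp add: sum_nonneg)
  qed
qed

text \<open>The values for \<open>D\<close> and \<open>D'\<close> differ by a bounded amount, so
  both sets of values are bounded or neither is; in the latter case the two suprema are the same
  default value.\<close>

lemma cut_norm_grid_diff_le:
  assumes k: "k \<ge> 1"
  shows "cut_norm (\<lambda>z. grid k D z - B z) \<le> cut_norm (\<lambda>z. grid k D' z - B z)
    + (\<Sum>i<k. \<Sum>j<k. \<bar>D i j - D' i j\<bar>) / (real k)\<^sup>2"
proof -
  let ?A = "sets (lebesgue_on unit_interval)"
  define v where "v D P = \<bar>LINT z:fst P \<times> snd P|lebesgue. grid k D z - B z\<bar>" for D and P :: "real set \<times> real set"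
  define d where "d D D' = (\<Sum>i<k. \<Sum>j<k. \<bar>D i j - D' i j\<bar>) / (real k)\<^sup>2" for D D' :: "nat \<Rightarrow> nat \<Rightarrow> real"
  have d0: "d D D' \<ge> 0" for D D' by (simp add: d_def sum_nonneg)
  have cn: "cut_norm (\<lambda>z. grid k D z - B z) = (SUP P\<in>?A \<times> ?A. v D P)" for D
    unfolding cut_norm_def v_def by (simp add: case_prod_unfold)
  have le: "v D P \<le> v D' P + d D D'" if "P \<in> ?A \<times> ?A" for D D' P
  proof -
    have "fst P \<in> sets lebesgue" "fst P \<subseteq> {0..1}" "snd P \<in> sets lebesgue" "snd P \<subseteq> {0..1}"
      using that by (simp_all only: mem_Times_iff sets_lebesgue_on_unit)
    then show ?thesis unfolding v_def d_def by (rule abs_integral_grid_diff_le[OF k])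
  qed
  have bdd: "bdd_above (v D ` (?A \<times> ?A))" if bd: "bdd_above (v D' ` (?A \<times> ?A))" for D D'
  proof -
    obtain M where M: "v D' P \<le> M" if "P \<in> ?A \<times> ?A" for P
      using bd unfolding bdd_above_def by blast
    show ?thesis
    proof (rule bdd_aboveI2)
      fix P assume "P \<in> ?A \<times> ?A"
      then show "v D P \<le> M + d D D'" using le[of P D D'] M[of P] by linarith
    qed
  qed
  have ne: "?A \<times> ?A \<noteq> {}" by auto
  show ?thesis unfolding cn d_def[symmetric]
  proof (cases "bdd_above (v D' ` (?A \<times> ?A))")
    case True
    show "(SUP P\<in>?A \<times> ?A. v D P) \<le> (SUP P\<in>?A \<times> ?A. v D' P) + d D D'"
    proof (rule cSUP_least[OF ne])
      fix P assume P: "P \<in> ?A \<times> ?A"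
      then have "v D' P \<le> (SUP P\<in>?A \<times> ?A. v D' P)" using True by (rule cSUP_upper)
      then show "v D P \<le> (SUP P\<in>?A \<times> ?A. v D' P) + d D D'" using le[OF P, of D D'] by linarith
    qed
  next
    case False
    have "\<not> bdd_above (v D ` (?A \<times> ?A))"
    proof
      assume "bdd_above (v D ` (?A \<times> ?A))"
      then have "bdd_above (v D' ` (?A \<times> ?A))" by (rule bdd)
      with False show False by simp
    qed
    from Sup_unbounded_eq[OF this False]
    show "(SUP P\<in>?A \<times> ?A. v D P) \<le> (SUP P\<in>?A \<times> ?A. v D' P) + d D D'" using d0 by simp
  qed
qed

text \<open>An infimum in the reals is meaningful only for sets bounded below. A bounded set of
  values contains 0, from empty \<open>S\<close> and \<open>T\<close>, and an unbounded one has the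
  fixed default \<open>Sup UNIV\<close>; so one bound serves for every \<open>W\<close>.\<close>

lemma cut_norm_lower_bound: "min 0 (Sup (UNIV :: real set)) \<le> cut_norm W"
proof -
  let ?A = "sets (lebesgue_on unit_interval)"
  let ?v = "\<lambda>(S, T). \<bar>LINT z:S \<times> T|lebesgue. W z\<bar>"
  show ?thesis
  proof (cases "bdd_above (?v ` (?A \<times> ?A))")
    case True
    have "?v ({}, {}) \<le> cut_norm W"
      unfolding cut_norm_def by (rule cSUP_upper[OF _ True]) auto
    then show ?thesis by simp
  next
    case False
    moreover have "\<not> bdd_above (UNIV :: real set)"
    proof
      assume "bdd_above (UNIV :: real set)"
      then obtain M where "\<And>x :: real. x \<le> M" unfolding bdd_above_def by blast
      from this[of "M + 1"] show False by simp
    qed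
    ultimately have "cut_norm W = Sup (UNIV :: real set)"
      unfolding cut_norm_def by (rule Sup_unbounded_eq)
    then show ?thesis by simp
  qed
qed

lemma cut_dist_eq:
  "cut_dist W U = (INF \<psi>\<in>mp_bijections. cut_norm (\<lambda>z. W z - U (\<psi> (fst z), \<psi> (snd z))))"
  by (simp add: cut_dist_def case_prod_unfold)

lemma cut_dist_le:
  assumes "\<psi> \<in> mp_bijections"
  shows "cut_dist W U \<le> cut_norm (\<lambda>z. W z - U (\<psi> (fst z), \<psi> (snd z)))"
  unfolding cut_dist_eq using assms
  by (intro cINF_lower bdd_belowI2[OF cut_norm_lower_bound])

lemma cut_dist_grid_diff_le:
  assumes k: "k \<ge> 1"
  shows "cut_dist (grid k D) U \<le> cut_dist (grid k D') U + (\<Sum>i<k. \<Sum>j<k. \<bar>D i j - D' i j\<bar>) / (real k)\<^sup>2"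
proof -
  let ?d = "(\<Sum>i<k. \<Sum>j<k. \<bar>D i j - D' i j\<bar>) / (real k)\<^sup>2"
  have "bij_betw id {..<1::nat} {..<1}" by simp
  then have ne: "mp_bijections \<noteq> {}" using cell_perm_mp_bijection[of 1 id] by auto
  have "cut_dist (grid k D) U - ?d \<le> cut_dist (grid k D') U"
    unfolding cut_dist_eq[of "grid k D'"]
  proof (rule cINF_greatest[OF ne])
    fix \<psi> assume "\<psi> \<in> mp_bijections"
    from cut_dist_le[OF this, of "grid k D" U]
    show "cut_dist (grid k D) U - ?d \<le> cut_norm (\<lambda>z. grid k D' z - U (\<psi> (fst z), \<psi> (snd z)))"
      using cut_norm_grid_diff_le[OF k, of D "\<lambda>z. U (\<psi> (fst z), \<psi> (snd z))" D'] by linarith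
  qed
  then show ?thesis by linarith
qed

text \<open>The infimum and the suprema run over uncountable families, so measurability comes from
  continuity instead: the cut distance is Lipschitz in the \<open>k * k\<close> entries.
  \<open>W\<close> is a function on all of \<open>nat \<times> nat\<close> so that continuity can be
  stated in the product topology.\<close>

lemma measurable_cut_dist_grid:
  assumes k: "k \<ge> 1"
  shows "(\<lambda>W :: nat \<times> nat \<Rightarrow> real. cut_dist (grid k (\<lambda>i j. W (i, j))) U) \<in> borel_measurable borel"
proof (rule borel_measurable_continuous_onI)
  let ?F = "\<lambda>W :: nat \<times> nat \<Rightarrow> real. cut_dist (grid k (\<lambda>i j. W (i, j))) U"
  let ?d = "\<lambda>W W'. (\<Sum>i<k. \<Sum>j<k. \<bar>W (i, j) - W' (i, j)\<bar>) / (real k)\<^sup>2 :: real"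
  show "continuous_on UNIV ?F"
    unfolding continuous_on_def
  proof
    fix W :: "nat \<times> nat \<Rightarrow> real"
    have "continuous_on UNIV (\<lambda>V. ?d V W)"
      by (intro continuous_intros continuous_on_product_coordinates) (use k in auto)
    then have "((\<lambda>V. ?d V W) \<longlongrightarrow> ?d W W) (at W)"
      unfolding continuous_on_def by blast
    then have d0: "((\<lambda>V. ?d V W) \<longlongrightarrow> 0) (at W)" by simp
    have "\<bar>?F V - ?F W\<bar> \<le> ?d V W" for V
      using cut_dist_grid_diff_le[OF k, of "\<lambda>i j. V (i, j)" U "\<lambda>i j. W (i, j)"]
        cut_dist_grid_diff_le[OF k, of "\<lambda>i j. W (i, j)" U "\<lambda>i j. V (i, j)"]
      by (simp add: abs_minus_commute abs_le_iff)
    then have "((\<lambda>V. ?F V - ?F W) \<longlongrightarrow> 0) (at W)"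
      by (intro Lim_null_comparison[OF _ d0]) auto
    then show "(?F \<longlongrightarrow> ?F W) (at W within UNIV)" by (simp add: LIM_zero_iff)
  qed
qed

lemma borel_measurable_completion_AE:
  fixes f h :: "'a \<Rightarrow> real"
  assumes f: "f \<in> borel_measurable M" and ae: "AE x in M. f x = h x"
  shows "h \<in> borel_measurable (completion M)"
proof (rule measurableI)
  fix A :: "real set" assume A: "A \<in> sets borel"
  show "h -` A \<inter> space (completion M) \<in> sets (completion M)"
  proof (rule completion.in_sets_AE)
    show "f -` A \<inter> space M \<in> sets (completion M)" using measurable_sets[OF f A] by auto
    show "AE x in completion M. x \<in> f -` A \<inter> space M \<longleftrightarrow> x \<in> h -` A \<inter> space (completion M)"
      using AE_completion[OF ae] by eventually_elim auto
  qed auto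
qed auto

section \<open>The law of the sample points\<close>

abbreviation unif :: "real measure"
  where "unif \<equiv> uniform_measure lborel unit_interval"

lemma prob_space_unif: "prob_space unif"
  by (rule prob_space_uniform_measure) auto

lemma prob_space_uniform_vector: "prob_space (uniform_vector k)"
proof (rule prob_spaceI)
  interpret prob_space "PiM {..<k} (\<lambda>_. unif)" by (intro prob_space_PiM prob_space_unif)
  show "emeasure (uniform_vector k) (space (uniform_vector k)) = 1"
    by (simp add: uniform_vector_def emeasure_space_1)
qed

lemma emeasure_unif: "A \<in> sets borel \<Longrightarrow> emeasure unif A = emeasure lborel (unit_interval \<inter> A)"
  by (simp add: emeasure_uniform_measure divide_ennreal_def)

text \<open>Two distinct coordinates are independent and uniform; all others integrate to 1.\<close>

lemma nn_integral_PiM_unif_pair: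
  fixes f :: "real \<times> real \<Rightarrow> ennreal" and i j k :: nat
  assumes ij: "i < k" "j < k" "i \<noteq> j" and f: "f \<in> borel_measurable borel"
  shows "(\<integral>\<^sup>+X. f (X i, X j) \<partial>PiM {..<k} (\<lambda>_. unif)) = (\<integral>\<^sup>+z\<in>unit_square. f z \<partial>lborel)"
proof -
  interpret prob_space unif by (rule prob_space_unif)
  interpret P: product_sigma_finite "\<lambda>_ :: nat. unif" ..
  define K where "K = {..<k} - {i, j}"
  have K: "{..<k} = insert i (insert j K)" "finite K" "i \<notin> insert j K" "j \<notin> K" using ij by (auto simp: K_def)
  interpret PK: prob_space "PiM K (\<lambda>_. unif)" by (intro prob_space_PiM prob_space_unif)
  have fm [measurable]: "f \<in> borel_measurable (borel \<Otimes>\<^sub>M borel)" using f by (simp add: borel_prod)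
  have s: "sets unif = sets borel" by simp
  note [measurable_cong] = s
  have "(\<integral>\<^sup>+X. f (X i, X j) \<partial>PiM {..<k} (\<lambda>_. unif))
    = (\<integral>\<^sup>+x. (\<integral>\<^sup>+X. f (x, X j) \<partial>PiM (insert j K) (\<lambda>_. unif)) \<partial>unif)"
    unfolding K(1) using K ij
    by (subst P.product_nn_integral_insert_rev) (auto simp: intro!: measurable_compose[OF _ fm])
  also have "\<dots> = (\<integral>\<^sup>+x. (\<integral>\<^sup>+y. f (x, y) \<partial>unif) \<partial>unif)"
    using K by (subst P.product_nn_integral_insert_rev)
      (auto simp: PK.emeasure_space_1 intro!: measurable_compose[OF _ fm])
  also have "\<dots> = (\<integral>\<^sup>+x. (\<integral>\<^sup>+y. f (x, y) * indicator unit_interval y \<partial>lborel) * indicator unit_interval x \<partial>lborel)"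
    by (simp add: nn_integral_uniform_measure divide_ennreal_def)
  also have "\<dots> = (\<integral>\<^sup>+x. (\<integral>\<^sup>+y. f (x, y) * indicator unit_square (x, y) \<partial>lborel) \<partial>lborel)"
    by (intro nn_integral_cong, subst nn_integral_multc[symmetric])
      (auto simp: indicator_times mult_ac)
  also have "\<dots> = (\<integral>\<^sup>+z. f z * indicator unit_square z \<partial>(lborel \<Otimes>\<^sub>M lborel))"
    by (intro lborel.nn_integral_fst) (auto intro!: borel_measurable_times_ennreal borel_measurable_indicator)
  finally show ?thesis by (simp add: lborel_prod)
qed

text \<open>Without \<open>i \<noteq> j\<close> this would fail: the diagonal of the square is
  itself a null set.\<close>

lemma AE_PiM_unif_pair:
  fixes i j k :: nat
  assumes ij: "i < k" "j < k" "i \<noteq> j" and N: "N \<in> null_sets lborel"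
  shows "AE X in PiM {..<k} (\<lambda>_. unif). (X i, X j) \<notin> N"
proof -
  have Nb: "N \<in> sets borel" using N by auto
  have m: "(\<lambda>X. (X i, X j)) \<in> PiM {..<k} (\<lambda>_. unif) \<rightarrow>\<^sub>M borel"
    unfolding borel_prod[symmetric] using ij by (intro measurable_Pair) (auto cong: measurable_cong_sets)
  have "(\<integral>\<^sup>+X. indicator N (X i, X j) \<partial>PiM {..<k} (\<lambda>_. unif)) = (\<integral>\<^sup>+z\<in>unit_square. indicator N z \<partial>lborel)"
    using Nb by (intro nn_integral_PiM_unif_pair ij) auto
  also have "\<dots> \<le> (\<integral>\<^sup>+z. indicator N z \<partial>lborel)"
    by (intro nn_integral_mono) (auto simp: indicator_def)
  also have "\<dots> = 0" using nn_integral_indicator[of N lborel] Nb null_setsD1[OF N] by simp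
  finally have "(\<integral>\<^sup>+X. indicator N (X i, X j) \<partial>PiM {..<k} (\<lambda>_. unif)) = 0" by simp
  then have "AE X in PiM {..<k} (\<lambda>_. unif). indicator N (X i, X j) = (0 :: ennreal)"
    using m Nb by (subst (asm) nn_integral_0_iff_AE)
      (auto intro!: measurable_compose[OF m borel_measurable_indicator])
  then show ?thesis by eventually_elim (auto simp: indicator_def split: if_splits)
qed

lemma AE_PiM_unif_range: "AE X in PiM {..<k :: nat} (\<lambda>_. unif). \<forall>i<k. X i \<in> unit_interval"
proof -
  have "AE X in PiM {..<k} (\<lambda>_. unif). X i \<in> unit_interval" if "i < k" for i
  proof (rule AE_PiM_component)
    show "AE x in unif. x \<in> unit_interval" by (intro AE_uniform_measureI) auto
  qed (use that prob_space_unif in auto)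
  then have "AE X in PiM {..<k} (\<lambda>_. unif). \<forall>i\<in>{..<k}. X i \<in> unit_interval"
    by (subst AE_ball_countable) auto
  then show ?thesis by eventually_elim auto
qed

text \<open>A Lebesgue measurable \<open>U\<close> has a Borel version \<open>g\<close> on the
  square, and a pair of distinct sample points almost surely avoids the null set where the two
  differ. Equality almost everywhere is enough for measurability in the completed product
  measure.\<close>

lemma measurable_sample_entry:
  fixes U :: "real \<times> real \<Rightarrow> real" and i j k :: nat
  assumes U: "(\<lambda>z. indicator unit_square z * U z) \<in> borel_measurable lebesgue"
    and ij: "i < k" "j < k" "i \<noteq> j"
  shows "(\<lambda>X. U (X i, X j)) \<in> borel_measurable (completion (PiM {..<k} (\<lambda>_. unif)))"
proof -
  obtain g where g: "g \<in> borel_measurable lborel" "AE z in lborel. indicator unit_square z * U z = g z"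
    using completion_ex_borel_measurable_real[OF U] by blast
  obtain N where N: "N \<in> null_sets lborel" "{z. indicator unit_square z * U z \<noteq> g z} \<subseteq> N"
    using g(2) by (auto elim!: AE_E simp: null_sets_def)
  have m: "(\<lambda>X. (X i, X j)) \<in> PiM {..<k} (\<lambda>_. unif) \<rightarrow>\<^sub>M borel"
    unfolding borel_prod[symmetric] using ij by (intro measurable_Pair) (auto cong: measurable_cong_sets)
  show ?thesis
  proof (rule borel_measurable_completion_AE)
    show "(\<lambda>X. g (X i, X j)) \<in> borel_measurable (PiM {..<k} (\<lambda>_. unif))"
      using g(1) by (intro measurable_compose[OF m]) simp
    show "AE X in PiM {..<k} (\<lambda>_. unif). g (X i, X j) = U (X i, X j)"
      using AE_PiM_unif_pair[OF ij N(1)] AE_PiM_unif_range[of k]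
    proof eventually_elim
      case (elim X)
      then have "(X i, X j) \<in> unit_square" using ij by auto
      moreover have "indicator unit_square (X i, X j) * U (X i, X j) = g (X i, X j)" using elim(1) N(2) by blast
      ultimately show ?case by simp
    qed
  qed
qed

lemma sample_eq_grid: "sample k U X = grid k (\<lambda>i j. if i = j then 0 else U (X i, X j))"
  by (simp add: sample_def grid_def Let_def)

lemma measurable_cut_dist_sample:
  assumes k: "k \<ge> 1" and U: "(\<lambda>z. indicator unit_square z * U z :: real) \<in> borel_measurable lebesgue"
  shows "(\<lambda>X. cut_dist (sample k U X) U) \<in> borel_measurable (uniform_vector k)"
proof -
  \<comment> \<open>With all other entries set to 0, \<open>W\<close> is measurable in every
    coordinate, and the step function of the sample is unchanged.\<close>
  define W where "W X = (\<lambda>(i, j). if i < k \<and> j < k \<and> i \<noteq> j then U (X i, X j) else 0)" for X :: "nat \<Rightarrow> real"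
  have "W \<in> borel_measurable (uniform_vector k)"
  proof (rule measurable_coordinatewise_then_product)
    fix ij :: "nat \<times> nat"
    obtain i j where ij: "ij = (i, j)" by (cases ij)
    show "(\<lambda>X. W X ij) \<in> borel_measurable (uniform_vector k)"
    proof (cases "i < k \<and> j < k \<and> i \<noteq> j")
      case True
      then have "(\<lambda>X. W X ij) = (\<lambda>X. U (X i, X j))" by (simp add: W_def ij)
      then show ?thesis using measurable_sample_entry[OF U, of i k j] True by (simp add: uniform_vector_def)
    next
      case False
      then have "(\<lambda>X. W X ij) = (\<lambda>X. 0)" by (auto simp: W_def ij)
      then show ?thesis by simp
    qed
  qed
  from measurable_compose[OF this measurable_cut_dist_grid[OF k, of U]]
  have "(\<lambda>X. cut_dist (grid k (\<lambda>i j. W X (i, j))) U) \<in> borel_measurable (uniform_vector k)" .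
  also have "(\<lambda>X. cut_dist (grid k (\<lambda>i j. W X (i, j))) U) = (\<lambda>X. cut_dist (sample k U X) U)"
  proof
    fix X
    have "grid k (\<lambda>i j. W X (i, j)) = sample k U X"
      using step_index_less[OF k] by (auto simp: sample_eq_grid grid_def W_def)
    then show "cut_dist (grid k (\<lambda>i j. W X (i, j))) U = cut_dist (sample k U X) U" by simp
  qed
  finally show ?thesis .
qed

text \<open>The bridge from counting to probability: the step indices of a uniform vector are
  independent and uniform in \<open>{..<n}\<close>, so a proportion of index vectors is a
  probability.\<close>

lemma emeasure_PiM_unif_steps:
  assumes n: "n \<ge> 1" and Bad: "Bad \<subseteq> PiE {..<k} (\<lambda>_. {..<n})"
  shows "{X \<in> space (PiM {..<k} (\<lambda>_. unif)). (\<lambda>i\<in>{..<k}. step_index n (X i)) \<in> Bad} \<in> sets (PiM {..<k} (\<lambda>_. unif))"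
    and "emeasure (PiM {..<k} (\<lambda>_. unif))
      {X \<in> space (PiM {..<k} (\<lambda>_. unif)). (\<lambda>i\<in>{..<k}. step_index n (X i)) \<in> Bad}
      = ennreal (real (card Bad) / real n ^ k)"
proof -
  interpret prob_space unif by (rule prob_space_unif)
  interpret P: product_sigma_finite "\<lambda>_ :: nat. unif" ..
  let ?P = "PiM {..<k} (\<lambda>_. unif)"
  define E where "E x = PiE {..<k} (\<lambda>i. step_index n -` {x i})" for x :: "nat \<Rightarrow> nat"
  have fin: "finite Bad" using Bad by (rule finite_subset) (simp add: finite_PiE)
  have v: "step_index n -` {a} \<in> sets borel" for a
    using measurable_sets[OF measurable_step_index, of "{a}" n] by simp
  have E_sets: "E x \<in> sets ?P" for x
    unfolding E_def using v by (intro sets_PiM_I_finite) auto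
  have eq: "{X \<in> space ?P. (\<lambda>i\<in>{..<k}. step_index n (X i)) \<in> Bad} = (\<Union>x\<in>Bad. E x)"
  proof (intro set_eqI iffI)
    fix X assume X: "X \<in> {X \<in> space ?P. (\<lambda>i\<in>{..<k}. step_index n (X i)) \<in> Bad}"
    then have "X \<in> E (\<lambda>i\<in>{..<k}. step_index n (X i))" by (auto simp: E_def space_PiM PiE_iff)
    then show "X \<in> (\<Union>x\<in>Bad. E x)" using X by blast
  next
    fix X assume "X \<in> (\<Union>x\<in>Bad. E x)"
    then obtain x where x: "x \<in> Bad" "X \<in> E x" by blast
    have "(\<lambda>i\<in>{..<k}. step_index n (X i)) = x"
    proof
      fix i show "(\<lambda>i\<in>{..<k}. step_index n (X i)) i = x i"
      proof (cases "i < k")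
        case False
        then show ?thesis using x(1) Bad by (auto simp: PiE_iff extensional_def)
      qed (use x(2) in \<open>auto simp: E_def PiE_iff\<close>)
    qed
    then show "X \<in> {X \<in> space ?P. (\<lambda>i\<in>{..<k}. step_index n (X i)) \<in> Bad}"
      using x by (auto simp: E_def space_PiM PiE_iff)
  qed
  show "{X \<in> space ?P. (\<lambda>i\<in>{..<k}. step_index n (X i)) \<in> Bad} \<in> sets ?P"
    unfolding eq using fin E_sets by (intro sets.finite_UN) auto
  have Em: "emeasure ?P (E x) = ennreal ((1 / real n) ^ k)" if "x \<in> Bad" for x
  proof -
    have "emeasure ?P (E x) = (\<Prod>i<k. emeasure unif (step_index n -` {x i}))"
      unfolding E_def using v by (intro P.emeasure_PiM) auto
    also have "\<dots> = (\<Prod>i<k. ennreal (1 / real n))"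
    proof (rule prod.cong[OF refl])
      fix i assume "i \<in> {..<k}"
      then have "x i < n" using that Bad by (auto simp: PiE_iff)
      moreover have "unit_interval \<inter> step_index n -` {x i} = cell n (x i)" by (auto simp: cell_def)
      ultimately show "emeasure unif (step_index n -` {x i}) = ennreal (1 / real n)"
        using emeasure_cell[OF n] v by (simp add: emeasure_unif divide_ennreal_def)
    qed
    also have "\<dots> = ennreal ((1 / real n) ^ k)" by (simp add: ennreal_power)
    finally show ?thesis .
  qed
  have "disjoint_family_on E Bad"
    unfolding disjoint_family_on_def
  proof (intro ballI impI)
    fix x y assume xy: "x \<in> Bad" "y \<in> Bad" "x \<noteq> y"
    show "E x \<inter> E y = {}"
    proof (rule ccontr)
      assume "E x \<inter> E y \<noteq> {}"
      then obtain X where X: "X \<in> E x" "X \<in> E y" by blast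
      have "x i = y i" if "i < k" for i using X that by (auto simp: E_def PiE_iff)
      moreover have "x i = y i" if "\<not> i < k" for i 
        using PiE_arb[OF subsetD[OF Bad xy(1)], of i] PiE_arb[OF subsetD[OF Bad xy(2)], of i] that by simp
      ultimately show False using xy(3) by (auto simp: fun_eq_iff)
    qed
  qed
  then have "emeasure ?P (\<Union>x\<in>Bad. E x) = (\<Sum>x\<in>Bad. emeasure ?P (E x))"
    using fin E_sets by (intro sum_emeasure[symmetric]) auto
  also have "\<dots> = (\<Sum>x\<in>Bad. ennreal ((1 / real n) ^ k))" using Em by (intro sum.cong) auto
  also have "\<dots> = ennreal (\<Sum>x\<in>Bad. (1 / real n) ^ k)" by (rule sum_ennreal) simp
  also have "\<dots> = ennreal (real (card Bad) / real n ^ k)" by (simp add: power_one_over)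
  finally show "emeasure ?P {X \<in> space ?P. (\<lambda>i\<in>{..<k}. step_index n (X i)) \<in> Bad}
    = ennreal (real (card Bad) / real n ^ k)" unfolding eq .
qed

text \<open>The value \<top> on the exceptional null set makes the bound hold at every point of the
  square, while \<open>d\<close> stays Borel, so that \<open>d (X i, X j)\<close> is measurable
  without completion and its integral follows from the product law.\<close>

lemma borel_majorant:
  fixes f :: "real \<times> real \<Rightarrow> real"
  assumes f: "(\<lambda>z. indicator unit_square z * f z) \<in> borel_measurable lebesgue"
  obtains d where "d \<in> borel_measurable borel" "\<And>z. z \<in> unit_square \<Longrightarrow> ennreal \<bar>f z\<bar> \<le> d z"
    "(\<integral>\<^sup>+z\<in>unit_square. d z \<partial>lborel) = (\<integral>\<^sup>+z\<in>unit_square. ennreal \<bar>f z\<bar> \<partial>lebesgue)"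
proof -
  obtain g where g: "g \<in> borel_measurable lborel" "AE z in lborel. indicator unit_square z * f z = g z"
    using completion_ex_borel_measurable_real[OF f] by blast
  obtain N where N: "N \<in> null_sets lborel" "{z. indicator unit_square z * f z \<noteq> g z} \<subseteq> N"
    using g(2) by (auto elim!: AE_E simp: null_sets_def)
  define d where "d z = (if z \<in> N then \<top> else ennreal \<bar>g z\<bar>)" for z
  have Nb: "N \<in> sets borel" using N(1) by auto
  have "g \<in> borel_measurable borel" using g(1) by simp
  then have d: "d \<in> borel_measurable borel"
    unfolding d_def using Nb by (intro measurable_If_set measurable_compose[OF _ measurable_ennreal]) auto
  show ?thesis
  proof (rule that[OF d])
    fix z assume "z \<in> unit_square"
    then have "f z = g z" if "z \<notin> N" using subsetD[OF N(2), of z] that by fastforce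
    then show "ennreal \<bar>f z\<bar> \<le> d z" by (simp add: d_def)
  next
    have "(\<integral>\<^sup>+z\<in>unit_square. ennreal \<bar>f z\<bar> \<partial>lebesgue) = (\<integral>\<^sup>+z\<in>unit_square. d z \<partial>lebesgue)"
    proof (rule nn_integral_cong_AE, rule AE_I'[OF null_sets_completionI[OF N(1)]], rule subsetI)
      fix z assume z: "z \<in> {z \<in> space lebesgue. ennreal \<bar>f z\<bar> * indicator unit_square z \<noteq> d z * indicator unit_square z}"
      show "z \<in> N"
      proof (rule ccontr)
        assume "z \<notin> N"
        then have "indicator unit_square z * f z = g z" using N(2) by blast
        then show False using z \<open>z \<notin> N\<close> by (cases "z \<in> unit_square") (auto simp: d_def)
      qed
    qed
    then show "(\<integral>\<^sup>+z\<in>unit_square. d z \<partial>lborel) = (\<integral>\<^sup>+z\<in>unit_square. ennreal \<bar>f z\<bar> \<partial>lebesgue)"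
      by (simp add: nn_integral_completion)
  qed
qed

section \<open>From step functions to kernels\<close>

text \<open>The deterministic part. The sample minus the rearranged \<open>U\<close> splits into the
  difference of step functions covered by \<open>cut_close\<close>, the sample of
  \<open>U - grid n A\<close>, bounded by \<open>t\<close> in mean absolute value, and the
  rearranged error \<open>U - grid n A\<close> of L1 norm at most \<open>\<eta>\<close>.\<close>

lemma cut_dist_sample_le:
  fixes U :: "real \<times> real \<Rightarrow> real" and d :: "real \<times> real \<Rightarrow> ennreal"
  assumes k: "k \<ge> 1" and n: "n \<ge> 1"
    and close: "cut_close k n A x c"
    and x: "\<And>i. i < k \<Longrightarrow> x i = step_index n (X i)"
    and d: "d \<in> borel_measurable borel" "\<And>z. z \<in> unit_square \<Longrightarrow> ennreal \<bar>U z - grid n A z\<bar> \<le> d z"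
      "(\<integral>\<^sup>+z\<in>unit_square. d z \<partial>lborel) \<le> ennreal \<eta>" "\<eta> \<ge> 0"
    and X: "\<And>i. i < k \<Longrightarrow> X i \<in> unit_interval"
    and t: "t \<ge> 0" "(\<Sum>i<k. \<Sum>j<k. if i = j then 0 else d (X i, X j)) \<le> ennreal (t * (real k)\<^sup>2)"
  shows "cut_dist (sample k U X) U \<le> c + t + \<eta>"
proof -
  obtain p where p: "bij_betw p {..<k * n} {..<k * n}"
    and le: "\<And>S T. S \<in> sets lebesgue \<Longrightarrow> S \<subseteq> {0..1} \<Longrightarrow> T \<in> sets lebesgue \<Longrightarrow> T \<subseteq> {0..1} \<Longrightarrow>
      \<bar>LINT z:S \<times> T|lebesgue. grid k (offdiag A x) z
        - grid n A (cell_perm2 (k * n) p z)\<bar> \<le> c"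
    using close unfolding cut_close_def by blast
  let ?psi = "cell_perm2 (k * n) p"
  have N: "k * n \<ge> 1" using k n by simp
  have pN: "p ` {..<k * n} \<subseteq> {..<k * n}" using p by (simp add: bij_betw_def)
  define W0 where "W0 z = grid k (offdiag A x) z - grid n A (?psi z)" for z
  define Delta where "Delta i j = (if i = j then 0 else U (X i, X j) - A (x i) (x j))" for i j
  define E where "E z = U (?psi z) - grid n A (?psi z)" for z
  define W where "W z = sample k U X z - U (?psi z)" for z
  have W_eq: "W z = W0 z + grid k Delta z - E z" for z
    by (simp add: W_def W0_def E_def Delta_def sample_eq_grid grid_def case_prod_unfold)
  have psi_sq: "?psi z \<in> unit_square \<longleftrightarrow> z \<in> unit_square" for z
    using cell_perm_mem_iff[OF N pN] by (cases z) (simp only: mem_Times_iff fst_conv snd_conv)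
  have Delta_le: "(\<Sum>i<k. \<Sum>j<k. \<bar>Delta i j\<bar>) / (real k)\<^sup>2 \<le> t"
  proof -
    have "ennreal (\<Sum>i<k. \<Sum>j<k. \<bar>Delta i j\<bar>) = (\<Sum>i<k. \<Sum>j<k. ennreal \<bar>Delta i j\<bar>)"
      by (simp add: sum_nonneg)
    also have "\<dots> \<le> (\<Sum>i<k. \<Sum>j<k. if i = j then 0 else d (X i, X j))"
    proof (intro sum_mono)
      fix i j assume ij: "i \<in> {..<k}" "j \<in> {..<k}"
      then have "(X i, X j) \<in> unit_square" using X by blast
      then have "ennreal \<bar>U (X i, X j) - A (x i) (x j)\<bar> \<le> d (X i, X j)"
        using d(2)[of "(X i, X j)"] ij x by (simp add: grid_def)
      then show "ennreal \<bar>Delta i j\<bar> \<le> (if i = j then 0 else d (X i, X j))"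
        by (simp add: Delta_def)
    qed
    also have "\<dots> \<le> ennreal (t * (real k)\<^sup>2)" by (rule t(2))
    finally have "(\<Sum>i<k. \<Sum>j<k. \<bar>Delta i j\<bar>) \<le> t * (real k)\<^sup>2"
      using t(1) by (subst (asm) ennreal_le_iff) auto
    then show ?thesis using k by (simp add: divide_le_eq)
  qed
  have c0: "c \<ge> 0" using le[of "{}" "{}"] by simp
  have psi_meas: "?psi \<in> borel \<rightarrow>\<^sub>M borel" unfolding borel_prod[symmetric] by measurable
  have E_le: "\<bar>LINT z:S \<times> T|lebesgue. E z\<bar> \<le> \<eta>"
    if ST: "S \<subseteq> {0..1}" "T \<subseteq> {0..1}" and int: "set_integrable lebesgue (S \<times> T) E" for S T
  proof -
    have "ennreal (norm (LINT z:S \<times> T|lebesgue. E z)) \<le> (\<integral>\<^sup>+z. ennreal (norm (indicator (S \<times> T) z *\<^sub>R E z)) \<partial>lebesgue)"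
      using int unfolding set_lebesgue_integral_def set_integrable_def by (rule integral_norm_bound_ennreal)
    also have "\<dots> \<le> (\<integral>\<^sup>+z. (\<lambda>z. d z * indicator unit_square z) (?psi z) \<partial>lebesgue)"
    proof (rule nn_integral_mono)
      fix z :: "real \<times> real"
      show "ennreal (norm (indicator (S \<times> T) z *\<^sub>R E z)) \<le> (\<lambda>z. d z * indicator unit_square z) (?psi z)"
      proof (cases "z \<in> S \<times> T")
        case True
        then have "z \<in> unit_square" using ST by blast
        then have "?psi z \<in> unit_square" using psi_sq by blast
        then show ?thesis using d(2)[of "?psi z"] True by (simp add: E_def del: mem_Times_iff)
      qed simp
    qed
    also have "\<dots> = (\<integral>\<^sup>+z. (\<lambda>z. d z * indicator unit_square z) (?psi z) \<partial>lborel)"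
      by (rule nn_integral_completion)
    also have "\<dots> = (\<integral>\<^sup>+z\<in>unit_square. d z \<partial>lborel)"
      using d(1) by (intro nn_integral_cell_perm[OF N p] borel_measurable_times_ennreal borel_measurable_indicator)
        (auto simp: borel_prod[symmetric])
    also have "\<dots> \<le> ennreal \<eta>" by (rule d(3))
    finally show ?thesis using d(4) by (subst (asm) ennreal_le_iff) auto
  qed
  have "cut_norm W \<le> c + t + \<eta>"
    unfolding cut_norm_def
  proof (rule cSUP_least)
    fix P assume P: "P \<in> sets (lebesgue_on unit_interval) \<times> sets (lebesgue_on unit_interval)"
    obtain S T where ST: "P = (S, T)" by (cases P)
    have S: "S \<in> sets lebesgue" "S \<subseteq> {0..1}" and T: "T \<in> sets lebesgue" "T \<subseteq> {0..1}"
      using P by (simp_all only: ST mem_Times_iff fst_conv snd_conv sets_lebesgue_on_unit)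
    have W0: "set_integrable lebesgue (S \<times> T) W0"
      unfolding W0_def by (rule sample_perm_integral(1)[OF k n pN S T])
    have G: "set_integrable lebesgue (S \<times> T) (grid k Delta)" by (rule grid_integral(1)[OF k S T])
    have "\<bar>LINT z:S \<times> T|lebesgue. W z\<bar> \<le> c + t + \<eta>"
    \<comment> \<open>Integrability of \<open>W\<close> yields that of \<open>E\<close>, as
      \<open>W0\<close> and \<open>grid k Delta\<close> are integrable; without it the integral of
      \<open>W\<close> is 0 by convention.\<close>
    proof (cases "set_integrable lebesgue (S \<times> T) W")
      case True
      have "set_integrable lebesgue (S \<times> T) (\<lambda>z. (W0 z + grid k Delta z) - W z)"
        by (intro set_integral_diff(1) set_integral_add(1) W0 G True)
      then have E: "set_integrable lebesgue (S \<times> T) E" by (simp add: W_eq)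
      have "(LINT z:S \<times> T|lebesgue. W z)
        = (LINT z:S \<times> T|lebesgue. W0 z) + (LINT z:S \<times> T|lebesgue. grid k Delta z) - (LINT z:S \<times> T|lebesgue. E z)"
        unfolding W_eq using W0 G E by (simp add: set_integral_diff(2) set_integral_add)
      moreover have "\<bar>LINT z:S \<times> T|lebesgue. W0 z\<bar> \<le> c"
        unfolding W0_def by (rule le[OF S T])
      moreover have "\<bar>LINT z:S \<times> T|lebesgue. grid k Delta z\<bar> \<le> t"
        using grid_integral_abs_le[OF k S T, of Delta] Delta_le by linarith
      moreover have "\<bar>LINT z:S \<times> T|lebesgue. E z\<bar> \<le> \<eta>" by (rule E_le[OF S(2) T(2) E])
      ultimately show ?thesis by linarith
    next
      case False
      then have "(LINT z:S \<times> T|lebesgue. W z) = 0"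
        by (simp add: set_lebesgue_integral_def set_integrable_def not_integrable_integral_eq)
      then show ?thesis using c0 t(1) d(4) by simp
    qed
    then show "(case P of (S, T) \<Rightarrow> \<bar>LINT z:S \<times> T|lebesgue. W z\<bar>) \<le> c + t + \<eta>" by (simp add: ST)
  qed auto
  moreover have "cut_dist (sample k U X) U \<le> cut_norm W"
    unfolding W_def using cut_dist_le[OF cell_perm_mp_bijection[OF N p]] .
  ultimately show ?thesis by linarith
qed

text \<open>Two events are excluded: \<open>B1\<close>, that the total of \<open>d\<close> over
  pairs of distinct sample points reaches \<open>t * (real k)\<^sup>2\<close>, which Markov's
  inequality bounds by \<open>\<eta> / t\<close>; and \<open>B2\<close>, that the step indices fall
  into \<open>Bad\<close>, whose probability is a proportion.\<close>

lemma prob_cut_dist_sample_ge: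
  fixes U :: "real \<times> real \<Rightarrow> real"
  assumes k: "k \<ge> 1" and n: "n \<ge> 1"
    and U: "(\<lambda>z. indicator unit_square z * U z) \<in> borel_measurable lebesgue"
    and eta: "L1_dist U (grid n A) \<le> ennreal \<eta>" "\<eta> \<ge> 0"
    and t: "t > 0"
    and Bad: "Bad \<subseteq> PiE {..<k} (\<lambda>_. {..<n})"
    and close: "\<And>x. x \<in> PiE {..<k} (\<lambda>_. {..<n}) - Bad \<Longrightarrow> cut_close k n A x c"
  shows "measure (uniform_vector k) {X \<in> space (uniform_vector k). cut_dist (sample k U X) U \<le> c + t + \<eta>}
    \<ge> 1 - \<eta> / t - real (card Bad) / real n ^ k"
proof -
  let ?P = "PiM {..<k} (\<lambda>_. unif)" and ?Q = "uniform_vector k"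
  have Q: "?Q = completion ?P" by (rule uniform_vector_def)
  interpret Q: prob_space ?Q by (rule prob_space_uniform_vector)
  have gm: "grid n A \<in> borel_measurable lebesgue" by (intro measurable_completion) simp
  have "(\<lambda>z. indicator unit_square z * (U z - grid n A z)) \<in> borel_measurable lebesgue"
  proof -
    have "(\<lambda>z. indicator unit_square z * U z - indicator unit_square z * grid n A z) \<in> borel_measurable lebesgue"
      by (intro borel_measurable_diff U borel_measurable_times borel_measurable_indicator gm unit_square_sets)
    then show ?thesis by (simp add: algebra_simps)
  qed
  then obtain d where d: "d \<in> borel_measurable borel"
    "\<And>z. z \<in> unit_square \<Longrightarrow> ennreal \<bar>U z - grid n A z\<bar> \<le> d z"
    "(\<integral>\<^sup>+z\<in>unit_square. d z \<partial>lborel) = L1_dist U (grid n A)"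
    by (rule borel_majorant) blast
  have d3: "(\<integral>\<^sup>+z\<in>unit_square. d z \<partial>lborel) \<le> ennreal \<eta>" unfolding d(3) by (rule eta(1))
  define s where "s X = (\<Sum>i<k. \<Sum>j<k. if i = j then 0 else d (X i, X j))" for X :: "nat \<Rightarrow> real"
  have dm: "(\<lambda>X. if i = j then 0 else d (X i, X j)) \<in> borel_measurable ?P" if "i < k" "j < k" for i j
  proof -
    have "(\<lambda>X. (X i, X j)) \<in> ?P \<rightarrow>\<^sub>M borel"
      unfolding borel_prod[symmetric] using that by (intro measurable_Pair) (auto cong: measurable_cong_sets)
    then have "(\<lambda>X. d (X i, X j)) \<in> borel_measurable ?P" using d(1) by (rule measurable_compose)
    then show ?thesis by simp
  qed
  have sm: "s \<in> borel_measurable ?P"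
    unfolding s_def using dm by (intro borel_measurable_sum) auto
  have s_int: "(\<integral>\<^sup>+X. s X \<partial>?P) \<le> ennreal ((real k)\<^sup>2 * \<eta>)"
  proof -
    have "(\<integral>\<^sup>+X. s X \<partial>?P) = (\<Sum>i<k. \<Sum>j<k. \<integral>\<^sup>+X. (if i = j then 0 else d (X i, X j)) \<partial>?P)"
    proof -
      have "(\<integral>\<^sup>+X. s X \<partial>?P) = (\<Sum>i<k. \<integral>\<^sup>+X. (\<Sum>j<k. if i = j then 0 else d (X i, X j)) \<partial>?P)"
        unfolding s_def using dm by (intro nn_integral_sum borel_measurable_sum) auto
      also have "\<dots> = (\<Sum>i<k. \<Sum>j<k. \<integral>\<^sup>+X. (if i = j then 0 else d (X i, X j)) \<partial>?P)"
        using dm by (intro sum.cong refl nn_integral_sum) auto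
      finally show ?thesis .
    qed
    also have "\<dots> \<le> (\<Sum>i<k. \<Sum>j<k. ennreal \<eta>)"
    proof (intro sum_mono)
      fix i j assume ij: "i \<in> {..<k}" "j \<in> {..<k}"
      show "(\<integral>\<^sup>+X. (if i = j then 0 else d (X i, X j)) \<partial>?P) \<le> ennreal \<eta>"
      proof (cases "i = j")
        case False
        then show ?thesis using nn_integral_PiM_unif_pair[of i k j d] ij d(1) d3 by simp
      qed simp
    qed
    also have "\<dots> = ennreal ((real k)\<^sup>2 * \<eta>)"
      using eta(2) by (simp add: ennreal_of_nat_eq_real_of_nat ennreal_mult[symmetric] power2_eq_square mult_ac)
    finally show ?thesis .
  qed
  define B1 where "B1 = {X \<in> space ?P. 1 \<le> ennreal (1 / (t * (real k)\<^sup>2)) * s X}"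
  define B2 where "B2 = {X \<in> space ?P. (\<lambda>i\<in>{..<k}. step_index n (X i)) \<in> Bad}"
  have B1s: "B1 \<in> sets ?P" unfolding B1_def using sm by measurable
  have B1: "emeasure ?P B1 \<le> ennreal (\<eta> / t)"
  proof -
    have "emeasure ?P B1 \<le> ennreal (1 / (t * (real k)\<^sup>2)) * (\<integral>\<^sup>+X. s X \<partial>?P)"
    proof -
      have "(\<integral>\<^sup>+X\<in>space ?P. s X \<partial>?P) = (\<integral>\<^sup>+X. s X \<partial>?P)" by (intro nn_integral_cong) simp
      moreover have "(\<lambda>X. s X * indicator (space ?P) X) \<in> borel_measurable ?P"
        using sm by (intro borel_measurable_times_ennreal borel_measurable_indicator) auto
      ultimately show ?thesis
        using nn_integral_Markov_inequality[of s "space ?P" ?P "ennreal (1 / (t * (real k)\<^sup>2))"]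
        by (simp add: B1_def)
    qed
    also have "\<dots> \<le> ennreal (1 / (t * (real k)\<^sup>2)) * ennreal ((real k)\<^sup>2 * \<eta>)"
      by (intro mult_left_mono s_int) simp
    also have "\<dots> = ennreal (\<eta> / t)" using t k eta(2) by (subst ennreal_mult[symmetric]) (auto simp: field_simps)
    finally show ?thesis .
  qed
  have B2s: "B2 \<in> sets ?P" and B2: "emeasure ?P B2 = ennreal (real (card Bad) / real n ^ k)"
    unfolding B2_def by (rule emeasure_PiM_unif_steps[OF n Bad])+
  let ?G = "{X \<in> space ?Q. cut_dist (sample k U X) U \<le> c + t + \<eta>}"
  have Gs: "?G \<in> sets ?Q"
    using measurable_cut_dist_sample[OF k U] by measurable
  have "emeasure ?Q (space ?Q - ?G) \<le> emeasure ?Q (B1 \<union> B2)"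
  proof (rule emeasure_mono_AE)
    have "AE X in ?Q. \<forall>i<k. X i \<in> unit_interval" unfolding Q by (rule AE_completion[OF AE_PiM_unif_range])
    then show "AE X in ?Q. X \<in> space ?Q - ?G \<longrightarrow> X \<in> B1 \<union> B2"
    proof eventually_elim
      case (elim X)
      show ?case
      proof (rule impI, rule ccontr)
        assume X: "X \<in> space ?Q - ?G" and nB: "X \<notin> B1 \<union> B2"
        have XP: "X \<in> space ?P" using X by (simp add: Q)
        have "\<not> 1 \<le> ennreal (1 / (t * (real k)\<^sup>2)) * s X" using nB XP by (simp add: B1_def)
        then have "ennreal (1 / (t * (real k)\<^sup>2)) * s X \<le> 1" by simp
        then have "ennreal (t * (real k)\<^sup>2) * (ennreal (1 / (t * (real k)\<^sup>2)) * s X) \<le> ennreal (t * (real k)\<^sup>2) * 1"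
          by (rule mult_left_mono) simp
        moreover have "ennreal (t * (real k)\<^sup>2) * (ennreal (1 / (t * (real k)\<^sup>2)) * s X) = s X"
          using t k by (simp add: mult.assoc[symmetric] ennreal_mult[symmetric])
        ultimately have sX: "s X \<le> ennreal (t * (real k)\<^sup>2)" by simp
        let ?x = "\<lambda>i\<in>{..<k}. step_index n (X i)"
        have "?x \<in> PiE {..<k} (\<lambda>_. {..<n})" using step_index_less[OF n] by auto
        moreover have "?x \<notin> Bad" using nB XP by (simp add: B2_def)
        ultimately have cl: "cut_close k n A ?x c" by (intro close) simp
        have "cut_dist (sample k U X) U \<le> c + t + \<eta>"
          using elim t sX[unfolded s_def]
          by (intro cut_dist_sample_le[OF k n cl _ d(1,2) d3 eta(2)]) auto
        then show False using X by simp
      qed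
    qed
  qed (use B1s B2s Q in auto)
  also have "\<dots> = emeasure ?P (B1 \<union> B2)" using B1s B2s unfolding Q by (intro emeasure_completion[THEN trans] arg_cong[of _ _ "emeasure ?P"]) auto
  also have "\<dots> \<le> emeasure ?P B1 + emeasure ?P B2" by (rule emeasure_subadditive[OF B1s B2s])
  also have "\<dots> \<le> ennreal (\<eta> / t) + ennreal (real (card Bad) / real n ^ k)"
    unfolding B2 by (intro add_right_mono B1)
  also have "\<dots> = ennreal (\<eta> / t + real (card Bad) / real n ^ k)"
    using eta(2) t by (intro ennreal_plus[symmetric]) auto
  finally have "measure ?Q (space ?Q - ?G) \<le> \<eta> / t + real (card Bad) / real n ^ k"
    using eta(2) t by (simp add: measure_def enn2real_leI)
  moreover have "measure ?Q (space ?Q - ?G) = 1 - measure ?Q ?G" by (rule Q.prob_compl[OF Gs])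
  ultimately show ?thesis by linarith
qed

section \<open>Concentration and asymptotics\<close>

text \<open>Cauchy-Schwarz in the form of \<open>avg_squared_le\<close>; it bounds the entries of
  the structured part of the decomposition.\<close>

lemma sum_abs_le_sqrt:
  assumes "(\<Sum>l<m. (c l)\<^sup>2) \<le> beta"
  shows "(\<Sum>l<m. \<bar>c l\<bar>) \<le> sqrt (real m * beta)"
proof (cases "m = 0")
  case False
  have "(avg {..<m} (\<lambda>l. \<bar>c l\<bar>))\<^sup>2 \<le> avg {..<m} (\<lambda>l. \<bar>c l\<bar>\<^sup>2)" by (rule avg_squared_le) simp
  then have "(\<Sum>l<m. \<bar>c l\<bar>)\<^sup>2 \<le> real m * (\<Sum>l<m. (c l)\<^sup>2)"
    using False by (simp add: avg_def power_divide power2_eq_square field_simps)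
  also have "\<dots> \<le> real m * beta" using assms by (intro mult_left_mono) auto
  finally show ?thesis by (rule real_le_rsqrt)
qed simp

text \<open>One sample point affects one row and one column, at most \<open>2 * k\<close> entries,
  each by at most \<open>2 * r\<close>.\<close>

lemma dcut_sample_update_le:
  assumes k: "k \<ge> 1" and R: "\<And>a b. \<bar>R a b\<bar> \<le> r"
  shows "dcut k (\<lambda>i j. if i = j then 0 else R ((x(l := a)) i) ((x(l := a)) j))
    \<le> dcut k (offdiag R x) + 4 * r / real k"
proof -
  let ?D = "\<lambda>x i j. if i = j then 0 else R (x i) (x j)"
  have r0: "r \<ge> 0" using R[of undefined undefined] by linarith
  have one: "(\<Sum>i<k. of_bool (i = l) :: real) \<le> 1"
    by (simp add: of_bool_def)
  have "(\<Sum>i<k. \<Sum>j<k. \<bar>?D (x(l := a)) i j - ?D x i j\<bar>)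
    \<le> (\<Sum>i<k. \<Sum>j<k. 2 * r * (of_bool (i = l) + of_bool (j = l)))"
  proof (intro sum_mono)
    fix i j
    have "\<bar>?D (x(l := a)) i j - ?D x i j\<bar> \<le> 2 * r"
      using R[of "(x(l := a)) i" "(x(l := a)) j"] R[of "x i" "x j"] r0 by auto
    then show "\<bar>?D (x(l := a)) i j - ?D x i j\<bar> \<le> 2 * r * (of_bool (i = l) + of_bool (j = l))"
      using r0 by (cases "i = l"; cases "j = l") auto
  qed
  also have "\<dots> = 2 * r * (2 * real k * (\<Sum>i<k. of_bool (i = l)))"
    by (simp add: sum_distrib_left[symmetric] sum.distrib)
  also have "\<dots> \<le> 2 * r * (2 * real k * 1)"
    using one r0 by (intro mult_left_mono) auto
  finally have "(\<Sum>i<k. \<Sum>j<k. \<bar>?D (x(l := a)) i j - ?D x i j\<bar>) / (real k)\<^sup>2 \<le> 4 * r / real k"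
    using k by (simp add: field_simps power2_eq_square)
  then show ?thesis using dcut_diff_le[OF k, of "?D (x(l := a))" "?D x"] by linarith
qed

text \<open>Moving one point changes at most two counts, each by 1, so the number of types does not
  enter.\<close>

lemma type_deviation_update_le:
  assumes k: "k \<ge> 1" and Ty: "finite Ty"
  shows "(\<Sum>t\<in>Ty. \<bar>real (card {i. i < k \<and> \<tau> ((x(l := a)) i) = t}) / real k - lam t\<bar>)
    \<le> (\<Sum>t\<in>Ty. \<bar>real (card {i. i < k \<and> \<tau> (x i) = t}) / real k - lam t\<bar>) + 2 / real k"
proof -
  let ?c = "\<lambda>x t. real (card {i. i < k \<and> \<tau> (x i) = t})"
  have cs: "?c x t = (\<Sum>i<k. of_bool (\<tau> (x i) = t))" for x t
    by (simp add: sum_of_bool_eq lessThan_def Int_def)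
  have step: "\<bar>?c (x(l := a)) t - ?c x t\<bar> \<le> of_bool (\<tau> a = t) + of_bool (\<tau> (x l) = t)" for t
  proof -
    let ?b = "of_bool (\<tau> a = t) + of_bool (\<tau> (x l) = t) :: real"
    have "\<bar>?c (x(l := a)) t - ?c x t\<bar> \<le> (\<Sum>i<k. \<bar>of_bool (\<tau> ((x(l := a)) i) = t) - of_bool (\<tau> (x i) = t)\<bar>)"
      unfolding cs sum_subtractf[symmetric] by (rule sum_abs)
    also have "\<dots> \<le> (\<Sum>i<k. if i = l then ?b else 0)" by (intro sum_mono) auto
    also have "\<dots> \<le> ?b" by simp
    finally show ?thesis .
  qed
  have "(\<Sum>t\<in>Ty. \<bar>?c (x(l := a)) t / real k - lam t\<bar>)
    \<le> (\<Sum>t\<in>Ty. \<bar>?c x t / real k - lam t\<bar> + (of_bool (\<tau> a = t) + of_bool (\<tau> (x l) = t)) / real k)"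
  proof (rule sum_mono)
    fix t
    have "?c (x(l := a)) t / real k - lam t = (?c x t / real k - lam t) + (?c (x(l := a)) t - ?c x t) / real k"
      by (simp add: diff_divide_distrib)
    moreover have "\<bar>(?c (x(l := a)) t - ?c x t) / real k\<bar> \<le> (of_bool (\<tau> a = t) + of_bool (\<tau> (x l) = t)) / real k"
      unfolding abs_divide using step[of t] by (simp add: divide_right_mono)
    ultimately show "\<bar>?c (x(l := a)) t / real k - lam t\<bar>
        \<le> \<bar>?c x t / real k - lam t\<bar> + (of_bool (\<tau> a = t) + of_bool (\<tau> (x l) = t)) / real k"
      by linarith
  qed
  also have "\<dots> = (\<Sum>t\<in>Ty. \<bar>?c x t / real k - lam t\<bar>)
      + ((\<Sum>t\<in>Ty. of_bool (\<tau> a = t)) + (\<Sum>t\<in>Ty. of_bool (\<tau> (x l) = t))) / real k"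
    by (simp add: sum.distrib sum_divide_distrib[symmetric])
  also have "\<dots> \<le> (\<Sum>t\<in>Ty. \<bar>?c x t / real k - lam t\<bar>) + (1 + 1) / real k"
    using Ty by (intro add_left_mono divide_right_mono add_mono) (auto simp: of_bool_def)
  finally show ?thesis by simp
qed

text \<open>Concentration is applied to the explicit bound \<open>H\<close> from
  \<open>sample_cut_close\<close>, as a function of the index vector, and not to the cut distance
  itself: the mean of \<open>H\<close> is a sum of averages estimated before, and its increments can
  be read off from \<open>dcut\<close> and the type counts.\<close>

lemma grid_sample_concentration:
  fixes A :: "nat \<Rightarrow> nat \<Rightarrow> real"
  assumes k: "k \<ge> 1" and n: "n \<ge> 1" and m: "m \<ge> 1" and M: "M > 0" "\<And>a b. \<bar>A a b\<bar> \<le> M"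
    and beta: "avg {..<n} (\<lambda>a. avg {..<n} (\<lambda>b. (A a b)\<^sup>2)) \<le> beta" and s: "s \<ge> 0"
  defines "q \<equiv> sqrt (real m * beta)"
  obtains Bad where "Bad \<subseteq> PiE {..<k} (\<lambda>_. {..<n})"
    "real (card Bad) / real n ^ k \<le> exp (- (s\<^sup>2 * real k / (2 * (4 * M + 12 * q)\<^sup>2)))"
    "\<And>x. x \<in> PiE {..<k} (\<lambda>_. {..<n}) - Bad \<Longrightarrow> cut_close k n A x
      (9 * sqrt (beta / real m) + 32 * sqrt (beta / real k) + 2 * q * (2 * 4 ^ m / sqrt (real k) + 1 / real k) + s)"
proof -
  let ?Z = "{..<n}" and ?P = "PiE {..<k} (\<lambda>_. {..<n})"
  have Z: "finite ?Z" "?Z \<noteq> {}" using n by (auto simp: lessThan_empty_iff)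
  obtain c S T R where R: "\<And>a b. R a b = A a b - (\<Sum>l<m. c l * of_bool (a \<in> S l \<and> b \<in> T l))"
    and cut: "\<And>S T. S \<subseteq> ?Z \<Longrightarrow> T \<subseteq> ?Z \<Longrightarrow> \<bar>\<Sum>a\<in>S. \<Sum>b\<in>T. R a b\<bar> \<le> sqrt (beta / real m) * (real (card ?Z))\<^sup>2"
    and R2: "avg ?Z (\<lambda>a. avg ?Z (\<lambda>b. (R a b)\<^sup>2)) \<le> beta"
    and c: "(\<Sum>l<m. (c l)\<^sup>2) \<le> beta"
    by (rule cut_decomposition[OF Z beta m]) blast
  \<comment> \<open>A type records which of the \<open>m\<close> sets \<open>S l\<close> and which
    of the sets \<open>T l\<close> contain a point; it takes \<open>2 ^ m * 2 ^ m\<close> values and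
    determines the structured part \<open>Q\<close>.\<close>
  define Ty where "Ty = Pow {..<m} \<times> Pow {..<m}"
  define \<tau> where "\<tau> a = ({l. l < m \<and> a \<in> S l}, {l. l < m \<and> a \<in> T l})" for a
  define Q where "Q t u = (\<Sum>l<m. c l * of_bool (l \<in> fst t \<and> l \<in> snd u))" for t u :: "nat set \<times> nat set"
  define rho where "rho = sqrt (beta / real m)"
  have Q_le: "\<bar>Q t u\<bar> \<le> q" for t u
  proof -
    have "\<bar>Q t u\<bar> \<le> (\<Sum>l<m. \<bar>c l * of_bool (l \<in> fst t \<and> l \<in> snd u)\<bar>)" unfolding Q_def by (rule sum_abs)
    also have "\<dots> \<le> (\<Sum>l<m. \<bar>c l\<bar>)" by (intro sum_mono) auto
    also have "\<dots> \<le> q" unfolding q_def by (rule sum_abs_le_sqrt[OF c])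
    finally show ?thesis .
  qed
  have q0: "q \<ge> 0" using Q_le[of undefined undefined] by linarith
  have AQ: "A a b = R a b + Q (\<tau> a) (\<tau> b)" for a b
  proof -
    have "Q (\<tau> a) (\<tau> b) = (\<Sum>l<m. c l * of_bool (a \<in> S l \<and> b \<in> T l))"
      unfolding Q_def \<tau>_def by (intro sum.cong) auto
    then show ?thesis by (simp add: R)
  qed
  have R_le: "\<bar>R a b\<bar> \<le> M + q" for a b
    using M(2)[of a b] Q_le[of "\<tau> a" "\<tau> b"] AQ[of a b] by linarith
  have Ty: "finite Ty" "\<tau> ` ?Z \<subseteq> Ty" "card Ty = 4 ^ m"
    by (auto simp: Ty_def \<tau>_def card_cartesian_product card_Pow power_mult_distrib[symmetric])
  have nR: "dcut n R \<le> rho"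
    using cut by (intro dcut_le[OF n]) (simp add: rho_def)
  define mis where "mis x = (\<Sum>t\<in>Ty. \<bar>real (card {i. i < k \<and> \<tau> (x i) = t}) / real k
    - real (card {a\<in>?Z. \<tau> a = t}) / real n\<bar>)" for x
  define Rx where "Rx x = offdiag R x" for x :: "nat \<Rightarrow> nat"
  define H where "H x = dcut k (Rx x) + dcut n R + 2 * q * (2 * mis x + 1 / real k)" for x
  have fin: "finite ?P" "?P \<noteq> {}" using n by (auto simp: finite_PiE PiE_eq_empty_iff lessThan_empty_iff)
  \<comment> \<open>The 9 is 8 from the expected cut norm of the sampled remainder plus 1 from the
    remainder itself.\<close>
  define c0 where "c0 = 9 * rho + 32 * sqrt (beta / real k) + 2 * q * (2 * 4 ^ m / sqrt (real k) + 1 / real k)"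
  have avgH: "avg ?P H \<le> c0"
  proof -
    have "avg ?P (\<lambda>x. dcut k (Rx x)) \<le> 8 * rho + 32 * sqrt (beta / real k)"
      unfolding Rx_def by (intro avg_dcut_sample_le k Z R2) (use cut in \<open>simp add: rho_def\<close>)
    moreover have "avg ?P mis \<le> real (card Ty) / sqrt (real k)"
      using avg_type_deviation_le[OF k Z, where Ty = Ty and \<tau> = \<tau>] unfolding mis_def by simp
    then have "2 * q * (2 * avg ?P mis + 1 / real k) \<le> 2 * q * (2 * (4 ^ m / sqrt (real k)) + 1 / real k)"
      using q0 by (intro mult_left_mono add_right_mono) (auto simp: Ty(3))
    moreover have "avg ?P H = avg ?P (\<lambda>x. dcut k (Rx x)) + dcut n R + 2 * q * (2 * avg ?P mis + 1 / real k)"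
      unfolding H_def by (simp only: avg_add avg_cmult avg_const[OF fin])
    ultimately show ?thesis using nR unfolding c0_def by simp
  qed
  \<comment> \<open>For each point \<open>4 * (M + q)\<close> comes from the sampled remainder,
    whose entries are at most \<open>M + q\<close>, and \<open>2 * q * 2 * 2 = 8 * q\<close> from
    the type counts.\<close>
  have H_up: "H (x(l := a)) \<le> H x + (4 * M + 12 * q) / real k" for x l a
  proof -
    have 1: "dcut k (Rx (x(l := a))) \<le> dcut k (Rx x) + 4 * (M + q) / real k"
      unfolding Rx_def by (rule dcut_sample_update_le[OF k R_le])
    have 2: "mis (x(l := a)) \<le> mis x + 2 / real k"
      unfolding mis_def by (rule type_deviation_update_le[OF k Ty(1)])
    have "2 * q * (2 * mis (x(l := a)) + 1 / real k) \<le> 2 * q * (2 * (mis x + 2 / real k) + 1 / real k)"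
      using 2 q0 by (intro mult_left_mono) auto
    also have "\<dots> = 2 * q * (2 * mis x + 1 / real k) + 8 * q / real k"
      by (simp add: algebra_simps)
    finally have 3: "2 * q * (2 * mis (x(l := a)) + 1 / real k) \<le> \<dots>" .
    have "4 * (M + q) / real k + 8 * q / real k = (4 * M + 12 * q) / real k"
      by (simp add: add_divide_distrib[symmetric])
    then show ?thesis using 1 3 unfolding H_def by linarith
  qed
  have H_lip: "\<bar>H (x(l := a)) - H x\<bar> \<le> (4 * M + 12 * q) / real k" for x l a
    using H_up[of x l a] H_up[of "x(l := a)" l "x l"] by (simp add: abs_le_iff)
  define Bad where "Bad = {x \<in> ?P. H x \<ge> avg ?P H + s}"
  show ?thesis
  proof (rule that[of Bad])
    show "Bad \<subseteq> ?P" by (auto simp: Bad_def)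
    have "real (card Bad) / real (card ?Z ^ card {..<k})
      \<le> exp (- (s\<^sup>2 / (2 * real (card {..<k}) * ((4 * M + 12 * q) / real k)\<^sup>2)))"
      unfolding Bad_def using k n s M q0 H_lip
      by (intro bounded_differences_tail) (auto simp: lessThan_empty_iff simp del: fun_upd_apply)
    also have "s\<^sup>2 / (2 * real (card {..<k}) * ((4 * M + 12 * q) / real k)\<^sup>2)
      = s\<^sup>2 * real k / (2 * (4 * M + 12 * q)\<^sup>2)"
      using k by (simp add: power_divide power2_eq_square)
    finally show "real (card Bad) / real n ^ k \<le> exp (- (s\<^sup>2 * real k / (2 * (4 * M + 12 * q)\<^sup>2)))"
      by simp
    fix x assume x: "x \<in> ?P - Bad"
    then have "\<not> avg ?P H + s \<le> H x" by (simp add: Bad_def)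
    then have Hx: "H x \<le> c0 + s" using avgH by linarith
    have xn: "x i < n" if "i < k" for i using PiE_mem[of x "{..<k}" "\<lambda>_. {..<n}" i] x that by simp
    have "cut_close k n A x (H x)"
      using sample_cut_close[where A = A and R = R and Q = Q and \<tau> = \<tau> and x = x, OF k n xn AQ Q_le Ty(1,2)]
      unfolding H_def Rx_def mis_def .
    then show "cut_close k n A x (9 * sqrt (beta / real m) + 32 * sqrt (beta / real k)
        + 2 * q * (2 * 4 ^ m / sqrt (real k) + 1 / real k) + s)"
      unfolding c0_def[unfolded rho_def, symmetric] using Hx by (rule cut_close_mono)
  qed
qed

text \<open>The step function and its size \<open>n\<close> are gone; what is left are the free
  parameters \<open>m\<close>, \<open>M\<close>, \<open>s\<close> and \<open>t\<close>, to be
  balanced against \<open>k\<close>.\<close>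

lemma sample_probability:
  assumes U: "U \<in> Lp_sym p" and p: "p > 2" and k: "k \<ge> 1" and m: "m \<ge> 1" and M: "M > 0"
    and s: "s \<ge> 0" and t: "t > 0"
  defines "J \<equiv> Lp_norm p U powr p"
  defines "beta \<equiv> J + 2"
  defines "q \<equiv> sqrt (real m * beta)" and "\<eta> \<equiv> (J + 1) * M powr (1 - p)"
  shows "measure (uniform_vector k) {X \<in> space (uniform_vector k). cut_dist (sample k U X) U \<le>
      (9 * sqrt (beta / real m) + 32 * sqrt (beta / real k) + 2 * q * (2 * 4 ^ m / sqrt (real k) + 1 / real k) + s)
      + t + \<eta>}
    \<ge> 1 - \<eta> / t - exp (- (s\<^sup>2 * real k / (2 * (4 * M + 12 * q)\<^sup>2)))"
proof -
  obtain n A where nA: "n \<ge> 1" "\<And>a b. \<bar>A a b\<bar> \<le> M"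
    "L1_dist U (grid n A) \<le> ennreal \<eta>"
    "avg {..<n} (\<lambda>a. avg {..<n} (\<lambda>b. (A a b)\<^sup>2)) \<le> beta"
    using Lp_grid_approximation[OF U p M] unfolding J_def[symmetric] \<eta>_def[symmetric] beta_def[symmetric] by blast
  obtain Bad where Bad: "Bad \<subseteq> PiE {..<k} (\<lambda>_. {..<n})"
    "real (card Bad) / real n ^ k \<le> exp (- (s\<^sup>2 * real k / (2 * (4 * M + 12 * q)\<^sup>2)))"
    "\<And>x. x \<in> PiE {..<k} (\<lambda>_. {..<n}) - Bad \<Longrightarrow> cut_close k n A x
      (9 * sqrt (beta / real m) + 32 * sqrt (beta / real k) + 2 * q * (2 * 4 ^ m / sqrt (real k) + 1 / real k) + s)"
    using grid_sample_concentration[OF k nA(1) m M nA(2,4) s] unfolding q_def[symmetric] by blast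
  have eta0: "\<eta> \<ge> 0" by (simp add: \<eta>_def J_def)
  from prob_cut_dist_sample_ge[OF k nA(1) Lp_sym_measurable[OF U] nA(3) eta0 t Bad(1,3)]
  show ?thesis using Bad(2) by linarith
qed

text \<open>Meant for the finitely many small \<open>k\<close>. The approximating step function is
  0, so there is nothing to match and only Markov's inequality remains;
  \<open>|u| \<le> |u| powr p + 1\<close> bounds the L1 norm by \<open>J + 1\<close>.\<close>

lemma sample_probability_crude:
  assumes U: "U \<in> Lp_sym p" and p: "p > 2" and k: "k \<ge> 1" and t: "t > 0"
  defines "J \<equiv> Lp_norm p U powr p"
  shows "measure (uniform_vector k) {X \<in> space (uniform_vector k). cut_dist (sample k U X) U \<le> t + (J + 1)}
    \<ge> 1 - (J + 1) / t"
proof -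
  let ?L = "lebesgue :: (real \<times> real) measure"
  note pm = Lp_sym_powr_measurable[OF U]
  have "L1_dist U (grid 1 (\<lambda>_ _. 0))
    \<le> (\<integral>\<^sup>+z. ennreal (\<bar>U z\<bar> powr p) * indicator unit_square z + indicator unit_square z \<partial>?L)"
  proof (rule nn_integral_mono)
    fix z :: "real \<times> real"
    have "\<bar>U z\<bar> \<le> \<bar>U z\<bar> powr p + 1"
    proof (cases "\<bar>U z\<bar> \<le> 1")
      case False
      then have "\<bar>U z\<bar> powr 1 \<le> \<bar>U z\<bar> powr p" using p by (intro powr_mono) auto
      then show ?thesis using False by simp
    next
      case True
      then show ?thesis using powr_ge_zero[of "\<bar>U z\<bar>" p] by linarith
    qed
    then have "ennreal \<bar>U z\<bar> \<le> ennreal (\<bar>U z\<bar> powr p) + 1"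
      by (simp add: ennreal_plus[symmetric] ennreal_1[symmetric] ennreal_leI del: ennreal_plus ennreal_1)
    then show "ennreal \<bar>U z - grid 1 (\<lambda>_ _. 0) z\<bar> * indicator unit_square z
        \<le> ennreal (\<bar>U z\<bar> powr p) * indicator unit_square z + indicator unit_square z"
      by (simp add: grid_def case_prod_unfold indicator_def)
  qed
  also have "\<dots> = ennreal J + 1"
  proof (subst nn_integral_add[OF pm])
    show "indicator unit_square \<in> borel_measurable ?L" by (rule borel_measurable_indicator[OF unit_square_sets])
  qed (use Lp_norm_powr[OF U] p in \<open>simp add: J_def emeasure_unit_square\<close>)
  also have "\<dots> = ennreal (J + 1)" by (simp add: J_def)
  finally have eta: "L1_dist U (grid 1 (\<lambda>_ _. 0)) \<le> ennreal (J + 1)" .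
  have "bij_betw id {..<k * 1} {..<k * 1}" by simp
  then have close: "cut_close k 1 (\<lambda>_ _. 0) x 0" for x
    unfolding cut_close_def by (intro exI[of _ id] conjI) (auto simp: grid_def case_prod_unfold)
  have "J + 1 \<ge> 0" by (simp add: J_def)
  from prob_cut_dist_sample_ge[OF k order_refl Lp_sym_measurable[OF U] eta this t, of "{}" 0]
  show ?thesis using close by simp
qed

text \<open>The four facts take care, in turn, of the errors below the leading order, of the failure
  probability in Markov's inequality, of that in the concentration bound, and of the structured part
  \<open>q\<close> against \<open>M\<close>. The 512 is \<open>2 * 16\<^sup>2\<close>, from
  \<open>4 * M + 12 * q \<le> 16 * M\<close>.\<close>

lemma rate_asymptotics:
  fixes B K a d :: real
  assumes "B > 0" "K > 0" "a > 0" "d > 0" "b > 0"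
  shows "\<forall>\<^sub>F k in sequentially.
      32 * (B / sqrt (real k)) + 2 * (B * sqrt (ln (real k))) * (2 * real k powr (- 1 / 4) + 1 / real k)
        + K * real k powr (- a) \<le> 1 / sqrt (ln (real k))"
    and "\<forall>\<^sub>F k in sequentially. K * real k powr (- a - b) * sqrt (ln (real k)) \<le> real k powr (- b)"
    and "\<forall>\<^sub>F k in sequentially. exp (- (real k powr d / (512 * ln (real k)))) \<le> real k powr (- b)"
    and "\<forall>\<^sub>F k in sequentially. B * sqrt (ln (real k)) \<le> real k powr d"
proof -
  show "\<forall>\<^sub>F k in sequentially.
      32 * (B / sqrt (real k)) + 2 * (B * sqrt (ln (real k))) * (2 * real k powr (- 1 / 4) + 1 / real k)
        + K * real k powr (- a) \<le> 1 / sqrt (ln (real k))"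
  proof -
    have "\<forall>\<^sub>F k in sequentially. 32 * (B / sqrt (real k)) \<le> 1 / 3 * (1 / sqrt (ln (real k)))"
      using assms by real_asymp
    moreover have "\<forall>\<^sub>F k in sequentially.
        2 * (B * sqrt (ln (real k))) * (2 * real k powr (- 1 / 4) + 1 / real k) \<le> 1 / 3 * (1 / sqrt (ln (real k)))"
      using assms by real_asymp
    moreover have "\<forall>\<^sub>F k in sequentially. K * real k powr (- a) \<le> 1 / 3 * (1 / sqrt (ln (real k)))"
      using assms by real_asymp
    ultimately show ?thesis by eventually_elim linarith
  qed
  show "\<forall>\<^sub>F k in sequentially. K * real k powr (- a - b) * sqrt (ln (real k)) \<le> real k powr (- b)"
    using assms by real_asymp
  show "\<forall>\<^sub>F k in sequentially. exp (- (real k powr d / (512 * ln (real k)))) \<le> real k powr (- b)"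
    using assms by real_asymp
  show "\<forall>\<^sub>F k in sequentially. B * sqrt (ln (real k)) \<le> real k powr d"
    using assms by real_asymp
qed

text \<open>The bounds of \<open>sample_probability\<close> depend on \<open>U\<close> only through
  \<open>J\<close>, so one \<open>k0\<close> serves all such \<open>U\<close>; this makes the
  constant uniform. The proof gives the order \<open>1 / sqrt (ln k)\<close>, of which the stated
  power of \<open>ln k\<close> is a weakening.\<close>

lemma sample_probability_large:
  assumes p: "p > 2" and phi: "0 < \<phi>" "\<phi> < 1/2 - 1/p" and J: "J \<ge> 0"
  obtains k0 where "k0 \<ge> 3" "\<And>k U. k \<ge> k0 \<Longrightarrow> U \<in> Lp_sym p \<Longrightarrow> Lp_norm p U powr p = J \<Longrightarrow>
    measure (uniform_vector k) {X \<in> space (uniform_vector k).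
      cut_dist (sample k U X) U \<le> (36 * sqrt (J + 2) + 3) / (ln (real k)) powr (1/2 - 1/(2*p))}
    \<ge> 1 - 2 * real k powr (- (\<phi> * p))"
proof -
  define B where "B = sqrt (J + 2)"
  \<comment> \<open>Any \<open>d > 0\<close> with \<open>(1/2 - d) (p - 1) > \<phi> p\<close> would do; \<open>\<phi> p < p/2 - 1\<close> leaves room.\<close>
  define d where "d = 1 / (4 * (p - 1))"
  define e where "e = (1 / 2 - d) * (p - 1)"
  have B: "B > 0" using J by (simp add: B_def)
  have d: "d > 0" "d < 1 / 4" using p by (auto simp: d_def field_simps)
  have e: "e = (p - 1) / 2 - 1 / 4" using p by (simp add: e_def d_def field_simps)
  have "\<phi> * p < (1/2 - 1/p) * p" using phi p by (intro mult_strict_right_mono) auto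
  also have "\<dots> = p / 2 - 1" using p by (simp add: field_simps)
  finally have ep: "e - \<phi> * p > 0" unfolding e by (simp add: field_simps)
  have phip: "\<phi> * p > 0" using phi p by simp
  have epos: "e > 0" using ep phip by linarith
  have "\<forall>\<^sub>F k in sequentially.
      32 * (B / sqrt (real k)) + 2 * (B * sqrt (ln (real k))) * (2 * real k powr (- 1 / 4) + 1 / real k)
        + (J + 1) * real k powr (- e) \<le> 1 / sqrt (ln (real k))
    \<and> (J + 1) * real k powr (- (e - \<phi> * p) - \<phi> * p) * sqrt (ln (real k)) \<le> real k powr (- (\<phi> * p))
    \<and> exp (- (real k powr (2 * d) / (512 * ln (real k)))) \<le> real k powr (- (\<phi> * p))
    \<and> B * sqrt (ln (real k)) \<le> real k powr (1 / 2 - d)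
    \<and> ln (real k) \<ge> 16 \<and> k \<ge> 3"
    using B J epos ep phip d
    by (intro eventually_conj rate_asymptotics eventually_ge_at_top) (auto, real_asymp)
  then obtain k0 where k0: "\<And>k. k \<ge> k0 \<Longrightarrow>
      32 * (B / sqrt (real k)) + 2 * (B * sqrt (ln (real k))) * (2 * real k powr (- 1 / 4) + 1 / real k)
        + (J + 1) * real k powr (- e) \<le> 1 / sqrt (ln (real k))
    \<and> (J + 1) * real k powr (- (e - \<phi> * p) - \<phi> * p) * sqrt (ln (real k)) \<le> real k powr (- (\<phi> * p))
    \<and> exp (- (real k powr (2 * d) / (512 * ln (real k)))) \<le> real k powr (- (\<phi> * p))
    \<and> B * sqrt (ln (real k)) \<le> real k powr (1 / 2 - d)
    \<and> ln (real k) \<ge> 16 \<and> k \<ge> 3"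
    unfolding eventually_sequentially by blast
  show ?thesis
  proof (rule that[of "max k0 3"])
    fix k U assume k: "k \<ge> max k0 3" and U: "U \<in> Lp_sym p" and JU: "Lp_norm p U powr p = J"
    define L where "L = ln (real k)"
    define M where "M = real k powr (1 / 2 - d)"
    \<comment> \<open>With \<open>ln 4 \<le> 2\<close> this gives
      \<open>4 ^ m \<le> k powr (1/4)\<close>, while \<open>m \<ge> L / 16\<close> keeps the cut
      norm of the remainder at order \<open>1 / sqrt L\<close>.\<close>
    define m where "m = nat \<lfloor>L / 8\<rfloor>"
    define q where "q = sqrt (real m * (J + 2))"
    define eta where "eta = (J + 1) * M powr (1 - p)"
    \<comment> \<open>It serves both as the deviation in the concentration bound and as the
      threshold in Markov's inequality.\<close>
    define s where "s = 1 / sqrt L"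
    have kp: "real k > 0" and k1: "k \<ge> 1" using k by auto
    have kk: "k \<ge> k0" using k by simp
    from k0[OF kk] have
      a1: "32 * (B / sqrt (real k)) + 2 * (B * sqrt L) * (2 * real k powr (- 1 / 4) + 1 / real k)
        + (J + 1) * real k powr (- e) \<le> s" and
      a2: "(J + 1) * real k powr (- (e - \<phi> * p) - \<phi> * p) * sqrt L \<le> real k powr (- (\<phi> * p))" and
      a3: "exp (- (real k powr (2 * d) / (512 * L))) \<le> real k powr (- (\<phi> * p))" and
      a4: "B * sqrt L \<le> M" and L: "L \<ge> 16"
      unfolding L_def[symmetric] M_def[symmetric] s_def[symmetric] by blast+
    have M: "M > 0" using kp by (simp add: M_def)
    have m1: "m \<ge> 1" using L by (simp add: m_def le_nat_iff le_floor_iff)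
    have m_up: "real m \<le> L / 8" using L unfolding m_def by linarith
    have m_lo: "real m \<ge> L / 16" using L unfolding m_def by linarith
    have s0: "s > 0" using L by (simp add: s_def)
    have eta_eq: "eta = (J + 1) * real k powr (- e)"
    proof -
      have "(1 / 2 - d) * (1 - p) = - e"
        unfolding e_def by (subst minus_diff_eq[symmetric, of p 1]) (simp only: mult_minus_right)
      then show ?thesis by (simp add: eta_def M_def powr_powr)
    qed
    have q_le: "q \<le> B * sqrt L"
    proof -
      have "q = sqrt (real m) * B" by (simp add: q_def B_def real_sqrt_mult)
      also have "\<dots> \<le> sqrt L * B" using m_up L B by (intro mult_right_mono real_sqrt_le_mono) auto
      finally show ?thesis by (simp add: mult.commute)
    qed
    have q0: "q \<ge> 0" using J by (simp add: q_def)
    have four: "4 ^ m / sqrt (real k) \<le> real k powr (- 1 / 4)"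
    proof -
      have "ln (4::real) \<le> 2"
        using ln_le_minus_one[of "2::real"] ln_mult[of "2::real" 2] by simp
      then have "real m * ln 4 \<le> L / 8 * 2" using m_up L by (intro mult_mono) auto
      then have "exp (real m * ln 4) \<le> exp (L / 4)" by simp
      then have "4 ^ m \<le> real k powr (1 / 4)"
        using kp by (simp add: exp_of_nat_mult powr_def L_def)
      then have "4 ^ m / sqrt (real k) \<le> real k powr (1 / 4) / real k powr (1 / 2)"
        by (simp add: powr_half_sqrt divide_right_mono)
      also have "\<dots> = real k powr (- 1 / 4)" by (simp add: powr_diff[symmetric])
      finally show ?thesis .
    qed
    \<comment> \<open>The 36 is 9 times 4, the square root of the 16 in
      \<open>m \<ge> L / 16\<close>.\<close>
    have rho: "9 * sqrt ((J + 2) / real m) \<le> 36 * B * s"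
    proof -
      have "(J + 2) / real m \<le> (J + 2) / (L / 16)"
        using J L m_lo by (intro divide_left_mono) auto
      also have "(J + 2) / (L / 16) = 16 * (J + 2) / L" by (simp add: mult.commute)
      finally have "sqrt ((J + 2) / real m) \<le> sqrt (16 * (J + 2) / L)" by (rule real_sqrt_le_mono)
      also have "\<dots> = 4 * B * s" unfolding B_def s_def real_sqrt_divide real_sqrt_mult by simp
      finally show ?thesis by simp
    qed
    \<comment> \<open>Besides the leading term there are three of size \<open>s\<close>: the
      deviation, the Markov threshold, and the lower-order terms collected in
      \<open>a1\<close>.\<close>
    have main: "(9 * sqrt ((J + 2) / real m) + 32 * sqrt ((J + 2) / real k)
        + 2 * q * (2 * 4 ^ m / sqrt (real k) + 1 / real k) + s) + s + eta \<le> (36 * B + 3) * s"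
    proof -
      have "2 * q * (2 * 4 ^ m / sqrt (real k) + 1 / real k)
        \<le> 2 * (B * sqrt L) * (2 * real k powr (- 1 / 4) + 1 / real k)"
        using q_le four q0 B L by (intro mult_mono) auto
      moreover have "sqrt ((J + 2) / real k) = B / sqrt (real k)" by (simp add: B_def real_sqrt_divide)
      ultimately show ?thesis using a1 rho unfolding eta_eq by (simp add: algebra_simps)
    qed
    also have "\<dots> \<le> (36 * B + 3) / L powr (1/2 - 1/(2*p))"
    proof -
      have "L powr (1/2 - 1/(2*p)) \<le> L powr (1/2)" using L p by (intro powr_mono) auto
      also have "\<dots> = sqrt L" using L by (simp add: powr_half_sqrt)
      finally have "s \<le> 1 / L powr (1/2 - 1/(2*p))"
        unfolding s_def using L by (intro divide_left_mono) auto
      then have "(36 * B + 3) * s \<le> (36 * B + 3) * (1 / L powr (1/2 - 1/(2*p)))"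
        using B by (intro mult_left_mono) auto
      then show ?thesis by simp
    qed
    finally have bound: "(9 * sqrt ((J + 2) / real m) + 32 * sqrt ((J + 2) / real k)
        + 2 * q * (2 * 4 ^ m / sqrt (real k) + 1 / real k) + s) + s + eta \<le> (36 * B + 3) / L powr (1/2 - 1/(2*p))" .
    have p1: "eta / s \<le> real k powr (- (\<phi> * p))"
      using a2 by (simp add: eta_eq s_def)
    have p2: "exp (- (s\<^sup>2 * real k / (2 * (4 * M + 12 * q)\<^sup>2))) \<le> real k powr (- (\<phi> * p))"
    proof -
      have "4 * M + 12 * q \<le> 16 * M" using q_le a4 by linarith
      then have "(4 * M + 12 * q)\<^sup>2 \<le> (16 * M)\<^sup>2" using q0 M by (intro power_mono) auto
      then have "s\<^sup>2 * real k / (2 * (16 * M)\<^sup>2) \<le> s\<^sup>2 * real k / (2 * (4 * M + 12 * q)\<^sup>2)"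
        using M q0 kp by (intro divide_left_mono mult_nonneg_nonneg) (auto intro!: mult_pos_pos zero_less_power add_pos_nonneg)
      moreover have "s\<^sup>2 * real k / (2 * (16 * M)\<^sup>2) = real k powr (2 * d) / (512 * L)"
      proof -
        have "M\<^sup>2 = real k powr (1 - 2 * d)"
          unfolding M_def power2_eq_square powr_add[symmetric] by simp
        then have "M\<^sup>2 * real k powr (2 * d) = real k" using kp by (simp add: powr_add[symmetric])
        moreover have "s\<^sup>2 = 1 / L" using L by (simp add: s_def power_divide)
        ultimately show ?thesis using M L by (simp add: power_mult_distrib field_simps)
      qed
      ultimately have "exp (- (s\<^sup>2 * real k / (2 * (4 * M + 12 * q)\<^sup>2))) \<le> exp (- (real k powr (2 * d) / (512 * L)))"
        by simp
      then show ?thesis using a3 by linarith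
    qed
    let ?G = "\<lambda>c. {X \<in> space (uniform_vector k). cut_dist (sample k U X) U \<le> c}"
    interpret Q: prob_space "uniform_vector k" by (rule prob_space_uniform_vector)
    have "1 - eta / s - exp (- (s\<^sup>2 * real k / (2 * (4 * M + 12 * q)\<^sup>2)))
      \<le> measure (uniform_vector k) (?G ((9 * sqrt ((J + 2) / real m) + 32 * sqrt ((J + 2) / real k)
        + 2 * q * (2 * 4 ^ m / sqrt (real k) + 1 / real k) + s) + s + eta))"
      using sample_probability[OF U p k1 m1 M less_imp_le[OF s0] s0]
      unfolding JU eta_def[symmetric] q_def[symmetric] .
    also have "\<dots> \<le> measure (uniform_vector k) (?G ((36 * B + 3) / L powr (1/2 - 1/(2*p))))"
    proof (rule Q.finite_measure_mono)
      show "?G ((36 * B + 3) / L powr (1/2 - 1/(2*p))) \<in> sets (uniform_vector k)"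
        using measurable_cut_dist_sample[OF k1 Lp_sym_measurable[OF U]] by measurable
    qed (use bound in auto)
    finally show "measure (uniform_vector k) {X \<in> space (uniform_vector k).
      cut_dist (sample k U X) U \<le> (36 * sqrt (J + 2) + 3) / (ln (real k)) powr (1/2 - 1/(2*p))}
      \<ge> 1 - 2 * real k powr (- (\<phi> * p))"
      using p1 p2 unfolding B_def L_def by linarith
  qed simp
qed

lemma sample_probability_constant:
  assumes p: "p > 2" and phi: "0 < \<phi>" "\<phi> < 1/2 - 1/p"
  shows "\<exists>C. \<forall>k\<ge>2. \<forall>U\<in>Lp_sym p. Lp_norm p U = b \<longrightarrow>
    measure (uniform_vector k) {X \<in> space (uniform_vector k).
      cut_dist (sample k U X) U \<le> C / (ln (real k)) powr (1/2 - 1/(2*p))}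
    \<ge> 1 - 2 * real k powr (- (\<phi> * p))"
proof -
  define J where "J = b powr p"
  have J: "J \<ge> 0" by (simp add: J_def)
  obtain k0 where k0: "k0 \<ge> 3" "\<And>k U. k \<ge> k0 \<Longrightarrow> U \<in> Lp_sym p \<Longrightarrow> Lp_norm p U powr p = J \<Longrightarrow>
    measure (uniform_vector k) {X \<in> space (uniform_vector k).
      cut_dist (sample k U X) U \<le> (36 * sqrt (J + 2) + 3) / (ln (real k)) powr (1/2 - 1/(2*p))}
    \<ge> 1 - 2 * real k powr (- (\<phi> * p))"
    using sample_probability_large[OF p phi J] by blast
  \<comment> \<open>With this threshold the failure probability in the crude bound is
    \<open>k0 powr (- \<phi> p)\<close>, which is at most \<open>k powr (- \<phi> p)\<close> for
    \<open>k < k0\<close>.\<close>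
  define t where "t = (J + 1) * real k0 powr (\<phi> * p)"
  \<comment> \<open>The second entry covers \<open>k < k0\<close>: there
    \<open>ln k \<le> ln k0\<close>, so \<open>C\<close> divided by the power of \<open>ln k\<close>
    is at least the crude bound \<open>t + (J + 1)\<close>.\<close>
  define C where "C = max (36 * sqrt (J + 2) + 3) ((t + (J + 1)) * ln (real k0) powr (1/2 - 1/(2*p)))"
  have t: "t > 0" using J k0(1) by (simp add: t_def)
  have ex: "1/2 - 1/(2*p) > 0" using p by (simp add: field_simps)
  have phip: "\<phi> * p > 0" using phi p by simp
  show ?thesis
  proof (intro exI[of _ C] allI ballI impI)
    fix k :: nat and U assume k: "k \<ge> 2" and U: "U \<in> Lp_sym p" and b: "Lp_norm p U = b"
    have JU: "Lp_norm p U powr p = J" by (simp add: J_def b)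
    have k1: "k \<ge> 1" using k by simp
    let ?G = "\<lambda>c. {X \<in> space (uniform_vector k). cut_dist (sample k U X) U \<le> c}"
    let ?l = "ln (real k) powr (1/2 - 1/(2*p))"
    have l: "?l > 0" using k by simp
    interpret Q: prob_space "uniform_vector k" by (rule prob_space_uniform_vector)
    have mono: "measure (uniform_vector k) (?G c) \<le> measure (uniform_vector k) (?G c')" if "c \<le> c'" for c c'
    proof (rule Q.finite_measure_mono)
      show "?G c' \<in> sets (uniform_vector k)"
        using measurable_cut_dist_sample[OF k1 Lp_sym_measurable[OF U]] by measurable
    qed (use that in auto)
    show "measure (uniform_vector k) (?G (C / ?l)) \<ge> 1 - 2 * real k powr (- (\<phi> * p))"
    proof (cases "k \<ge> k0")
      case True
      have "(36 * sqrt (J + 2) + 3) / ?l \<le> C / ?l" using l by (simp add: C_def divide_right_mono)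
      from mono[OF this] k0(2)[OF True U JU] show ?thesis by linarith
    next
      case False
      have "1 - (J + 1) / t \<le> measure (uniform_vector k) (?G (t + (J + 1)))"
        using sample_probability_crude[OF U p k1 t] unfolding JU .
      moreover have "(J + 1) / t = real k0 powr (- (\<phi> * p))"
      proof -
        have "J + 1 \<noteq> 0" using J by simp
        then show ?thesis by (simp add: t_def powr_minus_divide)
      qed
      moreover have "real k0 powr (- (\<phi> * p)) \<le> real k powr (- (\<phi> * p))"
        using False k phip by (intro powr_mono2') auto
      moreover have "t + (J + 1) \<le> C / ?l"
      proof -
        have "?l \<le> ln (real k0) powr (1/2 - 1/(2*p))" using False k ex by (intro powr_mono2) auto
        then have "(t + (J + 1)) * ?l \<le> (t + (J + 1)) * ln (real k0) powr (1/2 - 1/(2*p))"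
          using t J by (intro mult_left_mono) auto
        also have "\<dots> \<le> C" by (simp add: C_def)
        finally show ?thesis using l by (simp add: le_divide_eq)
      qed
      from mono[OF this] have "measure (uniform_vector k) (?G (t + (J + 1))) \<le> measure (uniform_vector k) (?G (C / ?l))" .
      moreover have "real k powr (- (\<phi> * p)) \<ge> 0" by simp
      ultimately show ?thesis by linarith
    qed
  qed
qed

theorem theorem2p3:
  shows "\<exists>C :: real \<Rightarrow> real \<Rightarrow> real \<Rightarrow> real \<Rightarrow> real.
    \<forall>(k :: nat) (p :: real) (U :: real \<times> real \<Rightarrow> real) (\<phi> :: real).
      k \<ge> 2 \<longrightarrow> p > 2 \<longrightarrow> U \<in> Lp_sym p \<longrightarrow> \<phi> \<in> {0 <..< 1/2 - 1/p} \<longrightarrow>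
      measure (uniform_vector k)
        {X \<in> space (uniform_vector k).
          cut_dist (sample k U X) U
            \<le> C p (Lp_norm 1 U) (Lp_norm p U) \<phi> / (ln (real k)) powr (1/2 - 1/(2*p))}
        \<ge> 1 - exp (- ((real k)^2 / (2 * log 2 (real k)))) - 4 * real k powr (- (\<phi> * p))"
proof -
  \<comment> \<open>All \<open>k\<close> and all \<open>U\<close> with the given norm share one
    \<open>C\<close>, so a choice by \<open>SOME\<close> depends on the permitted data
    alone.\<close>
  define good where "good p b \<phi> C \<longleftrightarrow> (\<forall>k\<ge>2. \<forall>U\<in>Lp_sym p. Lp_norm p U = b \<longrightarrow>
    measure (uniform_vector k) {X \<in> space (uniform_vector k).
      cut_dist (sample k U X) U \<le> C / (ln (real k)) powr (1/2 - 1/(2*p))}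
    \<ge> 1 - 2 * real k powr (- (\<phi> * p)))" for p b \<phi> C :: real
  show ?thesis
  proof (intro exI[of _ "\<lambda>p a b \<phi>. SOME C. good p b \<phi> C"] allI impI)
    fix k :: nat and p :: real and U :: "real \<times> real \<Rightarrow> real" and \<phi> :: real
    assume k: "k \<ge> 2" and p: "p > 2" and U: "U \<in> Lp_sym p" and phi: "\<phi> \<in> {0 <..< 1/2 - 1/p}"
    have "\<exists>C. good p (Lp_norm p U) \<phi> C"
      unfolding good_def using phi by (intro sample_probability_constant p) auto
    then have "good p (Lp_norm p U) \<phi> (SOME C. good p (Lp_norm p U) \<phi> C)" by (rule someI_ex)
    then have "measure (uniform_vector k) {X \<in> space (uniform_vector k).
      cut_dist (sample k U X) U \<le> (SOME C. good p (Lp_norm p U) \<phi> C) / (ln (real k)) powr (1/2 - 1/(2*p))}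
      \<ge> 1 - 2 * real k powr (- (\<phi> * p))"
      using k U unfolding good_def by blast
    moreover have "exp (- ((real k)^2 / (2 * log 2 (real k)))) \<ge> 0" "real k powr (- (\<phi> * p)) \<ge> 0" by simp_all
    ultimately show "measure (uniform_vector k)
        {X \<in> space (uniform_vector k).
          cut_dist (sample k U X) U
            \<le> (SOME C. good p (Lp_norm p U) \<phi> C) / (ln (real k)) powr (1/2 - 1/(2*p))}
        \<ge> 1 - exp (- ((real k)^2 / (2 * log 2 (real k)))) - 4 * real k powr (- (\<phi> * p))"
      by linarith
  qed
qed

end
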